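(* Let $\nu>0$, let $T:\mathbb{R}\to\mathbb{R}$ be a given temperature profile, let $N\in\mathbb{N}$ and suppose that $T'\in L^\infty(\mathbb{R})$. Consider the linearized Boussinesq equations with vertical dissipation in the velocity only around $v=(y,0)$, $\theta=T(y)$, in coordinates moving with the shear: $$\partial_t\omega=\nu(\partial_y-t\partial_x)^2\omega+\partial_x\theta,\qquad \partial_t\partial_x\theta=T'(y)\,\partial_x v_2,\qquad (t,x,y)\in(0,\infty)\times\mathbb{T}\times\mathbb{R}.$$ If the Fourier transform of $T'$ satisfies $$\sup_{\xi\in\mathbb{R}}\int|\mathcal{F}(T')(z-\xi)|\left(\frac{1+|z|}{1+|\xi|}+\frac{1+|\xi|}{1+|z|}\right)^{N}\left(1+\min(\nu^{-2/3},|z-\xi|^{2/3})\right)dz<\frac{1}{100}\nu^{1/3},$$ then the initial value problem is stable in $H^N\times H^N$ in the sense that there exists a constant $C>0$ such that for any initial data $(\omega_{in},\partial_x\theta_{in})\in H^N\times H^N$ the solution satisfies, for all $t>0$, $$\|\omega(t)\|_{H^N}+\nu\|\partial_x\theta(t)\|_{H^N}\le C\nu^{-2/3}\left(\|\omega_{in}\|_{H^N}+\nu\|\partial_x\theta_{in}\|_{H^N}\right).$$ In particular, if $T(y)=\alpha y$ with $\alpha\in\mathbb{R}$, this stability holds if $\alpha>-\frac{1}{100}\nu^{1/3}$.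
   Context: $\omega,\theta$ are the perturbations of vorticity and temperature, as functions of $(t,x,y)$ in coordinates moving with the shear: a function $f(t,x,y)$ in the original coordinates is replaced by $f(t,x+ty,y)$. Set $\nabla_t=(\partial_x,\ \partial_y-t\partial_x)$ and $\Delta_t=\partial_x^2+(\partial_y-t\partial_x)^2$. The velocity is $v=\nabla_t^\perp\Delta_t^{-1}\omega$ with $\nabla_t^\perp=(\partial_y-t\partial_x,\,-\partial_x)$, so that $v_2=-\partial_x\Delta_t^{-1}\omega$ and the temperature equation reads $\partial_t\partial_x\theta=-T'(y)\partial_x^2\Delta_t^{-1}\omega$; here $\partial_x^2\Delta_t^{-1}$ is the Fourier multiplier $\frac{k^2}{k^2+(\xi-kt)^2}$ for $k\neq0$ and $0$ for $k=0$, where $(k,\xi)\in\mathbb{Z}\times\mathbb{R}$ are the frequencies dual to $(x,y)\in\mathbb{T}\times\mathbb{R}$. $H^N=H^N(\mathbb{T}\times\mathbb{R})$ is the usual Sobolev space. $\mathcal{F}(T')$ is the Fourier transform of $T'$ on $\mathbb{R}$ in the sense of tempered distributions; it may be a measure, in which case $|\mathcal{F}(T')(z-\xi)|\,dz$ denotes integration against its total variation. The normalization is such that $\mathcal{F}(\alpha)=\alpha\,\delta_0$ for a constant $\alpha$. *)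

theory Defs
  imports "HOL-Analysis.Analysis"
begin

section \<open>Fourier transform on the line\<close>

definition schwartz :: "(real \<Rightarrow> complex) \<Rightarrow> bool" where
  "schwartz \<phi> \<longleftrightarrow> (\<exists>D :: nat \<Rightarrow> real \<Rightarrow> complex. D 0 = \<phi> \<and>
     (\<forall>j y. (D j has_vector_derivative D (Suc j) y) (at y)) \<and>
     (\<forall>m j. bounded (range (\<lambda>y. y ^ m *\<^sub>R D j y))))"

text \<open>The factor \<open>1 / (2\<pi>)\<close> sits in the forward transform. The Fourier transform of the
  constant \<open>\<alpha>\<close> is then \<open>\<alpha>\<close> times the Dirac mass at \<open>0\<close>, and products become convolutions
  without a further constant.\<close>

definition fourier_line :: "(real \<Rightarrow> complex) \<Rightarrow> real \<Rightarrow> complex" where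
  "fourier_line \<phi> y = (1 / (2 * pi)) *\<^sub>R (LINT \<xi>|lborel. \<phi> \<xi> * cis (- (\<xi> * y)))"

definition L_infinity :: "(real \<Rightarrow> real) \<Rightarrow> bool" where
  "L_infinity g \<longleftrightarrow> g \<in> borel_measurable borel \<and> (\<exists>B. AE y in lborel. \<bar>g y\<bar> \<le> B)"

text \<open>The derivative \<open>T'\<close> of the profile, for \<open>T'\<close> bounded, is determined almost everywhere:
  \<open>T\<close> is absolutely continuous with density \<open>T'\<close>. Equivalently, \<open>T'\<close> is the distributional
  derivative of \<open>T\<close> and \<open>T\<close> is the continuous representative.\<close>

definition has_density_derivative :: "(real \<Rightarrow> real) \<Rightarrow> (real \<Rightarrow> real) \<Rightarrow> bool" where
  "has_density_derivative T T' \<longleftrightarrow> (\<forall>a b. a \<le> b \<longrightarrow>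
     set_integrable lborel {a..b} T' \<and> T b - T a = (LINT y:{a..b}|lborel. T' y))"

text \<open>The tempered distribution \<open>\<F>(g)\<close> is the complex Radon measure \<open>d\<mu> = h d|\<mu>|\<close>, given
  through its polar decomposition: \<open>M\<close> is the total variation measure \<open>|\<mu>|\<close> and \<open>h\<close> is its
  unimodular density. A function \<open>F\<close> is covered by \<open>M = |F| d\<xi>\<close>, and the constant
  \<open>\<alpha>\<close> by the point mass \<open>\<bar>\<alpha>\<bar>\<close> at \<open>0\<close>.\<close>

definition fourier_is_measure ::
  "(real \<Rightarrow> real) \<Rightarrow> real measure \<Rightarrow> (real \<Rightarrow> complex) \<Rightarrow> bool" where
  "fourier_is_measure g M h \<longleftrightarrow>
     sets M = sets borel \<and> (\<forall>a b. emeasure M {a..b} < \<infinity>) \<and>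
     h \<in> borel_measurable borel \<and> (AE \<eta> in M. cmod (h \<eta>) = 1) \<and>
     (\<forall>\<phi>. schwartz \<phi> \<longrightarrow>
        integrable M (\<lambda>\<eta>. \<phi> \<eta> * h \<eta>) \<and>
        (LINT \<eta>|M. \<phi> \<eta> * h \<eta>) = (LINT y|lborel. g y *\<^sub>R fourier_line \<phi> y))"

text \<open>The integral of \<open>|\<F>(T')(z - \<xi>)| dz\<close> is the integral against the translate
  of \<open>M = |\<F>(T')|\<close> by \<open>\<xi>\<close>.\<close>

definition weighted_variation :: "real \<Rightarrow> nat \<Rightarrow> real measure \<Rightarrow> real \<Rightarrow> ennreal" where
  "weighted_variation \<nu> N M \<xi> =
     (\<integral>\<^sup>+ z. ennreal (((1 + \<bar>z\<bar>) / (1 + \<bar>\<xi>\<bar>) + (1 + \<bar>\<xi>\<bar>) / (1 + \<bar>z\<bar>)) ^ N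
               * (1 + min (\<nu> powr (- (2/3))) (\<bar>z - \<xi>\<bar> powr (2/3))))
      \<partial>distr M borel (\<lambda>\<eta>. \<eta> + \<xi>))"


section \<open>Functions on the cylinder\<close>

text \<open>The torus is \<open>\<real> / 2\<pi>\<int>\<close>. Functions on the cylinder are functions of \<open>(x, y)\<close> that are
  \<open>2\<pi>\<close>-periodic in \<open>x\<close>, and integrals are taken over one period.\<close>

definition cyl :: "(real \<times> real) measure" where
  "cyl = restrict_space lborel ({0..<2 * pi} \<times> UNIV)"

definition periodic_x :: "(real \<times> real \<Rightarrow> 'a) \<Rightarrow> bool" where
  "periodic_x u \<longleftrightarrow> (\<forall>x y. u (x + 2 * pi, y) = u (x, y))"

definition L2_cyl :: "(real \<times> real \<Rightarrow> real) \<Rightarrow> bool" where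
  "L2_cyl u \<longleftrightarrow> u \<in> borel_measurable borel \<and> periodic_x u \<and> integrable cyl (\<lambda>p. (u p)\<^sup>2)"

definition dx :: "(real \<times> real \<Rightarrow> complex) \<Rightarrow> real \<times> real \<Rightarrow> complex" where
  "dx \<phi> = (\<lambda>(x, y). vector_derivative (\<lambda>s. \<phi> (s, y)) (at x))"

definition dy :: "(real \<times> real \<Rightarrow> complex) \<Rightarrow> real \<times> real \<Rightarrow> complex" where
  "dy \<phi> = (\<lambda>(x, y). vector_derivative (\<lambda>s. \<phi> (x, s)) (at y))"

definition dy_shear :: "real \<Rightarrow> (real \<times> real \<Rightarrow> complex) \<Rightarrow> real \<times> real \<Rightarrow> complex" where
  "dy_shear t \<phi> p = dy \<phi> p - t *\<^sub>R dx \<phi> p"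

text \<open>Here \<open>D i j\<close> is the derivative of order \<open>i\<close> in \<open>x\<close> and \<open>j\<close> in \<open>y\<close>.\<close>

definition schwartz_cyl :: "(real \<times> real \<Rightarrow> complex) \<Rightarrow> bool" where
  "schwartz_cyl \<phi> \<longleftrightarrow> periodic_x \<phi> \<and>
     (\<exists>D :: nat \<Rightarrow> nat \<Rightarrow> real \<times> real \<Rightarrow> complex. D 0 0 = \<phi> \<and>
       (\<forall>i j x y.
          ((\<lambda>s. D i j (s, y)) has_vector_derivative D (Suc i) j (x, y)) (at x) \<and>
          ((\<lambda>s. D i j (x, s)) has_vector_derivative D i (Suc j) (x, y)) (at y)) \<and>
       (\<forall>m i j. bounded (range (\<lambda>(x, y). y ^ m *\<^sub>R D i j (x, y)))))"

definition pairing :: "(real \<times> real \<Rightarrow> real) \<Rightarrow> (real \<times> real \<Rightarrow> complex) \<Rightarrow> complex" where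
  "pairing u \<phi> = (LINT p|cyl. u p *\<^sub>R \<phi> p)"

definition weak_dx :: "(real \<times> real \<Rightarrow> real) \<Rightarrow> (real \<times> real \<Rightarrow> real) \<Rightarrow> bool" where
  "weak_dx \<theta> g \<longleftrightarrow> L2_cyl \<theta> \<and> L2_cyl g \<and>
     (\<forall>\<phi>. schwartz_cyl \<phi> \<longrightarrow> pairing \<theta> (dx \<phi>) = - pairing g \<phi>)"

text \<open>\<open>uh k\<close> is the Fourier transform in \<open>y\<close>, in the sense of tempered distributions, of the
  \<open>k\<close>-th Fourier coefficient in \<open>x\<close> of \<open>u\<close>.\<close>

definition is_fourier :: "(real \<times> real \<Rightarrow> real) \<Rightarrow> (int \<Rightarrow> real \<Rightarrow> complex) \<Rightarrow> bool" where
  "is_fourier u uh \<longleftrightarrow> (\<forall>k. uh k \<in> borel_measurable borel \<and>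
     (\<forall>\<phi>. schwartz \<phi> \<longrightarrow>
        integrable lborel (\<lambda>\<xi>. uh k \<xi> * \<phi> \<xi>) \<and>
        (LINT \<xi>|lborel. uh k \<xi> * \<phi> \<xi>) =
          (1 / (2 * pi)) *\<^sub>R pairing u (\<lambda>(x, y). cis (- (of_int k * x)) * fourier_line \<phi> y)))"

text \<open>The Fourier transform of an \<open>L\<^sup>2\<close> function exists and is unique up to null sets, so the
  choice is immaterial below.\<close>

definition fourier_cyl :: "(real \<times> real \<Rightarrow> real) \<Rightarrow> int \<Rightarrow> real \<Rightarrow> complex" where
  "fourier_cyl u = (SOME uh. is_fourier u uh)"

definition sobolev_energy :: "nat \<Rightarrow> (real \<times> real \<Rightarrow> real) \<Rightarrow> ennreal" where
  "sobolev_energy N u =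
     (\<integral>\<^sup>+ k. (\<integral>\<^sup>+ \<xi>. ennreal ((1 + (of_int k)\<^sup>2 + \<xi>\<^sup>2) ^ N * (cmod (fourier_cyl u k \<xi>))\<^sup>2) \<partial>lborel)
      \<partial>count_space UNIV)"

definition in_sobolev :: "nat \<Rightarrow> (real \<times> real \<Rightarrow> real) \<Rightarrow> bool" where
  "in_sobolev N u \<longleftrightarrow> L2_cyl u \<and> (\<exists>uh. is_fourier u uh) \<and> sobolev_energy N u < \<infinity>"

text \<open>The factor \<open>2\<pi>\<close> makes the norm for \<open>N = 0\<close> the \<open>L\<^sup>2\<close> norm.\<close>

definition sobolev_norm :: "nat \<Rightarrow> (real \<times> real \<Rightarrow> real) \<Rightarrow> real" where
  "sobolev_norm N u = 2 * pi * sqrt (enn2real (sobolev_energy N u))"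

definition continuous_in_sobolev :: "nat \<Rightarrow> (real \<Rightarrow> real \<times> real \<Rightarrow> real) \<Rightarrow> bool" where
  "continuous_in_sobolev N u \<longleftrightarrow> (\<forall>t\<ge>0. in_sobolev N (u t)) \<and>
     (\<forall>t\<ge>0. ((\<lambda>s. sobolev_norm N (\<lambda>p. u s p - u t p)) \<longlongrightarrow> 0) (at t within {0..}))"


section \<open>The linearized Boussinesq equations\<close>

text \<open>Symbol of \<open>\<partial>\<^sub>x\<^sup>2 \<Delta>\<^sub>t\<^sup>-\<^sup>1\<close>.\<close>

definition dxx_inv_laplace_symbol :: "real \<Rightarrow> int \<Rightarrow> real \<Rightarrow> real" where
  "dxx_inv_laplace_symbol t k \<xi> =
     (if k = 0 then 0 else (of_int k)\<^sup>2 / ((of_int k)\<^sup>2 + (\<xi> - of_int k * t)\<^sup>2))"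

text \<open>\<open>w = \<partial>\<^sub>x v\<^sub>2\<close> for \<open>v\<^sub>2 = - \<partial>\<^sub>x \<Delta>\<^sub>t\<^sup>-\<^sup>1 \<omega>\<close>.\<close>

definition is_dx_v2 :: "real \<Rightarrow> (real \<times> real \<Rightarrow> real) \<Rightarrow> (real \<times> real \<Rightarrow> real) \<Rightarrow> bool" where
  "is_dx_v2 t \<omega> w \<longleftrightarrow> L2_cyl w \<and>
     (\<exists>\<omega>h. is_fourier \<omega> \<omega>h \<and>
        is_fourier w (\<lambda>k \<xi>. - (of_real (dxx_inv_laplace_symbol t k \<xi>) * \<omega>h k \<xi>)))"

text \<open>Solutions \<open>(\<omega>, \<partial>\<^sub>x\<theta>)\<close> in \<open>C([0,\<infinity>); H\<^sup>N \<times> H\<^sup>N)\<close>, with the equations holding in the sense of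
  distributions; \<open>g t\<close> stands for \<open>\<partial>\<^sub>x\<theta>(t)\<close>. The operator \<open>(\<partial>\<^sub>y - t\<partial>\<^sub>x)\<^sup>2\<close> is formally
  self-adjoint, so it is moved onto the test function without change of sign. The mean of
  \<open>\<theta>\<close> in \<open>x\<close> does not enter the equations, so nothing is lost by \<open>\<theta> \<in> L\<^sup>2\<close> in
  \<^const>\<open>weak_dx\<close>.\<close>

definition boussinesq_solution ::
  "real \<Rightarrow> (real \<Rightarrow> real) \<Rightarrow> nat \<Rightarrow> (real \<Rightarrow> real \<times> real \<Rightarrow> real) \<Rightarrow>
   (real \<Rightarrow> real \<times> real \<Rightarrow> real) \<Rightarrow> (real \<Rightarrow> real \<times> real \<Rightarrow> real) \<Rightarrow> bool" where
  "boussinesq_solution \<nu> T' N \<omega> \<theta> g \<longleftrightarrow>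
     continuous_in_sobolev N \<omega> \<and> continuous_in_sobolev N g \<and>
     (\<forall>t\<ge>0. weak_dx (\<theta> t) (g t)) \<and>
     (\<exists>w. (\<forall>t>0. is_dx_v2 t (\<omega> t) (w t)) \<and>
       (\<forall>\<phi> t. schwartz_cyl \<phi> \<longrightarrow> t > 0 \<longrightarrow>
          ((\<lambda>s. pairing (\<omega> s) \<phi>) has_vector_derivative
             \<nu> *\<^sub>R pairing (\<omega> t) (dy_shear t (dy_shear t \<phi>)) + pairing (g t) \<phi>) (at t) \<and>
          ((\<lambda>s. pairing (g s) \<phi>) has_vector_derivative
             pairing (\<lambda>(x, y). T' y * w t (x, y)) \<phi>) (at t)))"

text \<open>The constant \<open>C\<close> may depend on \<open>\<nu>\<close>, \<open>T'\<close> and \<open>N\<close>, but not on the data or the time.\<close>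

definition boussinesq_stable :: "real \<Rightarrow> (real \<Rightarrow> real) \<Rightarrow> nat \<Rightarrow> bool" where
  "boussinesq_stable \<nu> T' N \<longleftrightarrow> (\<exists>C>0. \<forall>\<omega>_in \<theta>_in g_in.
     in_sobolev N \<omega>_in \<and> in_sobolev N g_in \<and> weak_dx \<theta>_in g_in \<longrightarrow>
     (\<forall>\<omega> \<theta> g. boussinesq_solution \<nu> T' N \<omega> \<theta> g \<and> \<omega> 0 = \<omega>_in \<and> g 0 = g_in \<longrightarrow>
        (\<forall>t>0. sobolev_norm N (\<omega> t) + \<nu> * sobolev_norm N (g t) \<le>
           C * \<nu> powr (- (2/3)) * (sobolev_norm N \<omega>_in + \<nu> * sobolev_norm N g_in))))"

end

theory Submission
  imports Defs "HOL-Probability.Probability" "HOL-Computational_Algebra.Polynomial"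
begin

text \<open>On the Fourier side the modes \<open>k\<close> decouple. With \<open>\<mu> = \<F>(T')\<close> and
\<open>\<kappa>(t, \<xi>) = 1 / (1 + (t - \<xi>/k)\<^sup>2)\<close> (and \<open>\<kappa> = 0\<close> for \<open>k = 0\<close>), the transforms \<open>u\<close> of
\<open>\<omega>\<close> and \<open>\<gamma>\<close> of \<open>\<partial>\<^sub>x\<theta>\<close> satisfy
\<open>\<partial>\<^sub>t u = - \<nu> (\<xi> - k t)\<^sup>2 u + \<gamma>\<close> and \<open>\<partial>\<^sub>t \<gamma> = - \<mu> * (\<kappa> u)\<close>. Stability rests on two bounds
that are uniform in the frequency.

\<^item> Damping. For \<open>k = 0\<close> the forcing \<open>\<gamma>\<close> vanishes. For \<open>k \<noteq> 0\<close>, if \<open>|\<gamma>| \<le> G\<close> up to time \<open>t\<close>, then \<open>|u(t)| \<le> |u(0)| + C G\<close> with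
  \<open>C = (1 + \<pi>) \<nu>\<^sup>-\<^sup>1\<^sup>/\<^sup>3\<close> (\<open>damped_ode_bound\<close>): outside the window of length \<open>\<nu>\<^sup>-\<^sup>1\<^sup>/\<^sup>3\<close> around the
  critical time \<open>\<xi>/k\<close> the damping rate is at least of order \<open>\<nu>\<^sup>1\<^sup>/\<^sup>3\<close>.
\<^item> Integrability of the resonance. The total integral of \<open>\<kappa>\<close> over time is at most \<open>\<pi>\<close>. Hence
  \<open>a(\<xi>) = \<integral> \<kappa> |u| dt\<close> is at most \<open>\<pi>\<close> times the supremum of \<open>|u|\<close> over time, while
  \<open>|\<gamma>(t)| \<le> |\<gamma>(0)| + |\<mu>| * a\<close> at all times.

Together, \<open>a \<le> \<pi> (|u(0)| + C |\<gamma>(0)| + C |\<mu>| * a)\<close> pointwise in \<open>\<xi>\<close>. By Schur's test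
(\<open>weighted_convolution_bound\<close>) convolution with \<open>|\<mu>|\<close> has norm at most \<open>\<nu>\<^sup>1\<^sup>/\<^sup>3 / 100\<close> on the
weighted \<open>L\<^sup>2\<close> space, and \<open>\<pi> (1 + \<pi>) / 100\<close> is small, so the last term is absorbed
(\<open>mode_estimate_small\<close>). For a linear profile \<open>\<mu>\<close> is a point mass at \<open>0\<close>, single frequencies
decouple, and Gronwall's inequality with respect to the finite measure \<open>\<kappa> dt\<close> takes the place of
the absorption (\<open>resonant_gronwall\<close>, \<open>mode_estimate_local\<close>).

What remains is to reach these pointwise equations from solutions in the sense of distributions.
Gaussians with arbitrary modulation separate functions (\<open>gauss_separating\<close>, a form of the
uniqueness theorem for characteristic functions) and have explicit transforms, so no other test
functions are used. The product \<open>T' \<partial>\<^sub>x v\<^sub>2\<close> becomes a convolution because \<open>T'\<close> agrees almost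
everywhere with the superposition of characters \<open>\<integral> e\<^sup>i\<^sup>\<eta>\<^sup>y d\<mu>(\<eta>)\<close>
(\<open>character_representation_of_fourier\<close>). Since \<open>t \<mapsto> u(t)\<close> is continuous into \<open>L\<^sup>2\<close>, it has a
version that is measurable in \<open>(t, \<xi>)\<close> jointly (\<open>measurable_version\<close>); the equations integrated in
time then hold for almost every \<open>\<xi>\<close>, and there they are ordinary differential equations
(\<open>pathwise_system\<close>).\<close>

section \<open>Schwartz functions and Gaussians on the line\<close>

lemma schwartz_derivative:
  assumes "schwartz \<phi>"
  obtains \<phi>' where "schwartz \<phi>'" "\<And>y. (\<phi> has_vector_derivative \<phi>' y) (at y)"
proof -
  from assms obtain D where D: "D 0 = \<phi>"
     "\<And>j y. (D j has_vector_derivative D (Suc j) y) (at y)"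
     "\<And>m j. bounded (range (\<lambda>y. y ^ m *\<^sub>R D j y))"
    unfolding schwartz_def by blast
  have "schwartz (D 1)"
    unfolding schwartz_def by (rule exI[of _ "\<lambda>j. D (Suc j)"]) (use D in auto)
  moreover have "(\<phi> has_vector_derivative D 1 y) (at y)" for y
    using D(2)[of 0 y] D(1) by simp
  ultimately show thesis by (rule that)
qed

lemma schwartz_decay:
  assumes "schwartz \<phi>"
  obtains B where "B \<ge> 0" "\<And>y. cmod (\<phi> y) * \<bar>y\<bar> ^ m \<le> B"
proof -
  from assms obtain D where D: "D 0 = \<phi>"
     "\<And>j y. (D j has_vector_derivative D (Suc j) y) (at y)"
     "\<And>m j. bounded (range (\<lambda>y. y ^ m *\<^sub>R D j y))"
    unfolding schwartz_def by blast
  from D(3)[of m 0] obtain B where "\<And>y. norm (y ^ m *\<^sub>R \<phi> y) \<le> B"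
    unfolding D(1) bounded_iff by auto
  then show thesis
    by (intro that[of "max B 0"]) (auto simp: power_abs mult.commute le_max_iff_disj)
qed

lemma schwartz_continuous: "schwartz \<phi> \<Longrightarrow> continuous_on UNIV \<phi>"
  by (metis schwartz_derivative continuous_at_imp_continuous_on has_vector_derivative_continuous)

lemma schwartz_measurable [measurable_dest]:
  "schwartz \<phi> \<Longrightarrow> \<phi> \<in> borel_measurable borel"
  by (intro borel_measurable_continuous_onI schwartz_continuous)

lemma integrable_inverse_one_plus_square: "integrable lborel (\<lambda>x::real. inverse (1 + x\<^sup>2))"
  using integrable_inverse_1_plus_square unfolding set_integrable_def by simp

lemma integrable_of_decay:
  fixes f :: "real \<Rightarrow> 'a::{banach, second_countable_topology}"
  assumes "f \<in> borel_measurable borel"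
    and "\<And>y. norm (f y) \<le> B" "\<And>y. norm (f y) * y\<^sup>2 \<le> C"
  shows "integrable lborel f"
proof (rule Bochner_Integration.integrable_bound)
  show "integrable lborel (\<lambda>x::real. (B + C) * inverse (1 + x\<^sup>2))"
    by (intro integrable_mult_right integrable_inverse_one_plus_square)
  have "norm (f y) \<le> (B + C) * inverse (1 + y\<^sup>2)" for y
  proof -
    have pos: "1 + y\<^sup>2 > 0" by (simp add: add_pos_nonneg)
    have "norm (f y) * (1 + y\<^sup>2) \<le> B + C" using assms(2,3)[of y] by (simp add: distrib_left)
    then show ?thesis using pos by (simp add: field_simps)
  qed
  then show "AE x in lborel. norm (f x) \<le> norm ((B + C) * inverse (1 + x\<^sup>2))"
    by (intro AE_I2) (metis abs_ge_self order_trans real_norm_def)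
qed (use assms in auto)

lemma schwartz_integrable:
  assumes "schwartz \<phi>"
  shows "integrable lborel \<phi>"
proof -
  obtain B where B: "\<And>y. cmod (\<phi> y) * \<bar>y\<bar> ^ 0 \<le> B" using schwartz_decay[OF assms, of 0] by blast
  obtain C where C: "\<And>y. cmod (\<phi> y) * \<bar>y\<bar> ^ 2 \<le> C" using schwartz_decay[OF assms, of 2] by blast
  show ?thesis
    by (rule integrable_of_decay[of _ B C]) (use assms B C in \<open>auto intro: schwartz_measurable\<close>)
qed

lemma schwartz_vanishes:
  assumes "schwartz \<phi>"
  shows "(\<phi> \<longlongrightarrow> 0) at_top" "(\<phi> \<longlongrightarrow> 0) at_bot"
proof -
  obtain B where B: "B \<ge> 0" "\<And>y. cmod (\<phi> y) * \<bar>y\<bar> ^ 1 \<le> B" using schwartz_decay[OF assms, of 1] by blast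
  have le: "norm (\<phi> y) \<le> B * inverse \<bar>y\<bar>" if "y \<noteq> 0" for y
    using B(2)[of y] that by (simp add: field_simps)
  show "(\<phi> \<longlongrightarrow> 0) at_top"
  proof (rule Lim_null_comparison)
    show "\<forall>\<^sub>F x in at_top. norm (\<phi> x) \<le> B * inverse \<bar>x\<bar>"
      using eventually_gt_at_top[of 0] by eventually_elim (rule le, simp)
    show "((\<lambda>x. B * inverse \<bar>x\<bar>) \<longlongrightarrow> 0) at_top" by real_asymp
  qed
  show "(\<phi> \<longlongrightarrow> 0) at_bot"
  proof (rule Lim_null_comparison)
    show "\<forall>\<^sub>F x in at_bot. norm (\<phi> x) \<le> B * inverse \<bar>x\<bar>"
      using eventually_gt_at_bot[of 0] by eventually_elim (rule le, simp)
    show "((\<lambda>x. B * inverse \<bar>x\<bar>) \<longlongrightarrow> 0) at_bot" by real_asymp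
  qed
qed

lemma has_vector_derivative_cis_linear:
  "((\<lambda>\<xi>. cis (a * \<xi>)) has_vector_derivative (\<i> * of_real a * cis (a * \<xi>))) (at \<xi>)"
  unfolding cis_conv_exp
  by (rule has_vector_derivative_real_field derivative_eq_intros refl | simp)+

lemma integrable_mult_cis:
  assumes "integrable lborel (f :: real \<Rightarrow> complex)"
  shows "integrable lborel (\<lambda>\<xi>. f \<xi> * cis (a * \<xi>))"
proof (rule Bochner_Integration.integrable_bound[OF assms])
  have [measurable]: "f \<in> borel_measurable borel" using assms by auto
  have [measurable]: "(\<lambda>\<xi>. cis (a * \<xi>)) \<in> borel_measurable borel"
    by (intro borel_measurable_continuous_onI continuous_intros)
  show "(\<lambda>\<xi>. f \<xi> * cis (a * \<xi>)) \<in> borel_measurable lborel" by measurable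
qed (simp add: norm_mult)

lemma fourier_line_derivative:
  assumes "schwartz \<phi>" "schwartz \<phi>'" "\<And>y. (\<phi> has_vector_derivative \<phi>' y) (at y)"
  shows "fourier_line \<phi>' y = \<i> * of_real y * fourier_line \<phi> y"
proof -
  let ?e = "\<lambda>\<xi>. cis (- y * \<xi>)"
  let ?f = "\<lambda>\<xi>. \<phi>' \<xi> * ?e \<xi> - \<i> * of_real y * (\<phi> \<xi> * ?e \<xi>)"
  have i1: "integrable lborel (\<lambda>\<xi>. \<phi>' \<xi> * ?e \<xi>)" and i2: "integrable lborel (\<lambda>\<xi>. \<phi> \<xi> * ?e \<xi>)"
    by (rule integrable_mult_cis[OF schwartz_integrable[OF assms(2)]]
             integrable_mult_cis[OF schwartz_integrable[OF assms(1)]])+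
  have cont: "isCont \<phi> x" "isCont \<phi>' x" for x
    using schwartz_continuous[OF assms(1)] schwartz_continuous[OF assms(2)]
    by (auto simp: continuous_on_eq_continuous_at)
  have "(LBINT x=-\<infinity>..\<infinity>. ?f x) = 0 - 0"
  proof (rule interval_integral_FTC_integrable)
    show "((\<lambda>\<xi>. \<phi> \<xi> * ?e \<xi>) has_vector_derivative ?f x) (at x)" for x
      by (rule has_vector_derivative_eq_rhs[OF has_vector_derivative_mult[OF assms(3) has_vector_derivative_cis_linear]])
         (simp add: algebra_simps)
    show "isCont ?f x" for x
      unfolding cis_conv_exp by (intro continuous_intros cont)
    show "set_integrable lborel (einterval (-\<infinity>) \<infinity>) ?f"
      unfolding set_integrable_def using i1 i2 by simp
    have n: "norm (\<phi> \<xi> * ?e \<xi>) = norm (\<phi> \<xi>)" for \<xi> by (simp add: norm_mult)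
    show "(((\<lambda>\<xi>. \<phi> \<xi> * ?e \<xi>) \<circ> real_of_ereal) \<longlongrightarrow> 0) (at_right (-\<infinity>))"
      unfolding ereal_tendsto_simps
      by (rule tendsto_norm_zero_cancel) (simp only: n tendsto_norm_zero_iff schwartz_vanishes[OF assms(1)])
    show "(((\<lambda>\<xi>. \<phi> \<xi> * ?e \<xi>) \<circ> real_of_ereal) \<longlongrightarrow> 0) (at_left \<infinity>)"
      unfolding ereal_tendsto_simps
      by (rule tendsto_norm_zero_cancel) (simp only: n tendsto_norm_zero_iff schwartz_vanishes[OF assms(1)])
  qed simp
  then have "(LINT \<xi>|lborel. ?f \<xi>) = 0"
    by (simp add: interval_lebesgue_integral_def set_lebesgue_integral_def)
  then have "(LINT \<xi>|lborel. \<phi>' \<xi> * ?e \<xi>) = \<i> * of_real y * (LINT \<xi>|lborel. \<phi> \<xi> * ?e \<xi>)"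
    using i1 i2 by simp
  then show ?thesis
    unfolding fourier_line_def by (simp add: mult.commute[of y] mult_scaleR_right)
qed

lemma fourier_line_measurable [measurable (raw)]:
  assumes "schwartz \<phi>" shows "fourier_line \<phi> \<in> borel_measurable borel"
proof -
  have [measurable]: "\<phi> \<in> borel_measurable borel" using assms by (rule schwartz_measurable)
  have [measurable]: "(\<lambda>(y, \<xi>). cis (- (\<xi> * y))) \<in> borel_measurable (borel \<Otimes>\<^sub>M borel)"
    unfolding borel_prod by (intro borel_measurable_continuous_onI) (auto simp: split_beta' intro!: continuous_intros)
  show ?thesis unfolding fourier_line_def[abs_def] by measurable
qed

lemma fourier_line_norm_le:
  assumes "schwartz \<phi>"
  shows "cmod (fourier_line \<phi> y) \<le> (LINT \<xi>|lborel. cmod (\<phi> \<xi>))"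
proof -
  have "cmod (fourier_line \<phi> y) \<le> 1 * cmod (LINT \<xi>|lborel. \<phi> \<xi> * cis (- (\<xi> * y)))"
    unfolding fourier_line_def norm_scaleR using pi_gt3
    by (intro mult_right_mono) (auto simp: divide_simps)
  also have "\<dots> \<le> 1 * (LINT \<xi>|lborel. cmod (\<phi> \<xi> * cis (- (\<xi> * y))))"
    by (intro mult_left_mono integral_norm_bound) auto
  finally show ?thesis by (simp add: norm_mult)
qed

text \<open>One integration by parts gives decay of order \<open>1 / |y|\<close>. This makes the pairing of an \<open>L\<^sup>2\<close>
function on the cylinder with the transform of any Schwartz function an absolutely convergent
integral.\<close>

lemma fourier_line_square_integrable:
  assumes "schwartz \<phi>"
  shows "integrable lborel (\<lambda>y. (cmod (fourier_line \<phi> y))\<^sup>2)"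
proof -
  obtain \<phi>' where \<phi>': "schwartz \<phi>'" "\<And>y. (\<phi> has_vector_derivative \<phi>' y) (at y)"
    using schwartz_derivative[OF assms] by blast
  have [measurable]: "fourier_line \<phi> \<in> borel_measurable borel"
    using assms by (rule fourier_line_measurable)
  let ?A = "LINT \<xi>|lborel. cmod (\<phi> \<xi>)" and ?B = "LINT \<xi>|lborel. cmod (\<phi>' \<xi>)"
  have "(cmod (fourier_line \<phi> y))\<^sup>2 * y\<^sup>2 \<le> ?B\<^sup>2" for y
  proof -
    have "cmod (fourier_line \<phi> y) * \<bar>y\<bar> = cmod (fourier_line \<phi>' y)"
      by (subst fourier_line_derivative[OF assms \<phi>']) (simp add: norm_mult)
    also have "\<dots> \<le> ?B" by (rule fourier_line_norm_le[OF \<phi>'(1)])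
    finally have "(cmod (fourier_line \<phi> y) * \<bar>y\<bar>)\<^sup>2 \<le> ?B\<^sup>2" by (intro power_mono) auto
    then show ?thesis by (simp add: power_mult_distrib)
  qed
  moreover have "(cmod (fourier_line \<phi> y))\<^sup>2 \<le> ?A\<^sup>2" for y
    by (intro power_mono fourier_line_norm_le[OF assms]) auto
  ultimately show ?thesis
    by (intro integrable_of_decay[of _ "?A\<^sup>2" "?B\<^sup>2"]) auto
qed

text \<open>The linear coefficient \<open>c\<close> is complex: its imaginary part is a modulation and its real part a
translation. Up to constant factors, the family is closed under translation and under the
Fourier transform.\<close>

definition gauss :: "complex \<Rightarrow> real \<Rightarrow> complex" where
  "gauss c \<xi> = exp (c * of_real \<xi> - (of_real \<xi>)\<^sup>2 / 2)"

lemma norm_gauss: "cmod (gauss c \<xi>) = exp (Re c * \<xi> - \<xi>\<^sup>2 / 2)"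
proof -
  have "Re (c * of_real \<xi> - (of_real \<xi>)\<^sup>2 / 2) = Re c * \<xi> - \<xi>\<^sup>2 / 2"
    by (simp add: power2_eq_square)
  then show ?thesis by (simp add: gauss_def norm_exp_eq_Re)
qed

lemma power_times_gauss_bounded: "\<exists>B\<ge>0. \<forall>\<xi>. \<bar>\<xi>\<bar> ^ n * cmod (gauss c \<xi>) \<le> B"
proof (intro exI conjI allI)
  let ?a = "\<bar>Re c\<bar> + 1"
  fix \<xi> :: real
  have "(\<Sum>i\<in>{n}. \<bar>\<xi>\<bar> ^ i /\<^sub>R fact i) \<le> exp \<bar>\<xi>\<bar>"
    by (subst sums_unique[OF exp_converges], rule sum_le_suminf) (use summable_exp in auto)
  then have "\<bar>\<xi>\<bar> ^ n \<le> fact n * exp \<bar>\<xi>\<bar>" by (simp add: field_simps)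
  then have "\<bar>\<xi>\<bar> ^ n * cmod (gauss c \<xi>) \<le> fact n * exp \<bar>\<xi>\<bar> * exp (Re c * \<xi> - \<xi>\<^sup>2 / 2)"
    unfolding norm_gauss by (intro mult_right_mono) auto
  also have "\<dots> = fact n * exp (\<bar>\<xi>\<bar> + (Re c * \<xi> - \<xi>\<^sup>2 / 2))"
    by (simp only: exp_add mult.assoc)
  also have "\<dots> \<le> fact n * exp (?a\<^sup>2 / 2)"
  proof (intro mult_left_mono iffD2[OF exp_le_cancel_iff])
    \<comment> \<open>The majorant \<open>|\<xi>| + |Re c| |\<xi>| - \<xi>\<^sup>2 / 2\<close> is maximal at \<open>|\<xi>| = |Re c| + 1\<close>.\<close>
    have "Re c * \<xi> \<le> \<bar>Re c\<bar> * \<bar>\<xi>\<bar>" by (metis abs_ge_self abs_mult)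
    moreover have "0 \<le> (?a - \<bar>\<xi>\<bar>)\<^sup>2" by simp
    ultimately show "\<bar>\<xi>\<bar> + (Re c * \<xi> - \<xi>\<^sup>2 / 2) \<le> ?a\<^sup>2 / 2"
      by (simp add: power2_eq_square algebra_simps)
  qed auto
  finally show "\<bar>\<xi>\<bar> ^ n * cmod (gauss c \<xi>) \<le> fact n * exp (?a\<^sup>2 / 2)" .
qed auto

lemma poly_times_gauss_bounded:
  "\<exists>B\<ge>0. \<forall>\<xi>. cmod (poly p (of_real \<xi>) * gauss c \<xi>) * \<bar>\<xi>\<bar> ^ n \<le> B"
proof (induction p arbitrary: n)
  case 0 show ?case by (auto intro!: exI[of _ 0])
next
  case (pCons a p)
  obtain B where B: "B \<ge> 0" "\<And>\<xi>. cmod (poly p (of_real \<xi>) * gauss c \<xi>) * \<bar>\<xi>\<bar> ^ Suc n \<le> B"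
    using pCons.IH[of "Suc n"] by blast
  obtain C where C: "C \<ge> 0" "\<And>\<xi>. \<bar>\<xi>\<bar> ^ n * cmod (gauss c \<xi>) \<le> C"
    using power_times_gauss_bounded by metis
  have "cmod (poly (pCons a p) (of_real \<xi>) * gauss c \<xi>) * \<bar>\<xi>\<bar> ^ n \<le> cmod a * C + B" for \<xi>
  proof -
    have "cmod (poly (pCons a p) (of_real \<xi>) * gauss c \<xi>) \<le>
        cmod (a * gauss c \<xi>) + cmod (of_real \<xi> * (poly p (of_real \<xi>) * gauss c \<xi>))"
      by (simp add: distrib_right mult.assoc norm_triangle_ineq)
    then have "cmod (poly (pCons a p) (of_real \<xi>) * gauss c \<xi>) * \<bar>\<xi>\<bar> ^ n \<le>
        (cmod (a * gauss c \<xi>) + cmod (of_real \<xi> * (poly p (of_real \<xi>) * gauss c \<xi>))) * \<bar>\<xi>\<bar> ^ n"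
      by (intro mult_right_mono) auto
    also have "\<dots> = cmod a * (\<bar>\<xi>\<bar> ^ n * cmod (gauss c \<xi>)) + cmod (poly p (of_real \<xi>) * gauss c \<xi>) * \<bar>\<xi>\<bar> ^ Suc n"
      by (simp add: norm_mult algebra_simps)
    also have "\<dots> \<le> cmod a * C + B"
      by (intro add_mono mult_left_mono B C) auto
    finally show ?thesis .
  qed
  then show ?case using B C by (intro exI[of _ "cmod a * C + B"]) auto
qed

lemma has_vector_derivative_poly_gauss:
  "((\<lambda>\<xi>. poly p (of_real \<xi>) * gauss c \<xi>) has_vector_derivative
     poly (pderiv p + p * [:c, -1:]) (of_real \<xi>) * gauss c \<xi>) (at \<xi>)"
proof -
  have "((\<lambda>z. poly p z * exp (c * z - z\<^sup>2 / 2)) has_field_derivative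
     poly (pderiv p + p * [:c, -1:]) z * exp (c * z - z\<^sup>2 / 2)) (at z)" for z
    by (rule derivative_eq_intros refl poly_DERIV | simp)+ (simp add: algebra_simps)
  from has_vector_derivative_real_field[OF this]
  show ?thesis unfolding gauss_def .
qed

lemma schwartz_poly_gauss: "schwartz (\<lambda>\<xi>. poly p (of_real \<xi>) * gauss c \<xi>)"
proof -
  define q where "q j = ((\<lambda>p. pderiv p + p * [:c, -1:]) ^^ j) p" for j
  show ?thesis
    unfolding schwartz_def
  proof (intro exI conjI allI)
    show "(\<lambda>\<xi>. poly (q 0) (of_real \<xi>) * gauss c \<xi>) = (\<lambda>\<xi>. poly p (of_real \<xi>) * gauss c \<xi>)"
      by (simp add: q_def)
    show "((\<lambda>\<xi>. poly (q j) (of_real \<xi>) * gauss c \<xi>) has_vector_derivative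
       poly (q (Suc j)) (of_real y) * gauss c y) (at y)" for j y
      using has_vector_derivative_poly_gauss[of "q j" c y] by (simp add: q_def)
    show "bounded (range (\<lambda>y. y ^ m *\<^sub>R (poly (q j) (of_real y) * gauss c y)))" for m j
    proof -
      obtain B where B: "\<And>\<xi>. cmod (poly (q j) (of_real \<xi>) * gauss c \<xi>) * \<bar>\<xi>\<bar> ^ m \<le> B"
        using poly_times_gauss_bounded by metis
      show ?thesis unfolding bounded_iff
        by (intro exI[of _ B]) (use B in \<open>auto simp: power_abs mult.commute\<close>)
    qed
  qed
qed

lemma schwartz_gauss: "schwartz (gauss c)"
  using schwartz_poly_gauss[of "[:1:]" c] by simp

lemma gauss_shift: "gauss c (\<xi> + \<eta>) = gauss c \<eta> * gauss (c - of_real \<eta>) \<xi>"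
proof -
  have "c * of_real (\<xi> + \<eta>) - (of_real (\<xi> + \<eta>))\<^sup>2 / 2 =
      (c * of_real \<eta> - (of_real \<eta>)\<^sup>2 / 2) + ((c - of_real \<eta>) * of_real \<xi> - (of_real \<xi>)\<^sup>2 / 2)"
    by (simp add: power2_eq_square field_simps)
  then show ?thesis by (simp only: gauss_def exp_add)
qed

lemma schwartz_gauss_shift: "schwartz (\<lambda>\<xi>. gauss c (\<xi> + \<eta>))"
  using schwartz_poly_gauss[of "[:gauss c \<eta>:]" "c - of_real \<eta>"] by (simp add: gauss_shift)

section \<open>Gaussians separate functions\<close>

text \<open>Positive and negative part of \<open>v\<close> have the same total integral. Normalized, they are probability
densities with equal characteristic functions, and these determine a distribution.\<close>

lemma char_zero_imp_zero_real:
  fixes v :: "real \<Rightarrow> real"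
  assumes v: "integrable lborel v"
    and zero: "\<And>b. (LINT \<xi>|lborel. v \<xi> *\<^sub>R cis (b * \<xi>)) = 0"
  shows "AE \<xi> in lborel. v \<xi> = 0"
proof -
  have [measurable]: "v \<in> borel_measurable borel" using v by auto
  have [measurable]: "(\<lambda>\<xi>. cis (b * \<xi>)) \<in> borel_measurable borel" for b
    by (intro borel_measurable_continuous_onI) (auto simp: cis_conv_exp intro!: continuous_intros)
  define p where "p \<xi> = max 0 (v \<xi>)" for \<xi>
  define m where "m \<xi> = max 0 (- v \<xi>)" for \<xi>
  have v_eq: "v \<xi> = p \<xi> - m \<xi>" for \<xi> by (simp add: p_def m_def max_def)
  have [simp]: "p \<xi> \<ge> 0" "m \<xi> \<ge> 0" for \<xi> by (auto simp: p_def m_def)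
  have [measurable]: "p \<in> borel_measurable borel" "m \<in> borel_measurable borel"
    unfolding p_def m_def by measurable
  have ip: "integrable lborel p" and im: "integrable lborel m"
    unfolding p_def m_def using v by auto
  have ic: "integrable lborel (\<lambda>\<xi>. f \<xi> *\<^sub>R cis (b * \<xi>))" if "integrable lborel f" for f :: "real \<Rightarrow> real" and b
    using integrable_mult_cis[of "\<lambda>\<xi>. of_real (f \<xi>)" b] that by (simp add: scaleR_conv_of_real)
  have split: "(LINT \<xi>|lborel. p \<xi> *\<^sub>R cis (b * \<xi>)) = (LINT \<xi>|lborel. m \<xi> *\<^sub>R cis (b * \<xi>))" for b
    using zero[of b] ic[OF ip, of b] ic[OF im, of b] by (simp add: v_eq scaleR_diff_left)
  define c where "c = (LINT \<xi>|lborel. p \<xi>)"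
  have "complex_of_real (LINT \<xi>|lborel. v \<xi>) = 0"
    using zero[of 0] v by (simp add: scaleR_conv_of_real)
  then have c': "(LINT \<xi>|lborel. m \<xi>) = c"
    using ip im unfolding v_eq c_def by simp
  have "c \<ge> 0" unfolding c_def by simp
  show ?thesis
  proof (cases "c = 0")
    case True
    have "AE \<xi> in lborel. p \<xi> = 0" "AE \<xi> in lborel. m \<xi> = 0"
      using integral_nonneg_eq_0_iff_AE[OF ip] integral_nonneg_eq_0_iff_AE[OF im] c' True c_def by auto
    then show ?thesis by eventually_elim (simp add: v_eq)
  next
    case False
    with \<open>c \<ge> 0\<close> have "c > 0" by simp
    define \<mu> where "\<mu> f = density lborel (\<lambda>\<xi>. ennreal (f \<xi> / c))" for f :: "real \<Rightarrow> real"
    have rd: "real_distribution (\<mu> f)"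
      if "integrable lborel f" "(LINT \<xi>|lborel. f \<xi>) = c" "\<And>\<xi>. f \<xi> \<ge> 0" for f
    proof -
      have [measurable]: "f \<in> borel_measurable borel" using that by auto
      have "(\<integral>\<^sup>+\<xi>. ennreal (f \<xi> / c) \<partial>lborel) = ennreal (LINT \<xi>|lborel. f \<xi> / c)"
        using that \<open>c > 0\<close> by (intro nn_integral_eq_integral) auto
      then have "prob_space (\<mu> f)"
        using that \<open>c > 0\<close> by (intro prob_spaceI) (simp add: \<mu>_def emeasure_density)
      then show ?thesis
        by (simp add: real_distribution_def real_distribution_axioms_def \<mu>_def)
    qed
    have ch: "char (\<mu> f) b = (LINT \<xi>|lborel. f \<xi> *\<^sub>R cis (b * \<xi>)) / of_real c"
      if "integrable lborel f" "\<And>\<xi>. f \<xi> \<ge> 0" for f b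
    proof -
      have [measurable]: "f \<in> borel_measurable borel" using that by auto
      have "char (\<mu> f) b = (LINT \<xi>|lborel. (f \<xi> / c) *\<^sub>R cis (b * \<xi>))"
        unfolding char_def \<mu>_def using that \<open>c > 0\<close> 
        by (subst integral_density) (auto simp: cis_conv_exp)
      also have "\<dots> = (LINT \<xi>|lborel. f \<xi> *\<^sub>R cis (b * \<xi>) / of_real c)"
        by (intro Bochner_Integration.integral_cong) (auto simp: scaleR_conv_of_real)
      finally show ?thesis by simp
    qed
    have "\<mu> p = \<mu> m"
    proof (rule Levy_uniqueness)
      show "char (\<mu> p) = char (\<mu> m)"
        using split by (intro ext) (simp add: ch ip im)
    qed (use rd ip im c' c_def in auto)
    then have "AE \<xi> in lborel. ennreal (p \<xi> / c) = ennreal (m \<xi> / c)"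
      unfolding \<mu>_def by (subst (asm) sigma_finite_measure.density_unique_iff[OF lborel.sigma_finite_measure_axioms]) auto
    then show ?thesis
      by eventually_elim (use \<open>c > 0\<close> in \<open>simp add: v_eq\<close>)
  qed
qed

lemma char_zero_imp_zero:
  fixes f :: "real \<Rightarrow> complex"
  assumes f: "integrable lborel f"
    and zero: "\<And>b. (LINT \<xi>|lborel. f \<xi> * cis (b * \<xi>)) = 0"
  shows "AE \<xi> in lborel. f \<xi> = 0"
proof -
  have i: "integrable lborel (\<lambda>\<xi>. f \<xi> * cis (b * \<xi>))" for b
    by (rule integrable_mult_cis[OF f])
  have zero': "(LINT \<xi>|lborel. cnj (f \<xi>) * cis (b * \<xi>)) = 0"
    and i': "integrable lborel (\<lambda>\<xi>. cnj (f \<xi>) * cis (b * \<xi>))" for b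
  proof -
    have eq: "cnj (f \<xi>) * cis (b * \<xi>) = cnj (f \<xi> * cis (- b * \<xi>))" for \<xi> by (simp add: cis_cnj)
    show "(LINT \<xi>|lborel. cnj (f \<xi>) * cis (b * \<xi>)) = 0" 
      by (simp only: eq Bochner_Integration.integral_cnj zero complex_cnj_zero)
    show "integrable lborel (\<lambda>\<xi>. cnj (f \<xi>) * cis (b * \<xi>))"
      unfolding eq using i[of "-b"] by (simp only: integrable_cnj)
  qed
  have "AE \<xi> in lborel. Re (f \<xi>) = 0"
  proof (rule char_zero_imp_zero_real)
    show "integrable lborel (\<lambda>\<xi>. Re (f \<xi>))" using f by simp
    have eq: "Re (f \<xi>) *\<^sub>R cis (b * \<xi>) = (f \<xi> * cis (b * \<xi>) + cnj (f \<xi>) * cis (b * \<xi>)) / 2" for b \<xi>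
      by (simp add: scaleR_conv_of_real complex_add_cnj distrib_right[symmetric])
    show "(LINT \<xi>|lborel. Re (f \<xi>) *\<^sub>R cis (b * \<xi>)) = 0" for b
      unfolding eq using i i' zero zero' by simp
  qed
  moreover have "AE \<xi> in lborel. Im (f \<xi>) = 0"
  proof (rule char_zero_imp_zero_real)
    show "integrable lborel (\<lambda>\<xi>. Im (f \<xi>))" using f by simp
    have eq: "Im (f \<xi>) *\<^sub>R cis (b * \<xi>) = (f \<xi> * cis (b * \<xi>) - cnj (f \<xi>) * cis (b * \<xi>)) / (2 * \<i>)" for b \<xi>
      by (simp add: complex_eq_iff)
    show "(LINT \<xi>|lborel. Im (f \<xi>) *\<^sub>R cis (b * \<xi>)) = 0" for b
      unfolding eq using i i' zero zero' by simp
  qed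
  ultimately show ?thesis by eventually_elim (simp add: complex_eq_iff)
qed

lemma gauss_imaginary: "gauss (\<i> * of_real b) \<xi> = gauss 0 \<xi> * cis (b * \<xi>)"
  unfolding gauss_def cis_conv_exp exp_add[symmetric] by (simp add: algebra_simps)

text \<open>The factor \<open>gauss 0\<close> makes \<open>f\<close> integrable, and the modulations evaluate the characteristic
function of the product. Every identity between Fourier transforms below is derived from this
criterion.\<close>

lemma gauss_separating:
  fixes f :: "real \<Rightarrow> complex"
  assumes f: "integrable lborel (\<lambda>\<xi>. f \<xi> * gauss 0 \<xi>)"
    and zero: "\<And>b. (LINT \<xi>|lborel. f \<xi> * gauss (\<i> * of_real b) \<xi>) = 0"
  shows "AE \<xi> in lborel. f \<xi> = 0"
proof -
  have "AE \<xi> in lborel. f \<xi> * gauss 0 \<xi> = 0"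
    by (rule char_zero_imp_zero[OF f]) (use zero in \<open>simp add: gauss_imaginary mult.assoc\<close>)
  then show ?thesis by (simp add: gauss_def)
qed

lemma gauss_measurable [measurable]: "gauss c \<in> borel_measurable borel"
  by (rule schwartz_measurable[OF schwartz_gauss])

lemma integral_gauss_cis:
  "(LINT \<xi>|lborel. gauss 0 \<xi> * cis (t * \<xi>)) = of_real (sqrt (2 * pi) * exp (- t\<^sup>2 / 2))"
proof -
  have "of_real (exp (- (t\<^sup>2) / 2)) = char std_normal_distribution t"
    by (simp add: char_std_normal_distribution)
  also have "\<dots> = (LINT \<xi>|lborel. std_normal_density \<xi> *\<^sub>R iexp (t * \<xi>))"
    unfolding char_def by (subst integral_density) auto
  also have "\<dots> = (LINT \<xi>|lborel. (gauss 0 \<xi> * cis (t * \<xi>)) / of_real (sqrt (2 * pi)))"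
    by (intro Bochner_Integration.integral_cong)
       (auto simp: std_normal_density_def scaleR_conv_of_real gauss_def cis_conv_exp exp_of_real[symmetric])
  also have "\<dots> = (LINT \<xi>|lborel. (gauss 0 \<xi> * cis (t * \<xi>))) / of_real (sqrt (2 * pi))"
    by (rule integral_divide_zero)
  finally show ?thesis by (simp add: field_simps)
qed

text \<open>Translating by \<open>Re c\<close> leaves a modulated real Gaussian, that is, a value of the characteristic
function of the normal law.\<close>

lemma fourier_line_gauss:
  "fourier_line (gauss c) y = of_real (1 / sqrt (2 * pi)) * exp (c\<^sup>2 / 2) * gauss (- \<i> * c) y"
proof -
  define a b where "a = Re c" and "b = Im c"
  have c: "c = of_real a + \<i> * of_real b" by (simp add: a_def b_def complex_eq)
  have "(LINT \<xi>|lborel. gauss c \<xi> * cis (- (\<xi> * y))) = (LINT \<xi>|lborel. gauss c (a + 1 * \<xi>) * cis (- ((a + 1 * \<xi>) * y)))"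
    using lborel_integral_real_affine[of 1 "\<lambda>\<xi>. gauss c \<xi> * cis (- (\<xi> * y))" a] by simp
  also have "\<dots> = (LINT \<xi>|lborel. exp (c * of_real a - (of_real a)\<^sup>2 / 2 - \<i> * of_real (a * y)) * (gauss 0 \<xi> * cis ((b - y) * \<xi>)))"
    unfolding gauss_def cis_conv_exp exp_add[symmetric]
    by (intro Bochner_Integration.integral_cong refl arg_cong[of _ _ exp]) (simp add: c power2_eq_square field_simps)
  also have "\<dots> = exp (c * of_real a - (of_real a)\<^sup>2 / 2 - \<i> * of_real (a * y)) * (of_real (sqrt (2 * pi) * exp (- (b - y)\<^sup>2 / 2)))"
    by (simp only: integral_mult_right_zero integral_gauss_cis)
  also have "\<dots> = of_real (sqrt (2 * pi)) * (exp (c\<^sup>2 / 2) * gauss (- \<i> * c) y)"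
  proof -
    have "exp (c * of_real a - (of_real a)\<^sup>2 / 2 - \<i> * of_real (a * y)) * of_real (exp (- (b - y)\<^sup>2 / 2))
      = exp (c\<^sup>2 / 2) * gauss (- \<i> * c) y"
      unfolding gauss_def exp_of_real[symmetric] exp_add[symmetric]
      by (intro arg_cong[of _ _ exp]) (simp add: c power2_eq_square field_simps)
    then show ?thesis by (simp add: mult_ac)
  qed
  finally have "fourier_line (gauss c) y = of_real (1 / (2 * pi) * sqrt (2 * pi)) * (exp (c\<^sup>2 / 2) * gauss (- \<i> * c) y)"
    unfolding fourier_line_def by (simp add: scaleR_conv_of_real)
  moreover have "1 / (2 * pi) * sqrt (2 * pi) = 1 / sqrt (2 * pi)"
    by (simp add: real_div_sqrt field_simps)
  ultimately show ?thesis by (simp only: mult.assoc)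
qed

lemma fourier_line_shift:
  "fourier_line (\<lambda>\<xi>. f (\<xi> + \<eta>)) y = cis (\<eta> * y) * fourier_line f y"
proof -
  have "(LINT \<xi>|lborel. f \<xi> * cis (- (\<xi> * y))) = (LINT \<xi>|lborel. f (\<eta> + 1 * \<xi>) * cis (- ((\<eta> + 1 * \<xi>) * y)))"
    using lborel_integral_real_affine[of 1 "\<lambda>\<xi>. f \<xi> * cis (- (\<xi> * y))" \<eta>] by simp
  also have "\<dots> = (LINT \<xi>|lborel. cis (- (\<eta> * y)) * (f (\<xi> + \<eta>) * cis (- (\<xi> * y))))"
    by (intro Bochner_Integration.integral_cong) (auto simp: cis_mult algebra_simps)
  finally have "(LINT \<xi>|lborel. f \<xi> * cis (- (\<xi> * y))) = cis (- (\<eta> * y)) * (LINT \<xi>|lborel. f (\<xi> + \<eta>) * cis (- (\<xi> * y)))"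
    by simp
  then have "cis (\<eta> * y) * (LINT \<xi>|lborel. f \<xi> * cis (- (\<xi> * y))) =
      (cis (\<eta> * y) * cis (- (\<eta> * y))) * (LINT \<xi>|lborel. f (\<xi> + \<eta>) * cis (- (\<xi> * y)))" by simp
  then show ?thesis unfolding fourier_line_def cis_mult by (simp add: mult_scaleR_right)
qed

lemma fourier_line_linear:
  assumes "integrable lborel f" "integrable lborel g"
  shows "fourier_line (\<lambda>\<xi>. a * f \<xi> + b * g \<xi>) y = a * fourier_line f y + b * fourier_line g y"
proof -
  have i: "integrable lborel (\<lambda>\<xi>. f \<xi> * cis (- (\<xi> * y)))" "integrable lborel (\<lambda>\<xi>. g \<xi> * cis (- (\<xi> * y)))"
    using integrable_mult_cis[OF assms(1), of "-y"] integrable_mult_cis[OF assms(2), of "-y"]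
    by (simp_all add: mult.commute)
  have "(LINT \<xi>|lborel. (a * f \<xi> + b * g \<xi>) * cis (- (\<xi> * y))) =
      (LINT \<xi>|lborel. a * (f \<xi> * cis (- (\<xi> * y))) + b * (g \<xi> * cis (- (\<xi> * y))))"
    by (simp add: algebra_simps)
  also have "\<dots> = a * (LINT \<xi>|lborel. f \<xi> * cis (- (\<xi> * y))) + b * (LINT \<xi>|lborel. g \<xi> * cis (- (\<xi> * y)))"
    using i by simp
  finally show ?thesis unfolding fourier_line_def by (simp add: scaleR_add_right mult_scaleR_right)
qed

lemma fourier_line_poly_gauss_pderiv:
  "fourier_line (\<lambda>\<xi>. poly (pderiv p + p * [:c, -1:]) (of_real \<xi>) * gauss c \<xi>) y =
     \<i> * of_real y * fourier_line (\<lambda>\<xi>. poly p (of_real \<xi>) * gauss c \<xi>) y"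
  by (rule fourier_line_derivative[OF schwartz_poly_gauss schwartz_poly_gauss has_vector_derivative_poly_gauss])

lemma schwartz_square_gauss: "schwartz (\<lambda>\<xi>. (of_real \<xi> - s)\<^sup>2 * gauss c \<xi>)"
  using schwartz_poly_gauss[of "[:-s, 1:]\<^sup>2" c] by (simp add: power2_eq_square algebra_simps)

text \<open>The transform turns derivatives into factors \<open>\<i> y\<close>. The first two derivatives of the Gaussian have
the polynomial factors \<open>c - \<xi>\<close> and \<open>(c - \<xi>)\<^sup>2 - 1\<close>, and \<open>(\<xi> - s)\<^sup>2\<close> is a combination of these and
a constant.\<close>

lemma fourier_line_square_gauss:
  "fourier_line (\<lambda>\<xi>. (of_real \<xi> - s)\<^sup>2 * gauss c \<xi>) y = (1 + (c - s - \<i> * of_real y)\<^sup>2) * fourier_line (gauss c) y"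
proof -
  let ?F = "fourier_line (gauss c) y"
  let ?P = "\<lambda>p \<xi>. poly p (of_real \<xi>) * gauss c \<xi>"
  define p1 where "p1 = [:c, -1:]"
  define p2 where "p2 = [:-1:] + p1 * [:c, -1:]"
  have F1: "fourier_line (?P p1) y = \<i> * of_real y * ?F"
    using fourier_line_poly_gauss_pderiv[of 1 c y] by (simp add: p1_def)
  have "pderiv p1 = [:-1:]" by (simp add: p1_def pderiv_pCons)
  then have F2: "fourier_line (?P p2) y = \<i> * of_real y * (\<i> * of_real y * ?F)"
    using fourier_line_poly_gauss_pderiv[of p1 c y] by (simp add: p2_def F1)
  have i: "integrable lborel (?P p)" for p by (rule schwartz_integrable[OF schwartz_poly_gauss])
  have "(\<lambda>\<xi>. (of_real \<xi> - s)\<^sup>2 * gauss c \<xi>) =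
      (\<lambda>\<xi>. 1 * ?P p2 \<xi> + 1 * ((- 2 * (c - s)) * ?P p1 \<xi> + (1 + (c - s)\<^sup>2) * ?P 1 \<xi>))"
    by (rule ext) (simp add: p1_def p2_def power2_eq_square algebra_simps)
  then have "fourier_line (\<lambda>\<xi>. (of_real \<xi> - s)\<^sup>2 * gauss c \<xi>) y =
      1 * fourier_line (?P p2) y + 1 * ((- 2 * (c - s)) * fourier_line (?P p1) y + (1 + (c - s)\<^sup>2) * fourier_line (?P 1) y)"
    by (simp only: fourier_line_linear i integrable_mult_right Bochner_Integration.integrable_add)
  also have "\<dots> = (1 + (c - s - \<i> * of_real y)\<^sup>2) * ?F"
    unfolding F1 F2 by (simp add: power2_eq_square algebra_simps)
  finally show ?thesis .
qed

lemma integrable_pair_dominated: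
  fixes f :: "'a \<times> 'b \<Rightarrow> 'c::{banach, second_countable_topology}" and g :: "'a \<Rightarrow> 'd::{banach, second_countable_topology}"
  assumes "sigma_finite_measure M1" "finite_measure M2"
    and f: "f \<in> borel_measurable (M1 \<Otimes>\<^sub>M M2)"
    and g: "integrable M1 g"
    and le: "\<And>x y. norm (f (x, y)) \<le> norm (g x)"
  shows "integrable (M1 \<Otimes>\<^sub>M M2) f"
proof -
  interpret M1: sigma_finite_measure M1 by fact
  interpret M2: finite_measure M2 by fact
  interpret pair_sigma_finite M1 M2 ..
  have [measurable]: "g \<in> borel_measurable M1" using g by auto
  have "integrable (M1 \<Otimes>\<^sub>M M2) (\<lambda>(x, y). norm (g x))"
    by (rule Fubini_integrable) (use g in auto)
  then show ?thesis
    by (rule Bochner_Integration.integrable_bound) (use f le in auto)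
qed

lemma borel_measurable_cis [measurable]: "cis \<in> borel_measurable borel"
  by (intro borel_measurable_continuous_onI) (auto simp: cis_conv_exp[abs_def] intro!: continuous_intros)

section \<open>Fourier transforms on the cylinder\<close>

lemma sigma_finite_cyl: "sigma_finite_measure cyl"
  unfolding cyl_def
  by (intro sigma_finite_measure_restrict_space lborel.sigma_finite_measure_axioms)
     (auto intro!: borel_Times)

lemma space_cyl_in: "{0..<2 * pi} \<times> (UNIV :: real set) \<in> sets lborel"
  by (auto intro!: borel_Times)

lemma measurable_cylI: "f \<in> borel \<rightarrow>\<^sub>M N \<Longrightarrow> f \<in> cyl \<rightarrow>\<^sub>M N"
  unfolding cyl_def by (intro measurable_restrict_space1) simp

lemma AE_cyl_snd:
  assumes "AE y in lborel. P y"
  shows "AE p in cyl. P (snd p)"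
proof -
  obtain S where S: "{y \<in> space lborel. \<not> P y} \<subseteq> S" "emeasure lborel S = 0" "S \<in> sets lborel"
    using assms by (rule AE_E)
  have "AE p in (lborel \<Otimes>\<^sub>M lborel :: (real \<times> real) measure). snd p \<notin> S"
  proof (rule lborel_pair.AE_pair_measure)
    show "{x \<in> space (lborel \<Otimes>\<^sub>M lborel). snd x \<notin> S} \<in> sets (lborel \<Otimes>\<^sub>M (lborel :: real measure))"
      using S(3) by measurable
    have "AE y in lborel. y \<notin> S" using S by (intro AE_not_in) (simp add: null_sets_def)
    then show "AE x in (lborel :: real measure). AE y in lborel. snd (x, y) \<notin> S" by simp
  qed
  then show ?thesis
    unfolding cyl_def lborel_prod
    by (subst AE_restrict_space_iff) (use S(1) in \<open>auto simp: space_cyl_in[simplified]\<close>)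
qed

lemma integrable_cyl_snd:
  fixes g :: "real \<Rightarrow> real"
  assumes "integrable lborel g"
  shows "integrable cyl (\<lambda>p. g (snd p))"
proof -
  have [measurable]: "g \<in> borel_measurable borel" using assms by auto
  have "integrable (lborel \<Otimes>\<^sub>M lborel) (\<lambda>(x, y). indicator {0..<2 * pi} x *\<^sub>R g y)"
    by (rule lborel_pair.Fubini_integrable) (use assms in \<open>auto simp: abs_mult\<close>)
  moreover have "(\<lambda>(x, y). indicator {0..<2 * pi} x *\<^sub>R g y) = (\<lambda>p. indicator ({0..<2 * pi} \<times> UNIV) p *\<^sub>R g (snd p))"
    by (auto simp: indicator_def)
  ultimately show ?thesis
    unfolding cyl_def by (subst integrable_restrict_space) (auto simp: space_cyl_in[simplified] lborel_prod)
qed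

lemma L2_cyl_measurable: "L2_cyl u \<Longrightarrow> u \<in> borel_measurable borel"
  by (simp add: L2_cyl_def)

lemma integrable_pairing:
  assumes u: "L2_cyl u"
    and c: "c \<in> borel_measurable borel" "\<And>x. cmod (c x) \<le> 1"
    and F: "F \<in> borel_measurable borel" "integrable lborel (\<lambda>y. (cmod (F y))\<^sup>2)"
  shows "integrable cyl (\<lambda>p. u p *\<^sub>R (c (fst p) * F (snd p)))"
proof (rule Bochner_Integration.integrable_bound)
  show "integrable cyl (\<lambda>p. (u p)\<^sup>2 + (cmod (F (snd p)))\<^sup>2)"
    using u integrable_cyl_snd[OF F(2)] by (auto simp: L2_cyl_def)
  note [measurable] = L2_cyl_measurable[OF u, unfolded borel_prod[symmetric]] c(1) F(1)
  show "(\<lambda>p. u p *\<^sub>R (c (fst p) * F (snd p))) \<in> borel_measurable cyl"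
    by (rule measurable_cylI) (unfold borel_prod[symmetric], measurable)
  have "norm (u p *\<^sub>R (c (fst p) * F (snd p))) \<le> (u p)\<^sup>2 + (cmod (F (snd p)))\<^sup>2" for p
  proof -
    have "norm (u p *\<^sub>R (c (fst p) * F (snd p))) \<le> \<bar>u p\<bar> * (1 * cmod (F (snd p)))"
      unfolding norm_scaleR norm_mult by (intro mult_left_mono mult_right_mono c) auto
    also have "\<dots> \<le> \<bar>u p\<bar>\<^sup>2 + (cmod (F (snd p)))\<^sup>2"
    proof -
      have "0 \<le> (\<bar>u p\<bar> - cmod (F (snd p)))\<^sup>2 + \<bar>u p\<bar>\<^sup>2 + (cmod (F (snd p)))\<^sup>2" by (intro add_nonneg_nonneg) auto
      then show ?thesis by (simp add: power2_eq_square algebra_simps)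
    qed
    finally show ?thesis by simp
  qed
  then show "AE p in cyl. norm (u p *\<^sub>R (c (fst p) * F (snd p))) \<le> norm ((u p)\<^sup>2 + (cmod (F (snd p)))\<^sup>2)"
    by (intro AE_I2) (metis abs_ge_self order_trans real_norm_def)
qed

text \<open>The test functions in \<^const>\<open>is_fourier\<close>: pairing with them evaluates the transform of mode \<open>k\<close>
on \<open>\<psi>\<close>, up to the factor \<open>2\<pi>\<close>.\<close>

definition mode_test :: "int \<Rightarrow> (real \<Rightarrow> complex) \<Rightarrow> real \<times> real \<Rightarrow> complex" where
  "mode_test k \<psi> = (\<lambda>(x, y). cis (- (of_int k * x)) * fourier_line \<psi> y)"

lemma integrable_mode_test:
  assumes "L2_cyl u" "schwartz \<psi>"
  shows "integrable cyl (\<lambda>p. u p *\<^sub>R mode_test k \<psi> p)"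
proof -
  have "(\<lambda>x. cis (- (of_int k * x))) \<in> borel_measurable borel" by measurable
  from integrable_pairing[OF assms(1) this _ fourier_line_measurable[OF assms(2)] fourier_line_square_integrable[OF assms(2)]]
  show ?thesis by (simp add: mode_test_def split_beta')
qed

lemma is_fourierD:
  fixes uh :: "int \<Rightarrow> real \<Rightarrow> complex"
  assumes "is_fourier u uh"
  shows "uh k \<in> borel_measurable borel"
    and "schwartz \<psi> \<Longrightarrow> integrable lborel (\<lambda>\<xi>. uh k \<xi> * \<psi> \<xi>)"
    and "schwartz \<psi> \<Longrightarrow> pairing u (mode_test k \<psi>) = 2 * pi * (LINT \<xi>|lborel. uh k \<xi> * \<psi> \<xi>)"
  using assms unfolding is_fourier_def mode_test_def by (auto simp: scaleR_conv_of_real field_simps)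

lemma is_fourier_unique:
  assumes "is_fourier u uh" "is_fourier u uh'"
  shows "AE \<xi> in lborel. uh k \<xi> = uh' k \<xi>"
proof -
  note i = is_fourierD(2)[OF assms(1) schwartz_gauss, of k] is_fourierD(2)[OF assms(2) schwartz_gauss, of k]
  have "AE \<xi> in lborel. uh k \<xi> - uh' k \<xi> = 0"
  proof (rule gauss_separating)
    show "integrable lborel (\<lambda>\<xi>. (uh k \<xi> - uh' k \<xi>) * gauss 0 \<xi>)"
      using i by (simp add: left_diff_distrib)
    show "(LINT \<xi>|lborel. (uh k \<xi> - uh' k \<xi>) * gauss (\<i> * of_real b) \<xi>) = 0" for b
      using i is_fourierD(3)[OF assms(1) schwartz_gauss, of k "\<i> * of_real b"] is_fourierD(3)[OF assms(2) schwartz_gauss, of k "\<i> * of_real b"]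
      by (simp add: left_diff_distrib)
  qed
  then show ?thesis by simp
qed

text \<open>The Sobolev norm of a difference is defined through a chosen transform of the difference. By this
lemma and uniqueness it can be computed from the transforms of the two functions.\<close>

lemma is_fourier_diff:
  assumes "L2_cyl u" "L2_cyl v" "is_fourier u uh" "is_fourier v vh"
  shows "is_fourier (\<lambda>p. u p - v p) (\<lambda>k \<xi>. uh k \<xi> - vh k \<xi>)"
  unfolding is_fourier_def
proof (intro allI conjI impI)
  fix k
  note [measurable] = is_fourierD(1)[OF assms(3), of k] is_fourierD(1)[OF assms(4), of k]
  show "(\<lambda>\<xi>. uh k \<xi> - vh k \<xi>) \<in> borel_measurable borel" by measurable
  fix \<phi> assume \<phi>: "schwartz \<phi>"
  note i = is_fourierD(2)[OF assms(3) \<phi>, of k] is_fourierD(2)[OF assms(4) \<phi>, of k]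
  show "integrable lborel (\<lambda>\<xi>. (uh k \<xi> - vh k \<xi>) * \<phi> \<xi>)"
    using i by (simp add: left_diff_distrib)
  have "pairing (\<lambda>p. u p - v p) (mode_test k \<phi>) = pairing u (mode_test k \<phi>) - pairing v (mode_test k \<phi>)"
    unfolding pairing_def using integrable_mode_test[OF assms(1) \<phi>] integrable_mode_test[OF assms(2) \<phi>]
    by (simp add: scaleR_diff_left)
  then show "(LINT \<xi>|lborel. (uh k \<xi> - vh k \<xi>) * \<phi> \<xi>) =
      (1 / (2 * pi)) *\<^sub>R pairing (\<lambda>p. u p - v p) (\<lambda>(x, y). cis (- (of_int k * x)) * fourier_line \<phi> y)"
    using i is_fourierD(3)[OF assms(3) \<phi>, of k] is_fourierD(3)[OF assms(4) \<phi>, of k]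
    unfolding mode_test_def by (simp add: left_diff_distrib scaleR_conv_of_real field_simps)
qed

lemma has_vector_derivative_gauss:
  "(gauss c has_vector_derivative (c - of_real y) * gauss c y) (at y)"
  using has_vector_derivative_poly_gauss[of 1 c y] by simp

lemma schwartz_cyl_mode_test: "schwartz_cyl (mode_test k (gauss c))"
proof -
  define K where "K = of_real (1 / sqrt (2 * pi)) * exp (c\<^sup>2 / 2)"
  define d where "d = - \<i> * c"
  define q where "q j = ((\<lambda>p. pderiv p + p * [:d, -1:]) ^^ j) [:K:]" for j
  define D where "D i j = (\<lambda>(x, y). (- \<i> * of_int k) ^ i * cis (- of_int k * x) * (poly (q j) (of_real y) * gauss d y))" for i j :: nat
  have Dx: "((\<lambda>s. D i j (s, y)) has_vector_derivative D (Suc i) j (x, y)) (at x)" for i j x y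
    unfolding D_def prod.case
    by (rule has_vector_derivative_eq_rhs[OF has_vector_derivative_mult_left[OF has_vector_derivative_mult_right[OF has_vector_derivative_cis_linear]]])
       (simp add: algebra_simps)
  have Dy: "((\<lambda>s. D i j (x, s)) has_vector_derivative D i (Suc j) (x, y)) (at y)" for i j x y
    unfolding D_def prod.case
    by (rule has_vector_derivative_eq_rhs[OF has_vector_derivative_mult_right[OF has_vector_derivative_poly_gauss]])
       (simp add: q_def)
  show ?thesis
    unfolding schwartz_cyl_def
  proof (intro conjI exI[of _ D] allI Dx Dy)
    have "cis (- (of_int k * (x + 2 * pi))) = cis (- (of_int k * x))" for x
    proof -
      have "cis (- (of_int k * (x + 2 * pi))) = cis (- (of_int k * x)) * cis (2 * pi * of_int (- k))"
        unfolding cis_mult by (simp add: algebra_simps)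
      then show ?thesis by (subst (asm) cis_multiple_2pi) auto
    qed
    then show "periodic_x (mode_test k (gauss c))" by (simp add: periodic_x_def mode_test_def)
    show "D 0 0 = mode_test k (gauss c)"
      by (simp add: D_def q_def mode_test_def fourier_line_gauss K_def d_def fun_eq_iff mult_ac)
    show "bounded (range (\<lambda>(x, y). y ^ m *\<^sub>R D i j (x, y)))" for m i j
    proof -
      obtain B where B: "B \<ge> 0" "\<And>\<xi>. cmod (poly (q j) (of_real \<xi>) * gauss d \<xi>) * \<bar>\<xi>\<bar> ^ m \<le> B"
        using poly_times_gauss_bounded by metis
      have "norm (y ^ m *\<^sub>R D i j (x, y)) \<le> \<bar>of_int k\<bar> ^ i * B" for x y
      proof -
        have "norm (y ^ m *\<^sub>R D i j (x, y)) = \<bar>of_int k\<bar> ^ i * (cmod (poly (q j) (of_real y) * gauss d y) * \<bar>y\<bar> ^ m)"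
          by (simp add: D_def norm_mult norm_power power_abs mult_ac)
        also have "\<dots> \<le> \<bar>of_int k\<bar> ^ i * B" by (intro mult_left_mono B) auto
        finally show ?thesis .
      qed
      then show ?thesis unfolding bounded_iff by (intro exI[of _ "\<bar>of_int k\<bar> ^ i * B"]) auto
    qed
  qed
qed

lemma dy_shear_mode:
  assumes "\<And>y. (g has_vector_derivative g' y) (at y)"
  shows "dy_shear t (\<lambda>(x, y). cis (- (a * x)) * g y) =
         (\<lambda>(x, y). cis (- (a * x)) * (g' y + \<i> * of_real (t * a) * g y))"
proof (rule ext, clarify)
  fix x y
  have "dx (\<lambda>(x, y). cis (- (a * x)) * g y) (x, y) = (\<i> * of_real (- a) * cis (- a * x)) * g y"
    unfolding dx_def prod.case
    by (rule vector_derivative_at)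
       (use has_vector_derivative_mult_left[OF has_vector_derivative_cis_linear[of "-a" x], of "g y"] in simp)
  moreover have "dy (\<lambda>(x, y). cis (- (a * x)) * g y) (x, y) = cis (- (a * x)) * g' y"
    unfolding dy_def prod.case
    by (rule vector_derivative_at) (rule has_vector_derivative_mult_right[OF assms])
  ultimately show "dy_shear t (\<lambda>(x, y). cis (- (a * x)) * g y) (x, y) =
      cis (- (a * x)) * (g' y + \<i> * of_real (t * a) * g y)"
    by (simp add: dy_shear_def scaleR_conv_of_real algebra_simps)
qed

text \<open>On the Fourier side \<open>\<partial>\<^sub>y - t\<partial>\<^sub>x\<close> acts on the test function as multiplication of \<open>\<psi>\<close> by
\<open>- \<i> (\<xi> - k t)\<close>.\<close>

lemma dy_shear_mode_test:
  "dy_shear t (dy_shear t (mode_test k (gauss c))) =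
     (\<lambda>p. - mode_test k (\<lambda>\<xi>. (of_real \<xi> - of_real (of_int k * t))\<^sup>2 * gauss c \<xi>) p)"
proof -
  define K where "K = of_real (1 / sqrt (2 * pi)) * exp (c\<^sup>2 / 2)"
  define d where "d = - \<i> * c"
  define e where "e = d + \<i> * of_real (t * of_int k)"
  have m: "mode_test k (gauss c) = (\<lambda>(x, y). cis (- (of_int k * x)) * (K * gauss d y))"
    by (simp add: mode_test_def fourier_line_gauss K_def d_def fun_eq_iff)
  have d1: "((\<lambda>y. K * gauss d y) has_vector_derivative K * ((d - of_real y) * gauss d y)) (at y)" for y
    by (rule has_vector_derivative_mult_right[OF has_vector_derivative_gauss])
  have m1: "dy_shear t (mode_test k (gauss c)) = (\<lambda>(x, y). cis (- (of_int k * x)) * (poly [:K * e, - K:] (of_real y) * gauss d y))"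
    unfolding m dy_shear_mode[OF d1] by (simp add: e_def fun_eq_iff algebra_simps)
  have e2: "(1 + (c - of_real (of_int k * t) - \<i> * of_real y)\<^sup>2) = - (- 1 + (e - of_real y)\<^sup>2)" for y
    by (simp add: e_def d_def power2_eq_square algebra_simps)
  have F: "fourier_line (gauss c) y = K * gauss d y" for y
    by (simp add: fourier_line_gauss K_def d_def)
  have "poly (pderiv [:K * e, - K:] + [:K * e, - K:] * [:d, -1:]) (of_real y) * gauss d y
      + \<i> * of_real (t * of_int k) * (poly [:K * e, - K:] (of_real y) * gauss d y)
      = (- 1 + (e - of_real y)\<^sup>2) * (K * gauss d y)" for y
    by (simp add: e_def pderiv_pCons power2_eq_square algebra_simps)
  note eq = this
  show ?thesis
    unfolding m1 dy_shear_mode[OF has_vector_derivative_poly_gauss]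
    unfolding mode_test_def fourier_line_square_gauss e2 F eq
    by (simp add: fun_eq_iff algebra_simps)
qed

lemma pairing_dy_shear_mode_test:
  assumes "is_fourier u uh"
  shows "pairing u (dy_shear t (dy_shear t (mode_test k (gauss c)))) =
     - (2 * pi * (LINT \<xi>|lborel. of_real ((\<xi> - of_int k * t)\<^sup>2) * uh k \<xi> * gauss c \<xi>))"
proof -
  have "pairing u (dy_shear t (dy_shear t (mode_test k (gauss c)))) =
     - pairing u (mode_test k (\<lambda>\<xi>. (of_real \<xi> - of_real (of_int k * t))\<^sup>2 * gauss c \<xi>))"
    unfolding dy_shear_mode_test pairing_def by simp
  also have "\<dots> = - (2 * pi * (LINT \<xi>|lborel. uh k \<xi> * ((of_real \<xi> - of_real (of_int k * t))\<^sup>2 * gauss c \<xi>)))"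
    by (simp only: is_fourierD(3)[OF assms schwartz_square_gauss])
  finally show ?thesis by (simp add: mult_ac)
qed

section \<open>The profile derivative as a superposition of characters\<close>

text \<open>This is \<open>g(y) = \<integral> e\<^sup>i\<^sup>\<eta>\<^sup>y d\<mu>(\<eta>)\<close> for the finite complex measure \<open>d\<mu> = h dM\<close>. The bound on \<open>h\<close> holds
everywhere, so that \<open>|\<mu>| \<le> M\<close> can be used without exceptional sets.\<close>

definition character_representation ::
  "(real \<Rightarrow> real) \<Rightarrow> real measure \<Rightarrow> (real \<Rightarrow> complex) \<Rightarrow> bool" where
  "character_representation g M h \<longleftrightarrow>
     sets M = sets borel \<and> finite_measure M \<and> h \<in> borel_measurable borel \<and>
     (\<forall>\<eta>. cmod (h \<eta>) \<le> 1) \<and>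
     (AE y in lborel. of_real (g y) = (LINT \<eta>|M. h \<eta> * cis (\<eta> * y)))"

lemma character_integral_swap:
  assumes M: "sets M = sets borel" "finite_measure M"
    and h: "h \<in> borel_measurable borel" "\<And>\<eta>. cmod (h \<eta>) \<le> 1"
    and L: "sigma_finite_measure L" "Y \<in> borel_measurable L" "integrable L F"
  shows "(LINT p|L. (LINT \<eta>|M. h \<eta> * cis (\<eta> * Y p)) * F p) = (LINT \<eta>|M. h \<eta> * (LINT p|L. cis (\<eta> * Y p) * F p))"
proof -
  interpret L: sigma_finite_measure L by fact
  interpret M: finite_measure M by fact
  interpret pair_sigma_finite L M ..
  note [measurable] = h(1) L(2) borel_measurable_integrable[OF L(3)] 
  note [measurable_cong] = M(1)
  have le: "cmod (h \<eta> * cis (\<eta> * Y p) * F p) \<le> cmod (F p)" for p \<eta>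
    using mult_right_mono[OF h(2)[of \<eta>], of "cmod (F p)"] by (simp add: norm_mult)
  have "integrable (L \<Otimes>\<^sub>M M) (\<lambda>(p, \<eta>). h \<eta> * cis (\<eta> * Y p) * F p)"
    by (rule integrable_pair_dominated[OF L(1) M(2) _ L(3)]) (use le in auto)
  from Fubini_integral[OF this]
  have "(LINT p|L. LINT \<eta>|M. h \<eta> * cis (\<eta> * Y p) * F p) = (LINT \<eta>|M. LINT p|L. h \<eta> * cis (\<eta> * Y p) * F p)"
    by (rule sym)
  then show ?thesis
    unfolding mult.assoc integral_mult_right_zero[symmetric] integral_mult_left_zero[symmetric] .
qed

text \<open>Both \<open>g\<close> and the superposition are bounded, so it suffices to test them with modulated Gaussians.
Such a Gaussian is a multiple of the transform of a real Gaussian \<open>gauss (- b)\<close>; on \<open>g\<close> the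
definition of the distributional transform applies, and on the superposition Fubini's theorem.\<close>

lemma character_representation_of_fourier:
  assumes T: "L_infinity g" and F: "fourier_is_measure g M h" and fin: "emeasure M UNIV < \<infinity>"
  obtains h0 where "character_representation g M h0"
proof -
  define h0 where "h0 \<eta> = (if cmod (h \<eta>) = 1 then h \<eta> else 0)" for \<eta>
  have setsM: "sets M = sets borel" and h[measurable]: "h \<in> borel_measurable borel"
    and h1: "AE \<eta> in M. cmod (h \<eta>) = 1"
    and test: "\<And>\<phi>. schwartz \<phi> \<Longrightarrow> (LINT \<eta>|M. \<phi> \<eta> * h \<eta>) = (LINT y|lborel. g y *\<^sub>R fourier_line \<phi> y)"
    using F unfolding fourier_is_measure_def by auto
  note [measurable_cong] = setsM
  have spaceM: "space M = UNIV" using sets_eq_imp_space_eq[OF setsM] by simp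
  interpret M: finite_measure M
    by (rule finite_measureI) (use fin spaceM in auto)
  have [measurable]: "h0 \<in> borel_measurable borel" unfolding h0_def[abs_def] by measurable
  have h0le: "cmod (h0 \<eta>) \<le> 1" for \<eta> by (simp add: h0_def)
  define m where "m y = (LINT \<eta>|M. h0 \<eta> * cis (\<eta> * y))" for y
  have [measurable]: "m \<in> borel_measurable borel" unfolding m_def by measurable
  have m_le: "cmod (m y) \<le> measure M UNIV" for y
  proof -
    have "cmod (m y) \<le> (LINT \<eta>|M. cmod (h0 \<eta> * cis (\<eta> * y)))" unfolding m_def by (rule integral_norm_bound)
    also have "\<dots> \<le> (LINT \<eta>|M. 1)"
      by (rule integral_mono') (auto simp: norm_mult h0le)
    finally show ?thesis by (simp add: spaceM)
  qed
  from T obtain B where [measurable]: "g \<in> borel_measurable borel" and B: "AE y in lborel. \<bar>g y\<bar> \<le> B"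
    unfolding L_infinity_def by auto
  have ig: "integrable lborel (\<lambda>y. of_real (g y) * gauss c y)" for c
  proof (rule Bochner_Integration.integrable_bound)
    show "integrable lborel (\<lambda>y. of_real B * gauss c y)"
      by (intro integrable_mult_right schwartz_integrable schwartz_gauss)
    show "AE y in lborel. norm (of_real (g y) * gauss c y) \<le> norm (of_real B * gauss c y)"
      using B by eventually_elim (auto simp: norm_mult intro!: mult_right_mono)
  qed measurable
  have im: "integrable lborel (\<lambda>y. m y * gauss c y)" for c
  proof (rule Bochner_Integration.integrable_bound)
    show "integrable lborel (\<lambda>y. of_real (measure M UNIV) * gauss c y)"
      by (intro integrable_mult_right schwartz_integrable schwartz_gauss)
    show "AE y in lborel. norm (m y * gauss c y) \<le> norm (of_real (measure M UNIV) * gauss c y)"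
      by (intro AE_I2) (auto simp: norm_mult m_le intro!: mult_right_mono)
  qed measurable
  have "AE y in lborel. of_real (g y) - m y = 0"
  proof (rule gauss_separating)
    show "integrable lborel (\<lambda>y. (of_real (g y) - m y) * gauss 0 y)"
      using ig[of 0] im[of 0] by (simp add: left_diff_distrib)
    fix b
    let ?K = "of_real (1 / sqrt (2 * pi)) :: complex"
    let ?G = "gauss (\<i> * of_real b)"
    have "?K * exp ((of_real (-b))\<^sup>2 / 2) * (LINT y|lborel. of_real (g y) * ?G y) =
        (LINT y|lborel. g y *\<^sub>R fourier_line (gauss (of_real (-b))) y)"
      by (simp only: fourier_line_gauss integral_mult_right_zero[symmetric] scaleR_conv_of_real)
         (simp add: mult_ac)
    also have "\<dots> = (LINT \<eta>|M. gauss (of_real (-b)) \<eta> * h \<eta>)"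
      using test[OF schwartz_gauss] by simp
    also have "\<dots> = (LINT \<eta>|M. h0 \<eta> * gauss (of_real (-b)) \<eta>)"
    proof (rule integral_cong_AE)
      show "AE \<eta> in M. gauss (of_real (-b)) \<eta> * h \<eta> = h0 \<eta> * gauss (of_real (-b)) \<eta>"
        using h1 by eventually_elim (simp add: h0_def)
    qed measurable
    finally have 1: "?K * exp ((of_real b)\<^sup>2 / 2) * (LINT y|lborel. of_real (g y) * ?G y) =
        (LINT \<eta>|M. h0 \<eta> * gauss (of_real (-b)) \<eta>)" by simp
    have "(LINT y|lborel. m y * ?G y) = (LINT \<eta>|M. h0 \<eta> * (LINT y|lborel. cis (\<eta> * y) * ?G y))"
      unfolding m_def
      by (rule character_integral_swap[OF setsM M.finite_measure_axioms _ h0le lborel.sigma_finite_measure_axioms])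
         (auto intro: schwartz_integrable schwartz_gauss)
    also have "\<dots> = (LINT \<eta>|M. (2 * pi * ?K * exp (- ((of_real b)\<^sup>2 / 2))) * (h0 \<eta> * gauss (of_real (-b)) \<eta>))"
    proof (rule Bochner_Integration.integral_cong)
      fix \<eta>
      have "(LINT y|lborel. cis (\<eta> * y) * ?G y) = 2 * pi * fourier_line ?G (- \<eta>)"
        unfolding fourier_line_def by (simp add: mult_ac scaleR_conv_of_real)
      also have "\<dots> = 2 * pi * ?K * exp (- ((of_real b)\<^sup>2 / 2)) * gauss (of_real b) (- \<eta>)"
        by (simp add: fourier_line_gauss power_mult_distrib mult.assoc[symmetric])
      also have "gauss (of_real b) (- \<eta>) = gauss (of_real (-b)) \<eta>"
        by (simp add: gauss_def)
      finally show "h0 \<eta> * (LINT y|lborel. cis (\<eta> * y) * ?G y) =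
        (2 * pi * ?K * exp (- ((of_real b)\<^sup>2 / 2))) * (h0 \<eta> * gauss (of_real (-b)) \<eta>)"
        by (simp add: mult_ac)
    qed simp
    also have "\<dots> = (2 * pi * ?K * exp (- ((of_real b)\<^sup>2 / 2))) * (LINT \<eta>|M. h0 \<eta> * gauss (of_real (-b)) \<eta>)"
      by (rule integral_mult_right_zero)
    also have "\<dots> = (2 * pi * ?K * ?K) * (exp (- ((of_real b)\<^sup>2 / 2)) * exp ((of_real b)\<^sup>2 / 2)) * (LINT y|lborel. of_real (g y) * ?G y)"
      unfolding 1[symmetric] by (simp only: mult_ac)
    also have "(2 * pi * ?K * ?K) = 1"
    proof -
      \<comment> \<open>Transforming twice gives back the function because of the normalization of \<^const>\<open>fourier_line\<close>.\<close>
      have "2 * pi * (1 / sqrt (2 * pi)) * (1 / sqrt (2 * pi)) = 1"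
        by (simp add: field_simps)
      then show ?thesis by (metis of_real_1 of_real_mult)
    qed
    also have "exp (- ((of_real b)\<^sup>2 / 2)) * exp ((of_real b)\<^sup>2 / 2) = (1 :: complex)"
      by (simp add: exp_add[symmetric])
    finally have "(LINT y|lborel. m y * ?G y) = (LINT y|lborel. of_real (g y) * ?G y)" by simp
    then show "(LINT y|lborel. (of_real (g y) - m y) * ?G y) = 0"
      using ig im by (simp add: left_diff_distrib)
  qed
  then have "character_representation g M h0"
    unfolding character_representation_def
    using setsM M.finite_measure_axioms h0le by (auto simp: m_def elim!: eventually_mono)
  then show thesis by (rule that)
qed

text \<open>After adding a large constant and normalizing, \<open>g\<close> is the density of a measure that gives every
interval its length, hence of Lebesgue measure.\<close>

lemma constant_of_linear_profile:
  assumes d: "has_density_derivative (\<lambda>y. \<alpha> * y) g" and g: "L_infinity g"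
  shows "AE y in lborel. g y = \<alpha>"
proof -
  from g obtain B0 where [measurable]: "g \<in> borel_measurable borel" and B0: "AE y in lborel. \<bar>g y\<bar> \<le> B0"
    unfolding L_infinity_def by auto
  define c where "c = \<bar>B0\<bar> + \<bar>\<alpha>\<bar> + 1"
  have c: "c > 0" by (simp add: c_def)
  define p where "p y = max 0 ((g y - \<alpha> + c) / c)" for y
  have [measurable]: "p \<in> borel_measurable borel" unfolding p_def by measurable
  have p_eq: "AE y in lborel. p y = (g y - \<alpha> + c) / c"
    using B0 by eventually_elim (use c in \<open>auto simp: p_def c_def field_simps\<close>)
  have "lborel = density lborel (\<lambda>y. ennreal (p y))"
  proof (rule lborel_eqI)
    fix l u :: real assume "\<And>b. b \<in> Basis \<Longrightarrow> l \<bullet> b \<le> u \<bullet> b"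
    then have lu: "l \<le> u" by simp
    have si: "set_integrable lborel {l..u} g" and di: "\<alpha> * u - \<alpha> * l = (LINT y:{l..u}|lborel. g y)"
      using d lu unfolding has_density_derivative_def by auto
    have i1: "integrable lborel (\<lambda>y. indicator {l..u} y * g y)"
      using si unfolding set_integrable_def by simp
    have i2: "integrable lborel (\<lambda>y. indicat_real {l..u} y)"
      by (rule integrable_real_indicator) (use lu in auto)
    have eq: "AE y in lborel. indicator {l<..<u} y * p y = indicator {l..u} y * g y / c + (c - \<alpha>) / c * indicator {l..u} y"
      using p_eq AE_lborel_singleton[of l] AE_lborel_singleton[of u]
      by eventually_elim (auto simp: indicator_def diff_divide_distrib add_divide_distrib)
    have "integrable lborel (\<lambda>y. indicator {l..u} y * g y / c + (c - \<alpha>) / c * indicator {l..u} y)"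
      using i1 i2 by simp
    then have ip: "integrable lborel (\<lambda>y. indicator {l<..<u} y * p y)"
      by (subst integrable_cong_AE[OF _ _ eq]) auto
    have "emeasure (density lborel (\<lambda>y. ennreal (p y))) {l<..<u} = (\<integral>\<^sup>+ y. ennreal (indicator {l<..<u} y * p y) \<partial>lborel)"
      by (subst emeasure_density) (auto intro!: nn_integral_cong simp: indicator_def)
    also have "\<dots> = ennreal (LINT y|lborel. indicator {l<..<u} y * p y)"
      by (rule nn_integral_eq_integral[OF ip]) (auto simp: p_def)
    also have "(LINT y|lborel. indicator {l<..<u} y * p y) =
        (LINT y|lborel. indicator {l..u} y * g y / c + (c - \<alpha>) / c * indicator {l..u} y)"
      by (rule integral_cong_AE[OF _ _ eq]) auto
    also have "\<dots> = (\<alpha> * u - \<alpha> * l) / c + (c - \<alpha>) / c * (u - l)"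
      using i1 i2 lu di unfolding set_lebesgue_integral_def by simp
    also have "\<dots> = u - l" using c by (simp add: field_simps)
    finally show "emeasure (density lborel (\<lambda>y. ennreal (p y))) (box l u) = (\<Prod>b\<in>Basis. (u - l) \<bullet> b)"
      by (simp add: box_real)
  qed simp
  then have "density lborel (\<lambda>y. 1) = density lborel (\<lambda>y. ennreal (p y))" by (simp add: density_1)
  then have "AE y in lborel. 1 = ennreal (p y)"
    by (subst (asm) sigma_finite_measure.density_unique_iff[OF lborel.sigma_finite_measure_axioms]) auto
  with p_eq show ?thesis
    by eventually_elim (use c in \<open>simp add: field_simps\<close>)
qed

section \<open>The equations for one Fourier mode\<close>

text \<open>Multiplication by the character \<open>e\<^sup>i\<^sup>\<eta>\<^sup>y\<close> translates the test function on the Fourier side by \<open>\<eta>\<close>, so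
a superposition of characters acts as a convolution.\<close>

lemma pairing_product_mode_test:
  assumes w: "L2_cyl w" "is_fourier w wh" and rep: "character_representation g M h"
    and g: "g \<in> borel_measurable borel"
  shows "pairing (\<lambda>(x, y). g y * w (x, y)) (mode_test k (gauss c)) =
    2 * pi * (LINT \<eta>|M. h \<eta> * (LINT \<zeta>|lborel. wh k \<zeta> * gauss c (\<zeta> + \<eta>)))"
proof -
  from rep have M: "sets M = sets borel" "finite_measure M"
    and h: "h \<in> borel_measurable borel" "\<And>\<eta>. cmod (h \<eta>) \<le> 1"
    and ae: "AE y in lborel. of_real (g y) = (LINT \<eta>|M. h \<eta> * cis (\<eta> * y))"
    unfolding character_representation_def by auto
  interpret M: finite_measure M by fact
  note [measurable_cong] = M(1)
  note [measurable] = h(1) g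
  let ?m = "\<lambda>y. LINT \<eta>|M. h \<eta> * cis (\<eta> * y)"
  let ?F = "\<lambda>p. w p *\<^sub>R mode_test k (gauss c) p"
  have iF: "integrable cyl ?F" by (rule integrable_mode_test[OF w(1) schwartz_gauss])
  have [measurable]: "?F \<in> borel_measurable cyl" using iF by auto
  have [measurable]: "(snd :: real \<times> real \<Rightarrow> real) \<in> borel_measurable cyl"
    by (rule measurable_cylI) (unfold borel_prod[symmetric], measurable)
  have [measurable]: "?m \<in> borel_measurable borel" by measurable
  have "pairing (\<lambda>(x, y). g y * w (x, y)) (mode_test k (gauss c)) = (LINT p|cyl. of_real (g (snd p)) * ?F p)"
    unfolding pairing_def by (intro Bochner_Integration.integral_cong) (auto simp: scaleR_conv_of_real)
  also have "\<dots> = (LINT p|cyl. ?m (snd p) * ?F p)"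
  proof (rule integral_cong_AE)
    show "AE p in cyl. of_real (g (snd p)) * ?F p = ?m (snd p) * ?F p"
      using AE_cyl_snd[OF ae] by eventually_elim simp
  qed measurable
  also have "\<dots> = (LINT \<eta>|M. h \<eta> * (LINT p|cyl. cis (\<eta> * snd p) * ?F p))"
    by (rule character_integral_swap[OF M h sigma_finite_cyl _ iF]) measurable
  also have "\<dots> = (LINT \<eta>|M. 2 * pi * (h \<eta> * (LINT \<zeta>|lborel. wh k \<zeta> * gauss c (\<zeta> + \<eta>))))"
  proof (rule Bochner_Integration.integral_cong)
    fix \<eta>
    have "(LINT p|cyl. cis (\<eta> * snd p) * ?F p) = pairing w (mode_test k (\<lambda>\<xi>. gauss c (\<xi> + \<eta>)))"
      unfolding pairing_def mode_test_def fourier_line_shift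
      by (intro Bochner_Integration.integral_cong) (auto simp: scaleR_conv_of_real)
    also have "\<dots> = 2 * pi * (LINT \<zeta>|lborel. wh k \<zeta> * gauss c (\<zeta> + \<eta>))"
      by (rule is_fourierD(3)[OF w(2) schwartz_gauss_shift])
    finally show "h \<eta> * (LINT p|cyl. cis (\<eta> * snd p) * ?F p) =
        2 * pi * (h \<eta> * (LINT \<zeta>|lborel. wh k \<zeta> * gauss c (\<zeta> + \<eta>)))" by (simp add: mult_ac)
  qed simp
  finally show ?thesis by simp
qed

lemma is_fourier_fourier_cyl: "in_sobolev N u \<Longrightarrow> is_fourier u (fourier_cyl u)"
  unfolding in_sobolev_def fourier_cyl_def by (metis someI_ex)

lemma vorticity_mode_equation:
  assumes sol: "boussinesq_solution \<nu> T' N \<omega> \<theta> g" and t: "t > 0"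
  shows "((\<lambda>s. LINT \<xi>|lborel. fourier_cyl (\<omega> s) k \<xi> * gauss c \<xi>) has_vector_derivative
     (LINT \<xi>|lborel. (of_real (- \<nu> * (\<xi> - of_int k * t)\<^sup>2) * fourier_cyl (\<omega> t) k \<xi> + fourier_cyl (g t) k \<xi>) * gauss c \<xi>)) (at t)"
proof -
  have F: "is_fourier (\<omega> s) (fourier_cyl (\<omega> s))" "is_fourier (g s) (fourier_cyl (g s))" if "s \<ge> 0" for s
    using sol that unfolding boussinesq_solution_def continuous_in_sobolev_def by (auto intro: is_fourier_fourier_cyl)
  let ?\<phi> = "mode_test k (gauss c)"
  let ?D = "\<nu> *\<^sub>R pairing (\<omega> t) (dy_shear t (dy_shear t ?\<phi>)) + pairing (g t) ?\<phi>"
  have "((\<lambda>s. pairing (\<omega> s) ?\<phi>) has_vector_derivative ?D) (at t)"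
    using sol t schwartz_cyl_mode_test unfolding boussinesq_solution_def by blast
  then have "((\<lambda>s. pairing (\<omega> s) ?\<phi> * (1 / (2 * pi))) has_vector_derivative ?D * (1 / (2 * pi))) (at t)"
    by (rule has_vector_derivative_mult_left)
  then have "((\<lambda>s. LINT \<xi>|lborel. fourier_cyl (\<omega> s) k \<xi> * gauss c \<xi>) has_vector_derivative ?D * (1 / (2 * pi))) (at t)"
    by (rule has_vector_derivative_transform_within_open[where S = "{0<..}"])
       (use t in \<open>auto simp: is_fourierD(3)[OF F(1) schwartz_gauss]\<close>)
  moreover have "?D * (1 / (2 * pi)) = (LINT \<xi>|lborel. (of_real (- \<nu> * (\<xi> - of_int k * t)\<^sup>2) * fourier_cyl (\<omega> t) k \<xi> + fourier_cyl (g t) k \<xi>) * gauss c \<xi>)"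
  proof -
    have t0: "t \<ge> 0" using t by simp
    have i1: "integrable lborel (\<lambda>\<xi>. of_real ((\<xi> - of_int k * t)\<^sup>2) * fourier_cyl (\<omega> t) k \<xi> * gauss c \<xi>)"
      using is_fourierD(2)[OF F(1)[OF t0] schwartz_square_gauss[of "of_real (of_int k * t)"], of k]
      by (simp add: mult_ac)
    have i2: "integrable lborel (\<lambda>\<xi>. fourier_cyl (g t) k \<xi> * gauss c \<xi>)"
      by (rule is_fourierD(2)[OF F(2)[OF t0] schwartz_gauss])
    have "?D * (1 / (2 * pi)) = of_real (- \<nu>) * (LINT \<xi>|lborel. of_real ((\<xi> - of_int k * t)\<^sup>2) * fourier_cyl (\<omega> t) k \<xi> * gauss c \<xi>)
        + (LINT \<xi>|lborel. fourier_cyl (g t) k \<xi> * gauss c \<xi>)"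
      unfolding pairing_dy_shear_mode_test[OF F(1)[OF t0]] is_fourierD(3)[OF F(2)[OF t0] schwartz_gauss]
      by (simp add: scaleR_conv_of_real field_simps)
    also have "\<dots> = (LINT \<xi>|lborel. of_real (- \<nu>) * (of_real ((\<xi> - of_int k * t)\<^sup>2) * fourier_cyl (\<omega> t) k \<xi> * gauss c \<xi>)
        + fourier_cyl (g t) k \<xi> * gauss c \<xi>)"
      using i1 i2 by simp
    finally show ?thesis by (simp add: algebra_simps)
  qed
  ultimately show ?thesis by simp
qed

lemma temperature_mode_equation:
  assumes sol: "boussinesq_solution \<nu> T' N \<omega> \<theta> g" and rep: "character_representation T' M h"
    and T: "L_infinity T'" and t: "t > 0"
  shows "((\<lambda>s. LINT \<xi>|lborel. fourier_cyl (g s) k \<xi> * gauss c \<xi>) has_vector_derivative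
     - (LINT \<eta>|M. h \<eta> * (LINT \<zeta>|lborel. of_real (dxx_inv_laplace_symbol t k \<zeta>) * fourier_cyl (\<omega> t) k \<zeta> * gauss c (\<zeta> + \<eta>)))) (at t)"
proof -
  have F: "is_fourier (\<omega> s) (fourier_cyl (\<omega> s))" "is_fourier (g s) (fourier_cyl (g s))" if "s \<ge> 0" for s
    using sol that unfolding boussinesq_solution_def continuous_in_sobolev_def by (auto intro: is_fourier_fourier_cyl)
  let ?\<phi> = "mode_test k (gauss c)"
  let ?\<kappa> = "dxx_inv_laplace_symbol t k"
  from sol obtain w where w: "\<forall>t>0. is_dx_v2 t (\<omega> t) (w t)"
    and wd: "\<forall>\<phi> t. schwartz_cyl \<phi> \<longrightarrow> t > 0 \<longrightarrow>
      ((\<lambda>s. pairing (g s) \<phi>) has_vector_derivative pairing (\<lambda>(x, y). T' y * w t (x, y)) \<phi>) (at t)"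
    unfolding boussinesq_solution_def by blast
  from w t obtain \<omega>h where wt: "L2_cyl (w t)" and \<omega>h: "is_fourier (\<omega> t) \<omega>h"
    and wh: "is_fourier (w t) (\<lambda>k \<xi>. - (of_real (dxx_inv_laplace_symbol t k \<xi>) * \<omega>h k \<xi>))"
    unfolding is_dx_v2_def by blast
  let ?D = "pairing (\<lambda>(x, y). T' y * w t (x, y)) ?\<phi>"
  have "((\<lambda>s. pairing (g s) ?\<phi>) has_vector_derivative ?D) (at t)"
    using wd t schwartz_cyl_mode_test by blast
  then have "((\<lambda>s. pairing (g s) ?\<phi> * (1 / (2 * pi))) has_vector_derivative ?D * (1 / (2 * pi))) (at t)"
    by (rule has_vector_derivative_mult_left)
  then have "((\<lambda>s. LINT \<xi>|lborel. fourier_cyl (g s) k \<xi> * gauss c \<xi>) has_vector_derivative ?D * (1 / (2 * pi))) (at t)"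
    by (rule has_vector_derivative_transform_within_open[where S = "{0<..}"])
       (use t in \<open>auto simp: is_fourierD(3)[OF F(2) schwartz_gauss]\<close>)
  moreover have "?D * (1 / (2 * pi)) =
     - (LINT \<eta>|M. h \<eta> * (LINT \<zeta>|lborel. of_real (?\<kappa> \<zeta>) * fourier_cyl (\<omega> t) k \<zeta> * gauss c (\<zeta> + \<eta>)))"
  proof -
    have t0: "t \<ge> 0" using t by simp
    have Tm: "T' \<in> borel_measurable borel" using T by (simp add: L_infinity_def)
    note [measurable] = is_fourierD(1)[OF \<omega>h, of k] is_fourierD(1)[OF F(1)[OF t0], of k]
    have [measurable]: "?\<kappa> \<in> borel_measurable borel"
      unfolding dxx_inv_laplace_symbol_def[abs_def] by measurable
    have "(LINT \<zeta>|lborel. - (of_real (?\<kappa> \<zeta>) * \<omega>h k \<zeta>) * gauss c (\<zeta> + \<eta>)) =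
        (LINT \<zeta>|lborel. - (of_real (?\<kappa> \<zeta>) * fourier_cyl (\<omega> t) k \<zeta> * gauss c (\<zeta> + \<eta>)))" for \<eta>
      by (rule integral_cong_AE)
         (use is_fourier_unique[OF \<omega>h F(1)[OF t0], of k] in \<open>auto elim!: eventually_mono\<close>)
    then show ?thesis
      unfolding pairing_product_mode_test[OF wt wh rep Tm] by simp
  qed
  ultimately show ?thesis by simp
qed

text \<open>\<open>g\<close> is a derivative in \<open>x\<close>, and the test functions of mode \<open>0\<close> do not depend on \<open>x\<close>.\<close>

lemma temperature_mean_mode_vanishes:
  assumes "weak_dx \<theta> g" "is_fourier g gh"
  shows "AE \<xi> in lborel. gh 0 \<xi> = 0"
proof (rule gauss_separating)
  show "integrable lborel (\<lambda>\<xi>. gh 0 \<xi> * gauss 0 \<xi>)"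
    by (rule is_fourierD(2)[OF assms(2) schwartz_gauss])
  fix b
  let ?\<phi> = "mode_test 0 (gauss (\<i> * of_real b))"
  have "dx ?\<phi> = (\<lambda>p. 0)"
    by (auto simp: dx_def mode_test_def fun_eq_iff)
  moreover have "pairing \<theta> (dx ?\<phi>) = - pairing g ?\<phi>"
    using assms(1) schwartz_cyl_mode_test[of 0 "\<i> * of_real b"] unfolding weak_dx_def by blast
  ultimately have "pairing g ?\<phi> = 0" by (simp add: pairing_def)
  then show "(LINT \<xi>|lborel. gh 0 \<xi> * gauss (\<i> * of_real b) \<xi>) = 0"
    using is_fourierD(3)[OF assms(2) schwartz_gauss, of 0 "\<i> * of_real b"] by simp
qed

section \<open>The damped transport equation for one frequency\<close>

text \<open>The function \<open>\<beta>(t) = G / \<delta> * (1 + \<pi> / 2 + arctan x)\<close> with \<open>x = \<delta> (t - \<xi> / k)\<close> is a barrier: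
its derivative is \<open>G / (1 + x\<^sup>2)\<close>, the damping rate is at least \<open>\<delta> x\<^sup>2\<close> and \<open>\<beta> \<ge> G / \<delta>\<close>, so
\<open>\<beta>' + \<delta>\<^sup>3 (\<xi> - k t)\<^sup>2 \<beta> \<ge> G (1 / (1 + x\<^sup>2) + x\<^sup>2) \<ge> G\<close>. The comparison is made after multiplication
with the integrating factor, where it is the mean value inequality for vector-valued functions.\<close>

lemma damped_ode_bound:
  fixes y g :: "real \<Rightarrow> complex"
  assumes \<delta>: "\<delta> > 0" and k: "k \<noteq> 0 \<or> G = 0" and G: "G \<ge> 0" and T: "T \<ge> 0"
    and cont: "continuous_on {0..T} y"
    and deriv: "\<And>t. 0 < t \<Longrightarrow> t < T \<Longrightarrow>
      (y has_vector_derivative of_real (- (\<delta>^3 * (\<xi> - of_int k * t)\<^sup>2)) * y t + g t) (at t)"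
    and bound: "\<And>t. 0 < t \<Longrightarrow> t < T \<Longrightarrow> cmod (g t) \<le> G"
  shows "cmod (y T) \<le> cmod (y 0) + G * ((1 + pi) / \<delta>)"
proof (cases "T = 0")
  case True
  then show ?thesis using \<delta> G by simp
next
  case False
  with T have T0: "T > 0" by simp
  define P where "P t = \<delta>^3 * (\<xi>\<^sup>2 * t - \<xi> * of_int k * t\<^sup>2 + (of_int k)\<^sup>2 * t^3 / 3)" for t :: real
  define x where "x t = \<delta> * (t - \<xi> / of_int k)" for t :: real
  define \<beta> where "\<beta> t = G / \<delta> * (1 + pi / 2 + arctan (x t))" for t
  define p where "p t = \<delta>^3 * (\<xi> - of_int k * t)\<^sup>2" for t :: real
  have dP: "(P has_real_derivative p t) (at t)" for t
    unfolding P_def[abs_def] p_def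
    by (auto intro!: derivative_eq_intros simp: power2_eq_square power3_eq_cube algebra_simps)
  have d\<beta>: "(\<beta> has_real_derivative G * inverse (1 + (x t)\<^sup>2)) (at t)" for t
  proof -
    have dx: "(x has_real_derivative \<delta>) (at t)"
      unfolding x_def[abs_def] by (auto intro!: derivative_eq_intros)
    have "(\<beta> has_real_derivative G / \<delta> * (inverse (1 + (x t)\<^sup>2) * \<delta>)) (at t)"
      unfolding \<beta>_def[abs_def] by (auto intro!: derivative_eq_intros dx)
    then show ?thesis using \<delta> by simp
  qed
  have arctan_low: "- (pi / 2) \<le> arctan z" and arctan_up: "arctan z \<le> pi / 2" for z
    using arctan_bounded[of z] by auto
  have \<beta>0: "\<beta> t \<ge> G / \<delta>" for t
  proof -
    have "G / \<delta> * 1 \<le> \<beta> t"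
      unfolding \<beta>_def using G \<delta> arctan_low[of "x t"] by (intro mult_left_mono) auto
    then show ?thesis by simp
  qed
  have barrier: "G \<le> G * inverse (1 + (x t)\<^sup>2) + p t * \<beta> t" for t
  proof (cases "G = 0")
    case True then show ?thesis by (simp add: \<beta>_def)
  next
    case False
    with k have k0: "k \<noteq> 0" by simp
    have k1: "1 \<le> (real_of_int k)\<^sup>2"
    proof -
      have "1 \<le> \<bar>k\<bar>" using k0 by simp
      then have "1 \<le> \<bar>real_of_int k\<bar>" by linarith
      then show ?thesis using power_mono[of 1 "\<bar>real_of_int k\<bar>" 2] by simp
    qed
    have "p t = (\<delta> * (x t)\<^sup>2) * (of_int k)\<^sup>2"
      unfolding p_def x_def using k0 by (simp add: power2_eq_square power3_eq_cube field_simps)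
    also have "\<dots> \<ge> (\<delta> * (x t)\<^sup>2) * 1"
      using \<delta> k1 by (intro mult_left_mono) auto
    finally have "\<delta> * (x t)\<^sup>2 \<le> p t" by simp
    then have "(\<delta> * (x t)\<^sup>2) * (G / \<delta>) \<le> p t * \<beta> t"
      using \<beta>0[of t] \<delta> G by (intro mult_mono) (auto simp: p_def)
    then have "G * (x t)\<^sup>2 \<le> p t * \<beta> t" using \<delta> by (simp add: field_simps)
    moreover have "1 \<le> inverse (1 + (x t)\<^sup>2) + (x t)\<^sup>2"
    proof -
      have "1 + (x t)\<^sup>2 > 0" by (simp add: add_pos_nonneg)
      then show ?thesis by (simp add: field_simps)
    qed
    then have "G * 1 \<le> G * (inverse (1 + (x t)\<^sup>2) + (x t)\<^sup>2)"
      using G by (intro mult_left_mono) auto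
    ultimately show ?thesis by (simp add: distrib_left)
  qed
  have dexp: "((\<lambda>t. exp (P t)) has_real_derivative p t * exp (P t)) (at t)" for t
    using DERIV_fun_exp[OF dP] by (simp add: mult.commute)
  have contP: "continuous_on A P" for A
    using dP by (meson DERIV_isCont continuous_at_imp_continuous_on)
  have cont\<beta>: "continuous_on A \<beta>" for A
    using d\<beta> by (meson DERIV_isCont continuous_at_imp_continuous_on)
  have "norm (exp (P T) *\<^sub>R y T - exp (P 0) *\<^sub>R y 0) \<le> exp (P T) * \<beta> T - exp (P 0) * \<beta> 0"
  proof (rule differentiable_bound_general[OF T0])
    show "continuous_on {0..T} (\<lambda>t. exp (P t) *\<^sub>R y t)" "continuous_on {0..T} (\<lambda>t. exp (P t) * \<beta> t)"
      by (intro continuous_intros contP cont cont\<beta>)+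
    fix t assume t: "0 < t" "t < T"
    show "((\<lambda>t. exp (P t) *\<^sub>R y t) has_vector_derivative exp (P t) *\<^sub>R g t) (at t)"
      by (rule has_vector_derivative_eq_rhs[OF has_vector_derivative_scaleR[OF dexp deriv[OF t]]])
         (simp add: p_def scaleR_conv_of_real algebra_simps)
    have "((\<lambda>t. exp (P t) * \<beta> t) has_real_derivative exp (P t) * (G * inverse (1 + (x t)\<^sup>2)) + p t * exp (P t) * \<beta> t) (at t)"
      by (rule DERIV_mult'[OF dexp d\<beta>])
    then show "((\<lambda>t. exp (P t) * \<beta> t) has_vector_derivative exp (P t) * (G * inverse (1 + (x t)\<^sup>2) + p t * \<beta> t)) (at t)"
      unfolding has_real_derivative_iff_has_vector_derivative by (simp add: algebra_simps)
    show "norm (exp (P t) *\<^sub>R g t) \<le> exp (P t) * (G * inverse (1 + (x t)\<^sup>2) + p t * \<beta> t)"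
      using bound[OF t] barrier[of t] by simp
  qed
  moreover have "P 0 = 0" by (simp add: P_def)
  moreover have "norm (exp (P T) *\<^sub>R y T) \<le> norm (exp (P T) *\<^sub>R y T - y 0) + norm (y 0)"
    by (metis diff_add_cancel norm_triangle_ineq)
  moreover have "\<beta> 0 \<ge> 0" using \<beta>0[of 0] G \<delta> by (meson divide_nonneg_pos order_trans)
  ultimately have le: "exp (P T) * cmod (y T) \<le> exp (P T) * \<beta> T + cmod (y 0)"
    by simp
  have "P T = \<delta>^3 * T * ((\<xi> - of_int k * T / 2)\<^sup>2 + (of_int k)\<^sup>2 * T\<^sup>2 / 12)"
    by (simp add: P_def power2_eq_square power3_eq_cube field_simps)
  then have "P T \<ge> 0" using \<delta> T by (simp add: zero_le_mult_iff)
  then have "cmod (y 0) * 1 \<le> cmod (y 0) * exp (P T)"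
    by (intro mult_left_mono) auto
  with le have "exp (P T) * cmod (y T) \<le> exp (P T) * (\<beta> T + cmod (y 0))"
    by (simp add: distrib_left mult.commute)
  then have "cmod (y T) \<le> \<beta> T + cmod (y 0)" by simp
  also have "\<beta> T \<le> G / \<delta> * (1 + pi)"
    unfolding \<beta>_def using G \<delta> arctan_up[of "x T"] by (intro mult_left_mono) auto
  finally show ?thesis by simp
qed

text \<open>Let \<open>\<theta>(t) = arctan (t - \<xi> / k)\<close>, the primitive of the resonance factor, and let \<open>A\<close> be the
maximum of \<open>|g| exp (- \<mu> \<theta>)\<close>. Since \<open>exp (\<mu> \<theta>)\<close> increases, \<open>damped_ode_bound\<close> with
\<open>G = A exp (\<mu> \<theta>(r))\<close> bounds \<open>|y(r)|\<close>; inserting this into the equation for \<open>g\<close> and integrating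
gains a factor \<open>1 / \<mu>\<close>. The choice of \<open>\<mu>\<close> makes the resulting multiple of \<open>A\<close> at most \<open>A / 2\<close>.\<close>

lemma resonant_gronwall:
  fixes y g :: "real \<Rightarrow> complex"
  assumes \<delta>: "\<delta> > 0" and k: "k \<noteq> 0" and T: "T > 0"
    and cont: "continuous_on {0..T} y" "continuous_on {0..T} g"
    and dy: "\<And>t. 0 < t \<Longrightarrow> t < T \<Longrightarrow>
      (y has_vector_derivative of_real (- (\<delta>^3 * (\<xi> - of_int k * t)\<^sup>2)) * y t + g t) (at t)"
    and dg: "\<And>t. 0 < t \<Longrightarrow> t < T \<Longrightarrow>
      (g has_vector_derivative of_real (- (\<alpha> * inverse (1 + (t - \<xi> / of_int k)\<^sup>2))) * y t) (at t)"
    and t: "t \<in> {0..T}"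
    and \<mu>: "\<mu> = 2 * \<bar>\<alpha>\<bar> * ((1 + pi) / \<delta>) + 1"
  shows "cmod (g t) \<le> 2 * exp (\<mu> * pi) * (cmod (g 0) + \<bar>\<alpha>\<bar> * pi * cmod (y 0))"
proof -
  define \<theta> where "\<theta> t = arctan (t - \<xi> / of_int k)" for t :: real
  define C where "C = (1 + pi) / \<delta>"
  have C: "C > 0" using \<delta> pi_gt_zero by (simp add: C_def add_pos_pos)
  have \<mu>pos: "\<mu> > 0" using C by (simp add: \<mu> C_def[symmetric] add_nonneg_pos)
  have "2 * (\<bar>\<alpha>\<bar> * C) \<le> \<mu>" by (simp add: \<mu> C_def)
  then have \<alpha>\<mu>: "\<bar>\<alpha>\<bar> * C / \<mu> \<le> 1 / 2" using \<mu>pos by (simp add: divide_le_eq)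
  have d\<theta>: "(\<theta> has_real_derivative inverse (1 + (t - \<xi> / of_int k)\<^sup>2)) (at t)" for t
    unfolding \<theta>_def[abs_def] by (auto intro!: derivative_eq_intros)
  have cont\<theta>: "continuous_on S \<theta>" for S
    using d\<theta> by (meson DERIV_isCont continuous_at_imp_continuous_on)
  have \<theta>_mono: "\<theta> s \<le> \<theta> t" if "s \<le> t" for s t using that by (simp add: \<theta>_def arctan_le_iff)
  have \<theta>_low: "- (pi / 2) \<le> \<theta> t" and \<theta>_up: "\<theta> t \<le> pi / 2" for t
    using arctan_bounded[of "t - \<xi> / of_int k"] by (auto simp: \<theta>_def)
  have "\<exists>s\<in>{0..T}. \<forall>r\<in>{0..T}. cmod (g r) * exp (- (\<mu> * \<theta> r)) \<le> cmod (g s) * exp (- (\<mu> * \<theta> s))"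
    by (rule continuous_attains_sup) (use T in \<open>auto intro!: continuous_intros cont cont\<theta>\<close>)
  then obtain s where s: "s \<in> {0..T}"
    and smax: "\<And>r. r \<in> {0..T} \<Longrightarrow> cmod (g r) * exp (- (\<mu> * \<theta> r)) \<le> cmod (g s) * exp (- (\<mu> * \<theta> s))"
    by blast
  define A where "A = cmod (g s) * exp (- (\<mu> * \<theta> s))"
  have A0: "A \<ge> 0" by (simp add: A_def)
  have gA: "cmod (g r) \<le> A * exp (\<mu> * \<theta> r)" if "r \<in> {0..T}" for r
  proof -
    have "cmod (g r) = cmod (g r) * exp (- (\<mu> * \<theta> r)) * exp (\<mu> * \<theta> r)"
      by (simp add: mult.assoc exp_add[symmetric])
    also have "\<dots> \<le> A * exp (\<mu> * \<theta> r)"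
      unfolding A_def by (intro mult_right_mono smax that) auto
    finally show ?thesis .
  qed
  have yA: "cmod (y r) \<le> cmod (y 0) + A * exp (\<mu> * \<theta> r) * C" if r: "r \<in> {0..T}" for r
    unfolding C_def
  proof (rule damped_ode_bound[OF \<delta>, where k = k and \<xi> = \<xi> and g = g])
    show "continuous_on {0..r} y" by (rule continuous_on_subset[OF cont(1)]) (use r in auto)
    fix t assume t: "0 < t" "t < r"
    then have "cmod (g t) \<le> A * exp (\<mu> * \<theta> t)" using r by (intro gA) auto
    also have "\<dots> \<le> A * exp (\<mu> * \<theta> r)"
      using t A0 \<mu>pos \<theta>_mono[of t r] by (intro mult_left_mono) auto
    finally show "cmod (g t) \<le> A * exp (\<mu> * \<theta> r)" .
  qed (use k A0 r dy in auto)
  let ?K = "cmod (g 0) + \<bar>\<alpha>\<bar> * pi * cmod (y 0)"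
  have step: "cmod (g r) \<le> ?K + A / 2 * exp (\<mu> * \<theta> r)" if r: "r \<in> {0..T}" for r
  proof (cases "r = 0")
    case True
    have "0 \<le> \<bar>\<alpha>\<bar> * pi * cmod (y 0) + A / 2 * exp (\<mu> * \<theta> r)"
      using A0 by (intro add_nonneg_nonneg mult_nonneg_nonneg) auto
    then show ?thesis unfolding True by linarith
  next
    case False
    with r have r0: "0 < r" by simp
    define \<phi> where "\<phi> t = \<bar>\<alpha>\<bar> * (cmod (y 0) * \<theta> t + C * A / \<mu> * exp (\<mu> * \<theta> t))" for t
    have d\<phi>: "(\<phi> has_real_derivative \<bar>\<alpha>\<bar> * (inverse (1 + (t - \<xi> / of_int k)\<^sup>2) * (cmod (y 0) + A * exp (\<mu> * \<theta> t) * C))) (at t)" for t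
      unfolding \<phi>_def[abs_def] using \<mu>pos
      by (auto intro!: derivative_eq_intros d\<theta> simp: algebra_simps)
    have "norm (g r - g 0) \<le> \<phi> r - \<phi> 0"
    proof (rule differentiable_bound_general[OF r0])
      show "continuous_on {0..r} g" by (rule continuous_on_subset[OF cont(2)]) (use r in auto)
      show "continuous_on {0..r} \<phi>"
        using d\<phi> by (meson DERIV_isCont continuous_at_imp_continuous_on)
      fix t assume t: "0 < t" "t < r"
      then show "(g has_vector_derivative of_real (- (\<alpha> * inverse (1 + (t - \<xi> / of_int k)\<^sup>2))) * y t) (at t)"
        using r by (intro dg) auto
      show "(\<phi> has_vector_derivative \<bar>\<alpha>\<bar> * (inverse (1 + (t - \<xi> / of_int k)\<^sup>2) * (cmod (y 0) + A * exp (\<mu> * \<theta> t) * C))) (at t)"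
        using d\<phi> has_real_derivative_iff_has_vector_derivative by blast
      have "norm (complex_of_real (- (\<alpha> * inverse (1 + (t - \<xi> / of_int k)\<^sup>2))) * y t) =
          \<bar>\<alpha>\<bar> * (inverse (1 + (t - \<xi> / of_int k)\<^sup>2) * cmod (y t))"
        by (simp only: norm_mult norm_of_real abs_minus_cancel abs_mult) simp
      also have "\<dots> \<le> \<bar>\<alpha>\<bar> * (inverse (1 + (t - \<xi> / of_int k)\<^sup>2) * (cmod (y 0) + A * exp (\<mu> * \<theta> t) * C))"
        using t r by (intro mult_left_mono yA) auto
      finally show "norm (complex_of_real (- (\<alpha> * inverse (1 + (t - \<xi> / of_int k)\<^sup>2))) * y t) \<le>
          \<bar>\<alpha>\<bar> * (inverse (1 + (t - \<xi> / of_int k)\<^sup>2) * (cmod (y 0) + A * exp (\<mu> * \<theta> t) * C))" .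
    qed
    also have "\<dots> \<le> \<bar>\<alpha>\<bar> * pi * cmod (y 0) + A / 2 * exp (\<mu> * \<theta> r)"
    proof -
      have "\<phi> r - \<phi> 0 = \<bar>\<alpha>\<bar> * cmod (y 0) * (\<theta> r - \<theta> 0) + (\<bar>\<alpha>\<bar> * C / \<mu>) * (A * exp (\<mu> * \<theta> r)) - (\<bar>\<alpha>\<bar> * C / \<mu>) * (A * exp (\<mu> * \<theta> 0))"
        by (simp add: \<phi>_def algebra_simps)
      also have "\<dots> \<le> \<bar>\<alpha>\<bar> * cmod (y 0) * pi + 1 / 2 * (A * exp (\<mu> * \<theta> r)) - 0"
        using \<theta>_up[of r] \<theta>_low[of 0] A0 C \<mu>pos \<alpha>\<mu>
        by (intro add_mono diff_mono mult_left_mono mult_right_mono) auto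
      finally show ?thesis by (simp add: mult_ac)
    qed
    finally show ?thesis using norm_triangle_sub[of "g r" "g 0"] by linarith
  qed
  have "A * exp (\<mu> * \<theta> s) = cmod (g s)" by (simp add: A_def mult.assoc exp_add[symmetric])
  with step[OF s] have "A * exp (\<mu> * \<theta> s) \<le> 2 * ?K" by simp
  then have "A * exp (\<mu> * \<theta> s) * exp (- (\<mu> * \<theta> s)) \<le> 2 * ?K * exp (- (\<mu> * \<theta> s))"
    by (rule mult_right_mono) simp
  then have "A \<le> 2 * ?K * exp (- (\<mu> * \<theta> s))"
    by (simp add: mult.assoc exp_add[symmetric])
  also have "\<dots> \<le> 2 * ?K * exp (\<mu> * (pi / 2))"
  proof (intro mult_left_mono iffD2[OF exp_le_cancel_iff])
    have "\<mu> * (- \<theta> s) \<le> \<mu> * (pi / 2)" using \<mu>pos \<theta>_low[of s] by (intro mult_left_mono) auto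
    then show "- (\<mu> * \<theta> s) \<le> \<mu> * (pi / 2)" by simp
  qed (simp add: add_nonneg_nonneg)
  finally have A_le: "A \<le> 2 * ?K * exp (\<mu> * (pi / 2))" .
  have "cmod (g t) \<le> A * exp (\<mu> * \<theta> t)" by (rule gA[OF t])
  also have "\<dots> \<le> (2 * ?K * exp (\<mu> * (pi / 2))) * exp (\<mu> * (pi / 2))"
    using A_le \<theta>_up[of t] \<mu>pos A0 by (intro mult_mono) (auto simp: add_nonneg_nonneg)
  also have "\<dots> = 2 * exp (\<mu> * pi) * ?K"
    by (simp add: mult.assoc exp_add[symmetric]) (simp add: algebra_simps exp_add[symmetric])
  finally show ?thesis .
qed

section \<open>Square integrable families\<close>

lemma finite_cover_of_pointwise:
  fixes d :: "real \<Rightarrow> real \<Rightarrow> real"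
  assumes zero: "\<And>t. t \<in> {0..T} \<Longrightarrow> d t t = 0"
    and lim: "\<And>t. t \<in> {0..T} \<Longrightarrow> ((\<lambda>s. d s t) \<longlongrightarrow> 0) (at t within {0..T})"
    and e: "e > 0"
  obtains C \<delta> where "finite C" "C \<subseteq> {0..T}" "\<And>t. t \<in> C \<Longrightarrow> \<delta> t > 0"
    "\<And>s t. t \<in> C \<Longrightarrow> s \<in> {0..T} \<Longrightarrow> \<bar>s - t\<bar> < 2 * \<delta> t \<Longrightarrow> d s t \<le> e"
    "\<And>s. s \<in> {0..T} \<Longrightarrow> \<exists>t\<in>C. \<bar>s - t\<bar> < \<delta> t"
proof -
  have "\<exists>\<delta>>0. \<forall>s\<in>{0..T}. \<bar>s - t\<bar> < 2 * \<delta> \<longrightarrow> d s t \<le> e" if t: "t \<in> {0..T}" for t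
  proof -
    have "\<forall>\<^sub>F s in at t within {0..T}. d s t < e"
      using order_tendstoD(2)[OF lim[OF t], of e] e by simp
    then obtain \<delta> where \<delta>: "\<delta> > 0" "\<And>s. s \<in> {0..T} \<Longrightarrow> s \<noteq> t \<Longrightarrow> dist s t < \<delta> \<Longrightarrow> d s t < e"
      unfolding eventually_at by auto
    have "d s t \<le> e" if "s \<in> {0..T}" "\<bar>s - t\<bar> < 2 * (\<delta> / 2)" for s
      using \<delta>(2)[of s] that zero[OF t] e by (cases "s = t") (auto simp: dist_real_def)
    then show ?thesis using \<delta>(1) by (intro exI[of _ "\<delta> / 2"]) auto
  qed
  then obtain \<delta> where \<delta>: "\<And>t. t \<in> {0..T} \<Longrightarrow> \<delta> t > 0"
    "\<And>s t. t \<in> {0..T} \<Longrightarrow> s \<in> {0..T} \<Longrightarrow> \<bar>s - t\<bar> < 2 * \<delta> t \<Longrightarrow> d s t \<le> e"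
    by metis
  have "compact {0..T}" by simp
  moreover have "\<And>t. t \<in> {0..T} \<Longrightarrow> open (ball t (\<delta> t))" by auto
  moreover have "{0..T} \<subseteq> (\<Union>t\<in>{0..T}. ball t (\<delta> t))" using \<delta>(1) by force
  ultimately obtain C where C: "C \<subseteq> {0..T}" "finite C" "{0..T} \<subseteq> (\<Union>t\<in>C. ball t (\<delta> t))"
    by (rule compactE_image) auto
  show thesis
  proof (rule that[OF C(2,1)])
    show "\<exists>t\<in>C. \<bar>s - t\<bar> < \<delta> t" if s: "s \<in> {0..T}" for s
    proof -
      obtain t where "t \<in> C" "s \<in> ball t (\<delta> t)" using C(3) s by blast
      then show ?thesis by (auto simp: dist_real_def abs_minus_commute)
    qed
  qed (use \<delta> C(1) in auto)
qed

text \<open>The Heine-Cantor theorem for a squared distance, for which the triangle inequality carries the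
factor \<open>2\<close>.\<close>

lemma uniform_of_pointwise_on_interval:
  fixes d :: "real \<Rightarrow> real \<Rightarrow> real"
  assumes tri: "\<And>r s t. r \<in> {0..T} \<Longrightarrow> s \<in> {0..T} \<Longrightarrow> t \<in> {0..T} \<Longrightarrow> d s t \<le> 2 * d s r + 2 * d t r"
    and zero: "\<And>t. t \<in> {0..T} \<Longrightarrow> d t t = 0"
    and lim: "\<And>t. t \<in> {0..T} \<Longrightarrow> ((\<lambda>s. d s t) \<longlongrightarrow> 0) (at t within {0..T})"
    and e: "e > 0"
  obtains \<delta> where "\<delta> > 0" "\<And>s t. s \<in> {0..T} \<Longrightarrow> t \<in> {0..T} \<Longrightarrow> \<bar>s - t\<bar> < \<delta> \<Longrightarrow> d s t \<le> e"
proof -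
  have "e / 4 > 0" using e by simp
  from finite_cover_of_pointwise[OF zero lim this]
  obtain C \<delta> where C: "finite C" "C \<subseteq> {0..T}" and \<delta>: "\<And>t. t \<in> C \<Longrightarrow> \<delta> t > 0"
    and near: "\<And>s t. t \<in> C \<Longrightarrow> s \<in> {0..T} \<Longrightarrow> \<bar>s - t\<bar> < 2 * \<delta> t \<Longrightarrow> d s t \<le> e / 4"
    and cover: "\<And>s. s \<in> {0..T} \<Longrightarrow> \<exists>t\<in>C. \<bar>s - t\<bar> < \<delta> t" by metis
  define \<delta>0 where "\<delta>0 = Min (insert 1 (\<delta> ` C))"
  have "\<delta>0 > 0" unfolding \<delta>0_def using C \<delta> by (subst Min_gr_iff) auto
  moreover have "d s t \<le> e" if st: "s \<in> {0..T}" "t \<in> {0..T}" "\<bar>s - t\<bar> < \<delta>0" for s t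
  proof -
    obtain r where r: "r \<in> C" "\<bar>s - r\<bar> < \<delta> r" using cover[OF st(1)] by blast
    have "\<delta>0 \<le> \<delta> r" unfolding \<delta>0_def using r C(1) by auto
    then have "d s r \<le> e / 4" "d t r \<le> e / 4"
      by (intro near r st; use r st \<delta>[OF r(1)] in linarith)+
    moreover have "r \<in> {0..T}" using r C(2) by blast
    ultimately show ?thesis using tri[of r s t] st(1,2) by linarith
  qed
  ultimately show thesis by (rule that)
qed

lemma bounded_of_pointwise_on_interval:
  fixes d :: "real \<Rightarrow> real \<Rightarrow> real" and n :: "real \<Rightarrow> real"
  assumes tri: "\<And>s t. s \<in> {0..T} \<Longrightarrow> t \<in> {0..T} \<Longrightarrow> n s \<le> 2 * d s t + 2 * n t"
    and zero: "\<And>t. t \<in> {0..T} \<Longrightarrow> d t t = 0"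
    and lim: "\<And>t. t \<in> {0..T} \<Longrightarrow> ((\<lambda>s. d s t) \<longlongrightarrow> 0) (at t within {0..T})"
  obtains B where "\<And>t. t \<in> {0..T} \<Longrightarrow> n t \<le> B"
proof -
  from finite_cover_of_pointwise[OF zero lim zero_less_one]
  obtain C \<delta> where C: "finite C" "C \<subseteq> {0..T}" and \<delta>: "\<And>t. t \<in> C \<Longrightarrow> \<delta> t > 0"
    and near: "\<And>s t. t \<in> C \<Longrightarrow> s \<in> {0..T} \<Longrightarrow> \<bar>s - t\<bar> < 2 * \<delta> t \<Longrightarrow> d s t \<le> 1"
    and cover: "\<And>s. s \<in> {0..T} \<Longrightarrow> \<exists>t\<in>C. \<bar>s - t\<bar> < \<delta> t" by metis
  have "n t \<le> 2 + 2 * (\<Sum>r\<in>C. \<bar>n r\<bar>)" if t: "t \<in> {0..T}" for t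
  proof -
    obtain r where r: "r \<in> C" "\<bar>t - r\<bar> < \<delta> r" using cover[OF t] by blast
    have "d t r \<le> 1" by (intro near r t) (use r \<delta>[OF r(1)] in linarith)
    moreover have "n r \<le> (\<Sum>r\<in>C. \<bar>n r\<bar>)"
      using member_le_sum[OF r(1), of "\<lambda>r. \<bar>n r\<bar>"] C(1) by simp
    moreover have "r \<in> {0..T}" using r C(2) by blast
    ultimately show ?thesis using tri[OF t, of r] by linarith
  qed
  then show thesis by (rule that)
qed

text \<open>The values \<open>f s\<close> are representatives chosen independently for each \<open>s\<close>, so \<open>f\<close> itself need not be
measurable in both variables. Step functions in time are, and along fast enough refinements they
converge to \<open>f s\<close> almost everywhere for every fixed \<open>s\<close>.\<close>

lemma measurable_version:
  fixes f :: "real \<Rightarrow> real \<Rightarrow> complex"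
  assumes meas: "\<And>s. s \<in> {0..T} \<Longrightarrow> f s \<in> borel_measurable borel"
    and unif: "\<And>e. e > 0 \<Longrightarrow> \<exists>\<delta>>0. \<forall>s\<in>{0..T}. \<forall>t\<in>{0..T}. \<bar>s - t\<bar> < \<delta> \<longrightarrow>
        (\<integral>\<^sup>+\<xi>. ennreal ((cmod (f s \<xi> - f t \<xi>))\<^sup>2) \<partial>lborel) \<le> ennreal e"
  obtains F where "F \<in> borel_measurable (borel \<Otimes>\<^sub>M borel)"
    "\<And>s. s \<in> {0..T} \<Longrightarrow> AE \<xi> in lborel. F (s, \<xi>) = f s \<xi>"
proof -
  let ?near = "\<lambda>n r. r > 0 \<and> (\<forall>s\<in>{0..T}. \<forall>t\<in>{0..T}. \<bar>s - t\<bar> < 2 * r \<longrightarrow>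
        (\<integral>\<^sup>+\<xi>. ennreal ((cmod (f s \<xi> - f t \<xi>))\<^sup>2) \<partial>lborel) \<le> ennreal ((1/2)^n))"
  have "\<forall>n::nat. \<exists>r. ?near n r"
  proof
    fix n :: nat
    obtain r where "r > 0" "\<forall>s\<in>{0..T}. \<forall>t\<in>{0..T}. \<bar>s - t\<bar> < r \<longrightarrow>
        (\<integral>\<^sup>+\<xi>. ennreal ((cmod (f s \<xi> - f t \<xi>))\<^sup>2) \<partial>lborel) \<le> ennreal ((1/2)^n)"
      using unif[of "(1/2)^n"] by auto
    then show "\<exists>r. ?near n r" by (intro exI[of _ "r / 2"]) auto
  qed
  then have "\<exists>\<delta>. \<forall>n. ?near n (\<delta> n)" by (rule choice)
  then obtain \<delta> where near: "\<forall>n. ?near n (\<delta> n)" by blast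
  have \<delta>: "\<delta> n > 0"
    "\<lbrakk>s \<in> {0..T}; t \<in> {0..T}; \<bar>s - t\<bar> < 2 * \<delta> n\<rbrakk> \<Longrightarrow>
        (\<integral>\<^sup>+\<xi>. ennreal ((cmod (f s \<xi> - f t \<xi>))\<^sup>2) \<partial>lborel) \<le> ennreal ((1/2)^n)" for n s t
    using near by blast+
  define f' where "f' s = (if s \<in> {0..T} then f s else (\<lambda>_. 0))" for s
  have [measurable]: "f' s \<in> borel_measurable borel" for s
    using meas[of s] by (cases "s \<in> {0..T}") (auto simp: f'_def)
  \<comment> \<open>Sampling on grid \<open>n\<close> has squared \<open>L\<^sup>2\<close> error at most \<open>1 / 2 ^ n\<close>, which is summable.\<close>
  define F where "F n p = f' (\<delta> n * of_int \<lfloor>fst p / \<delta> n\<rfloor>) (snd p)" for n and p :: "real \<times> real"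
  have F_meas[measurable]: "F n \<in> borel_measurable (borel \<Otimes>\<^sub>M borel)" for n
  proof -
    have "(\<lambda>p::real \<times> real. f' (\<delta> n * of_int i) (snd p)) \<in> borel_measurable (borel \<Otimes>\<^sub>M borel)" for i :: int
      by measurable
    moreover have "(\<lambda>p::real \<times> real. \<lfloor>fst p / \<delta> n\<rfloor>) \<in> borel \<Otimes>\<^sub>M borel \<rightarrow>\<^sub>M count_space UNIV"
      by measurable
    ultimately have "(\<lambda>p::real \<times> real. (\<lambda>i p. f' (\<delta> n * of_int i) (snd p)) \<lfloor>fst p / \<delta> n\<rfloor> p) \<in> borel_measurable (borel \<Otimes>\<^sub>M borel)"
      by (rule measurable_compose_countable)
    then show ?thesis unfolding F_def[abs_def] .
  qed
  define G where "G p = lim (\<lambda>n. F n p)" for p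
  have G_meas: "G \<in> borel_measurable (borel \<Otimes>\<^sub>M borel)" unfolding G_def[abs_def] by measurable
  moreover have "AE \<xi> in lborel. G (s, \<xi>) = f s \<xi>" if s: "s \<in> {0..T}" for s
  proof -
    have [measurable]: "f s \<in> borel_measurable borel" by (rule meas[OF s])
    have le: "(\<integral>\<^sup>+\<xi>. ennreal ((cmod (F n (s, \<xi>) - f s \<xi>))\<^sup>2) \<partial>lborel) \<le> ennreal ((1/2)^n)" for n
    proof -
      let ?r = "\<delta> n * of_int \<lfloor>s / \<delta> n\<rfloor>"
      have r1: "?r \<le> s" "s < ?r + \<delta> n"
        using floor_divide_lower[OF \<delta>(1), of s n] floor_divide_upper[OF \<delta>(1), of s n]
        by (simp_all add: algebra_simps)
      moreover have "0 \<le> ?r" using s \<delta>(1)[of n] by (auto intro!: mult_nonneg_nonneg simp: less_imp_le)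
      ultimately have r: "?r \<in> {0..T}" "\<bar>?r - s\<bar> < 2 * \<delta> n" using s \<delta>(1)[of n] by auto
      from \<delta>(2)[OF r(1) s r(2)] show ?thesis using r(1) by (simp add: F_def f'_def)
    qed
    have "(\<integral>\<^sup>+\<xi>. (\<Sum>n. ennreal ((cmod (F n (s, \<xi>) - f s \<xi>))\<^sup>2)) \<partial>lborel) =
        (\<Sum>n. \<integral>\<^sup>+\<xi>. ennreal ((cmod (F n (s, \<xi>) - f s \<xi>))\<^sup>2) \<partial>lborel)"
      by (rule nn_integral_suminf) measurable
    also have "\<dots> \<le> (\<Sum>n. ennreal ((1/2)^n))" by (intro suminf_le le) auto
    also have "\<dots> < \<infinity>" by (subst suminf_ennreal2) auto
    finally have "AE \<xi> in lborel. (\<Sum>n. ennreal ((cmod (F n (s, \<xi>) - f s \<xi>))\<^sup>2)) \<noteq> \<infinity>"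
      by (intro nn_integral_PInf_AE) (auto simp: less_top)
    then show ?thesis
    proof eventually_elim
      case (elim \<xi>)
      then have "summable (\<lambda>n. (cmod (F n (s, \<xi>) - f s \<xi>))\<^sup>2)"
        by (intro summable_suminf_not_top) auto
      then have "(\<lambda>n. (cmod (F n (s, \<xi>) - f s \<xi>))\<^sup>2) \<longlonglongrightarrow> 0" by (rule summable_LIMSEQ_zero)
      then have "(\<lambda>n. sqrt ((cmod (F n (s, \<xi>) - f s \<xi>))\<^sup>2)) \<longlonglongrightarrow> sqrt 0" by (rule tendsto_real_sqrt)
      then have "(\<lambda>n. F n (s, \<xi>)) \<longlonglongrightarrow> f s \<xi>"
        by (simp add: tendsto_norm_zero_iff LIM_zero_iff)
      then show ?case unfolding G_def by (rule limI)
    qed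
  qed
  ultimately show thesis by (rule that)
qed

abbreviation square_integral :: "(real \<Rightarrow> ennreal) \<Rightarrow> ennreal" where
  "square_integral f \<equiv> (\<integral>\<^sup>+\<xi>. (f \<xi>)\<^sup>2 \<partial>lborel)"

lemma square_add3_le: 
  fixes a b c :: ennreal shows "(a + b + c)\<^sup>2 \<le> 3 * (a\<^sup>2 + b\<^sup>2 + c\<^sup>2)"
proof (cases "a = \<infinity> \<or> b = \<infinity> \<or> c = \<infinity>")
  case True then show ?thesis by (auto simp: power2_eq_square)
next
  case False
  then obtain x y z where "a = ennreal x" "b = ennreal y" "c = ennreal z" "x \<ge> 0" "y \<ge> 0" "z \<ge> 0"
    by (cases a; cases b; cases c) auto
  moreover have "(x + y + z)\<^sup>2 \<le> 3 * (x\<^sup>2 + y\<^sup>2 + z\<^sup>2)"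
  proof -
    have "0 \<le> (x - y)\<^sup>2 + (y - z)\<^sup>2 + (x - z)\<^sup>2" by simp
    then show ?thesis by (simp add: power2_eq_square algebra_simps)
  qed
  ultimately show ?thesis
    by (simp add: ennreal_power ennreal_plus[symmetric] ennreal_mult[symmetric] del: ennreal_plus flip: ennreal_numeral)
qed

section \<open>Sobolev weights and convolution\<close>

definition weight_ratio :: "nat \<Rightarrow> real \<Rightarrow> real \<Rightarrow> real" where
  "weight_ratio N z \<xi> = ((1 + \<bar>z\<bar>) / (1 + \<bar>\<xi>\<bar>) + (1 + \<bar>\<xi>\<bar>) / (1 + \<bar>z\<bar>)) ^ N"

text \<open>Equivalent, up to constants that depend on \<open>N\<close>, to the square root of the Sobolev weight
\<open>(1 + k\<^sup>2 + \<xi>\<^sup>2)\<^sup>N\<close>. For this version the quotient at two frequencies is bounded by \<^const>\<open>weight_ratio\<close>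
with constant \<open>1\<close> (\<open>mode_weight_le\<close>), so that the smallness of the weighted variation is inherited
without loss.\<close>

definition mode_weight :: "nat \<Rightarrow> int \<Rightarrow> real \<Rightarrow> real" where
  "mode_weight N k \<xi> = (max (1 + \<bar>\<xi>\<bar>) \<bar>of_int k\<bar>) ^ N"

lemma weight_ratio_ge_1: "1 \<le> weight_ratio N z \<xi>"
proof -
  let ?a = "1 + \<bar>z\<bar>" and ?b = "1 + \<bar>\<xi>\<bar>"
  have "1 \<le> ?a / ?b \<or> 1 \<le> ?b / ?a" by (auto simp: field_simps)
  moreover have "0 \<le> ?a / ?b" "0 \<le> ?b / ?a" by auto
  ultimately have "1 \<le> ?a / ?b + ?b / ?a" by linarith
  then show ?thesis unfolding weight_ratio_def by (rule one_le_power)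
qed

lemma mode_weight_ge_1: "1 \<le> mode_weight N k \<xi>"
  unfolding mode_weight_def by (intro one_le_power) auto

lemma mode_weight_le: "mode_weight N k \<xi> \<le> weight_ratio N \<xi> z * mode_weight N k z"
proof -
  let ?a = "1 + \<bar>\<xi>\<bar>" and ?b = "1 + \<bar>z\<bar>"
  let ?r = "?a / ?b + ?b / ?a" and ?m = "max ?b \<bar>of_int k\<bar>"
  have r1: "1 \<le> ?r" using weight_ratio_ge_1[of 1 \<xi> z] by (simp add: weight_ratio_def)
  have "?a = (?a / ?b) * ?b" by simp
  also have "\<dots> \<le> ?r * ?m" by (intro mult_mono) auto
  finally have "?a \<le> ?r * ?m" .
  moreover have "\<bar>of_int k\<bar> \<le> ?r * ?m"
    using mult_mono[OF r1, of "\<bar>of_int k\<bar>" ?m] r1 by auto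
  ultimately have "max ?a \<bar>of_int k\<bar> \<le> ?r * ?m" by simp
  then have "(max ?a \<bar>of_int k\<bar>) ^ N \<le> (?r * ?m) ^ N" by (intro power_mono) auto
  then show ?thesis by (simp add: mode_weight_def weight_ratio_def power_mult_distrib)
qed

lemma mode_weight_measurable [measurable]: "mode_weight N k \<in> borel_measurable borel"
  unfolding mode_weight_def[abs_def] by measurable

lemma weight_ratio_measurable [measurable]:
  assumes [measurable]: "f \<in> borel_measurable M" "g \<in> borel_measurable M"
  shows "(\<lambda>x. weight_ratio N (f x) (g x)) \<in> borel_measurable M"
  unfolding weight_ratio_def by measurable

lemma sobolev_weight_equivalent:
  "(1 + (of_int k)\<^sup>2 + \<xi>\<^sup>2) ^ N \<le> 2 ^ N * (mode_weight N k \<xi>)\<^sup>2"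
  "(mode_weight N k \<xi>)\<^sup>2 \<le> 2 ^ N * (1 + (of_int k)\<^sup>2 + \<xi>\<^sup>2) ^ N"
proof -
  let ?m = "max (1 + \<bar>\<xi>\<bar>) \<bar>of_int k\<bar>"
  have m: "(mode_weight N k \<xi>)\<^sup>2 = (?m\<^sup>2) ^ N"
    by (simp add: mode_weight_def power_mult[symmetric] mult.commute)
  have a: "(1 + \<bar>\<xi>\<bar>)\<^sup>2 \<le> ?m\<^sup>2" "\<bar>of_int k\<bar>\<^sup>2 \<le> ?m\<^sup>2" by (intro power_mono; simp)+
  moreover have "1 + \<xi>\<^sup>2 \<le> (1 + \<bar>\<xi>\<bar>)\<^sup>2" by (simp add: power2_sum)
  ultimately have "1 + (of_int k)\<^sup>2 + \<xi>\<^sup>2 \<le> 2 * ?m\<^sup>2" unfolding power2_abs by linarith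
  then have "(1 + (of_int k)\<^sup>2 + \<xi>\<^sup>2) ^ N \<le> (2 * ?m\<^sup>2) ^ N" by (intro power_mono) (auto intro!: add_nonneg_nonneg)
  then show "(1 + (of_int k)\<^sup>2 + \<xi>\<^sup>2) ^ N \<le> 2 ^ N * (mode_weight N k \<xi>)\<^sup>2"
    unfolding m by (simp add: power_mult_distrib)
  have "0 \<le> (1 - \<bar>\<xi>\<bar>)\<^sup>2" by simp
  then have "(1 + \<bar>\<xi>\<bar>)\<^sup>2 \<le> 2 * (1 + \<xi>\<^sup>2)" by (simp add: power2_eq_square algebra_simps)
  moreover have "\<bar>of_int k\<bar>\<^sup>2 \<le> 2 * (1 + (of_int k)\<^sup>2 + \<xi>\<^sup>2)"
  proof -
    have "a \<le> 2 * (1 + a + b)" if "0 \<le> a" "0 \<le> b" for a b :: real using that by simp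
    then show ?thesis by simp
  qed
  moreover have "2 * (1 + \<xi>\<^sup>2) \<le> 2 * (1 + (of_int k)\<^sup>2 + \<xi>\<^sup>2)" by simp
  ultimately have "?m\<^sup>2 \<le> 2 * (1 + (of_int k)\<^sup>2 + \<xi>\<^sup>2)"
    by (cases "1 + \<bar>\<xi>\<bar> \<le> \<bar>of_int k\<bar>") (simp_all only: max_def if_True if_False)
  then have "(?m\<^sup>2) ^ N \<le> (2 * (1 + (of_int k)\<^sup>2 + \<xi>\<^sup>2)) ^ N" by (intro power_mono) auto
  then show "(mode_weight N k \<xi>)\<^sup>2 \<le> 2 ^ N * (1 + (of_int k)\<^sup>2 + \<xi>\<^sup>2) ^ N"
    unfolding m by (simp only: power_mult_distrib)
qed

text \<open>Schur's test: the weight is moved to \<open>a\<close> at the price of the kernel \<open>weight_ratio\<close>, the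
Cauchy-Schwarz inequality distributes the kernel over both factors, and each of the two marginals
is at most \<open>S\<close>.\<close>

lemma weighted_convolution_bound:
  fixes a :: "real \<Rightarrow> ennreal"
  assumes M: "sets M = sets borel" "finite_measure M"
    and S: "\<And>\<xi>. (\<integral>\<^sup>+\<eta>. ennreal (weight_ratio N (\<eta> + \<xi>) \<xi>) \<partial>M) \<le> S"
    and a[measurable]: "a \<in> borel_measurable borel"
  shows "(square_integral (\<lambda>\<xi>. ennreal (mode_weight N k \<xi>) * (\<integral>\<^sup>+\<eta>. a (\<xi> - \<eta>) \<partial>M)))
    \<le> S\<^sup>2 * (square_integral (\<lambda>\<xi>. ennreal (mode_weight N k \<xi>) * a \<xi>))"
proof -
  interpret M: finite_measure M by fact
  interpret pair_sigma_finite M lborel ..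
  note [measurable_cong] = M(1)
  define f where "f \<xi> = ennreal (mode_weight N k \<xi>) * a \<xi>" for \<xi>
  define r where "r z \<xi> = ennreal (sqrt (weight_ratio N z \<xi>))" for z \<xi>
  have [measurable]: "f \<in> borel_measurable borel" unfolding f_def[abs_def] by measurable
  have r_meas[measurable]: "(\<lambda>x. r (p x) (q x)) \<in> borel_measurable L"
    if [measurable]: "p \<in> borel_measurable L" "q \<in> borel_measurable L" for p q and L :: "'c measure"
    unfolding r_def by measurable
  have wr0: "0 \<le> weight_ratio N z \<xi>" for z \<xi> using weight_ratio_ge_1[of N z \<xi>] by simp
  have r2: "(r z \<xi>)\<^sup>2 = ennreal (weight_ratio N z \<xi>)" for z \<xi>
    unfolding r_def using wr0[of z \<xi>] by (simp add: ennreal_power)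
  \<comment> \<open>The weight depends on absolute values only, so a reflection turns one Schur condition into the other.\<close>
  have refl: "weight_ratio N \<xi> (\<xi> - \<eta>) = weight_ratio N (\<eta> + (- \<xi>)) (- \<xi>)" for \<xi> \<eta>
  proof -
    have "\<bar>\<eta> + - \<xi>\<bar> = \<bar>\<xi> - \<eta>\<bar>" by simp
    then show ?thesis unfolding weight_ratio_def by (simp only: abs_minus_cancel add.commute)
  qed
  have S': "(\<integral>\<^sup>+\<eta>. ennreal (weight_ratio N \<xi> (\<xi> - \<eta>)) \<partial>M) \<le> S" for \<xi>
    unfolding refl by (rule S)
  have pointwise: "(ennreal (mode_weight N k \<xi>) * (\<integral>\<^sup>+\<eta>. a (\<xi> - \<eta>) \<partial>M))\<^sup>2 \<le>
      S * (\<integral>\<^sup>+\<eta>. (f (\<xi> - \<eta>))\<^sup>2 * ennreal (weight_ratio N \<xi> (\<xi> - \<eta>)) \<partial>M)" for \<xi>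
  proof -
    have "ennreal (mode_weight N k \<xi>) * (\<integral>\<^sup>+\<eta>. a (\<xi> - \<eta>) \<partial>M) = (\<integral>\<^sup>+\<eta>. ennreal (mode_weight N k \<xi>) * a (\<xi> - \<eta>) \<partial>M)"
      by (rule nn_integral_cmult[symmetric]) measurable
    also have "\<dots> \<le> (\<integral>\<^sup>+\<eta>. (f (\<xi> - \<eta>) * r \<xi> (\<xi> - \<eta>)) * r \<xi> (\<xi> - \<eta>) \<partial>M)"
    proof (rule nn_integral_mono)
      fix \<eta>
      have "ennreal (mode_weight N k \<xi>) \<le> ennreal (weight_ratio N \<xi> (\<xi> - \<eta>) * mode_weight N k (\<xi> - \<eta>))"
        by (intro ennreal_leI mode_weight_le)
      also have "\<dots> = (r \<xi> (\<xi> - \<eta>))\<^sup>2 * ennreal (mode_weight N k (\<xi> - \<eta>))"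
        unfolding r2 using wr0 by (intro ennreal_mult') 
      finally have "ennreal (mode_weight N k \<xi>) * a (\<xi> - \<eta>) \<le> ((r \<xi> (\<xi> - \<eta>))\<^sup>2 * ennreal (mode_weight N k (\<xi> - \<eta>))) * a (\<xi> - \<eta>)"
        by (rule mult_right_mono) simp
      then show "ennreal (mode_weight N k \<xi>) * a (\<xi> - \<eta>) \<le> (f (\<xi> - \<eta>) * r \<xi> (\<xi> - \<eta>)) * r \<xi> (\<xi> - \<eta>)"
        by (simp add: f_def power2_eq_square mult_ac)
    qed
    finally have "(ennreal (mode_weight N k \<xi>) * (\<integral>\<^sup>+\<eta>. a (\<xi> - \<eta>) \<partial>M))\<^sup>2 \<le>
        (\<integral>\<^sup>+\<eta>. (f (\<xi> - \<eta>) * r \<xi> (\<xi> - \<eta>)) * r \<xi> (\<xi> - \<eta>) \<partial>M)\<^sup>2"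
      by (intro power_mono) auto
    also have "\<dots> \<le> (\<integral>\<^sup>+\<eta>. (f (\<xi> - \<eta>) * r \<xi> (\<xi> - \<eta>))\<^sup>2 \<partial>M) * (\<integral>\<^sup>+\<eta>. (r \<xi> (\<xi> - \<eta>))\<^sup>2 \<partial>M)"
      by (rule Cauchy_Schwarz_nn_integral) measurable
    also have "\<dots> \<le> (\<integral>\<^sup>+\<eta>. (f (\<xi> - \<eta>) * r \<xi> (\<xi> - \<eta>))\<^sup>2 \<partial>M) * S"
      unfolding r2 by (intro mult_left_mono S') auto
    finally show ?thesis by (simp add: power_mult_distrib r2 mult.commute)
  qed
  have "(square_integral (\<lambda>\<xi>. ennreal (mode_weight N k \<xi>) * (\<integral>\<^sup>+\<eta>. a (\<xi> - \<eta>) \<partial>M))) \<le>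
      (\<integral>\<^sup>+\<xi>. S * (\<integral>\<^sup>+\<eta>. (f (\<xi> - \<eta>))\<^sup>2 * ennreal (weight_ratio N \<xi> (\<xi> - \<eta>)) \<partial>M) \<partial>lborel)"
    by (intro nn_integral_mono pointwise)
  also have "\<dots> = S * (\<integral>\<^sup>+\<xi>. (\<integral>\<^sup>+\<eta>. (f (\<xi> - \<eta>))\<^sup>2 * ennreal (weight_ratio N \<xi> (\<xi> - \<eta>)) \<partial>M) \<partial>lborel)"
    by (rule nn_integral_cmult) measurable
  also have "(\<integral>\<^sup>+\<xi>. (\<integral>\<^sup>+\<eta>. (f (\<xi> - \<eta>))\<^sup>2 * ennreal (weight_ratio N \<xi> (\<xi> - \<eta>)) \<partial>M) \<partial>lborel) =
      (\<integral>\<^sup>+\<eta>. (\<integral>\<^sup>+\<xi>. (f (\<xi> - \<eta>))\<^sup>2 * ennreal (weight_ratio N \<xi> (\<xi> - \<eta>)) \<partial>lborel) \<partial>M)"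
    by (rule Fubini') measurable
  also have "\<dots> = (\<integral>\<^sup>+\<eta>. (\<integral>\<^sup>+\<xi>. (f \<xi>)\<^sup>2 * ennreal (weight_ratio N (\<eta> + \<xi>) \<xi>) \<partial>lborel) \<partial>M)"
  proof (rule nn_integral_cong)
    fix \<eta>
    have "(\<integral>\<^sup>+\<xi>. (f (\<xi> - \<eta>))\<^sup>2 * ennreal (weight_ratio N \<xi> (\<xi> - \<eta>)) \<partial>lborel) =
      ennreal \<bar>1\<bar> * (\<integral>\<^sup>+\<xi>. (f ((\<eta> + 1 * \<xi>) - \<eta>))\<^sup>2 * ennreal (weight_ratio N (\<eta> + 1 * \<xi>) ((\<eta> + 1 * \<xi>) - \<eta>)) \<partial>lborel)"
      by (rule nn_integral_real_affine) auto
    then show "(\<integral>\<^sup>+\<xi>. (f (\<xi> - \<eta>))\<^sup>2 * ennreal (weight_ratio N \<xi> (\<xi> - \<eta>)) \<partial>lborel) =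
      (\<integral>\<^sup>+\<xi>. (f \<xi>)\<^sup>2 * ennreal (weight_ratio N (\<eta> + \<xi>) \<xi>) \<partial>lborel)" by simp
  qed
  also have "\<dots> = (\<integral>\<^sup>+\<xi>. (\<integral>\<^sup>+\<eta>. (f \<xi>)\<^sup>2 * ennreal (weight_ratio N (\<eta> + \<xi>) \<xi>) \<partial>M) \<partial>lborel)"
    by (rule Fubini'[symmetric]) measurable
  also have "\<dots> = (\<integral>\<^sup>+\<xi>. (f \<xi>)\<^sup>2 * (\<integral>\<^sup>+\<eta>. ennreal (weight_ratio N (\<eta> + \<xi>) \<xi>) \<partial>M) \<partial>lborel)"
    by (intro nn_integral_cong nn_integral_cmult) measurable
  also have "\<dots> \<le> (\<integral>\<^sup>+\<xi>. (f \<xi>)\<^sup>2 * S \<partial>lborel)"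
    by (intro nn_integral_mono mult_left_mono S) auto
  also have "\<dots> = S * (square_integral (\<lambda>\<xi>. f \<xi>))"
    by (subst nn_integral_multc) (auto simp: mult.commute)
  finally show ?thesis
    unfolding f_def by (simp add: power2_eq_square mult.assoc mult_left_mono)
qed

section \<open>From weak equations to ordinary differential equations\<close>

lemma continuous_indefinite_integral:
  fixes f :: "real \<Rightarrow> complex"
  assumes "set_integrable lborel {0..T} f"
  shows "continuous_on {0..T} (\<lambda>t. LINT s|lborel. indicator {0..t} s *\<^sub>R f s)"
proof -
  have "f integrable_on {0..T}" using set_borel_integral_eq_integral(1)[OF assms] .
  then have "continuous_on {0..T} (\<lambda>t. integral {0..t} f)" by (rule indefinite_integral_continuous_1)
  moreover have "(LINT s|lborel. indicator {0..t} s *\<^sub>R f s) = integral {0..t} f" if "t \<in> {0..T}" for t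
  proof -
    have "set_integrable lborel {0..t} f" by (rule set_integrable_subset[OF assms]) (use that in auto)
    then show ?thesis using set_borel_integral_eq_integral(2) by (simp add: set_lebesgue_integral_def)
  qed
  ultimately show ?thesis by (subst continuous_on_cong[OF refl]) auto
qed

lemma derivative_indefinite_integral:
  fixes f g :: "real \<Rightarrow> complex"
  assumes f: "f \<in> borel_measurable borel" and eq: "AE s in lborel. s \<in> {0..T} \<longrightarrow> f s = g s"
    and g: "continuous_on {0..T} g" and t: "0 < t" "t < T"
  shows "((\<lambda>t. LINT s|lborel. indicator {0..t} s *\<^sub>R f s) has_vector_derivative g t) (at t)"
proof -
  note [measurable] = f
  have int: "(LINT s|lborel. indicator {0..r} s *\<^sub>R f s) = integral {0..r} g" if r: "r \<in> {0..T}" for r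
  proof -
    have gr: "set_integrable lborel {0..r} g"
      by (intro borel_integrable_atLeastAtMost' continuous_on_subset[OF g]) (use r in auto)
    have [measurable]: "(\<lambda>s. indicator {0..r} s *\<^sub>R g s) \<in> borel_measurable borel"
      using gr by (simp add: set_integrable_def)
    have "(LINT s|lborel. indicator {0..r} s *\<^sub>R f s) = (LINT s|lborel. indicator {0..r} s *\<^sub>R g s)"
    proof (rule integral_cong_AE)
      show "AE s in lborel. indicator {0..r} s *\<^sub>R f s = indicator {0..r} s *\<^sub>R g s"
        using eq by eventually_elim (use r in \<open>auto simp: indicator_def\<close>)
    qed measurable
    then show ?thesis using set_borel_integral_eq_integral(2)[OF gr] by (simp add: set_lebesgue_integral_def)
  qed
  have "((\<lambda>r. integral {0..r} g) has_vector_derivative g t) (at t within {0..T})"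
    by (rule integral_has_vector_derivative[OF g]) (use t in auto)
  then have "((\<lambda>r. integral {0..r} g) has_vector_derivative g t) (at t)"
    using t by (simp add: at_within_Icc_at)
  then show ?thesis
    by (rule has_vector_derivative_transform_within_open[where S = "{0<..<T}"]) (use t int in auto)
qed

lemma norm_integral_le_nn_integral:
  fixes f :: "'a \<Rightarrow> 'b::{banach, second_countable_topology}"
  shows "ennreal (norm (integral\<^sup>L M f)) \<le> (\<integral>\<^sup>+x. ennreal (norm (f x)) \<partial>M)"
  by (cases "integrable M f") (auto simp: integral_norm_bound_ennreal not_integrable_integral_eq)

lemma ennreal_square_finite_iff: "(a::ennreal)\<^sup>2 < \<infinity> \<longleftrightarrow> a < \<infinity>"
  by (cases a) (auto simp: power2_eq_square ennreal_mult_less_top)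

lemma nn_integral_product_finite:
  fixes f g :: "real \<Rightarrow> ennreal"
  assumes [measurable]: "f \<in> borel_measurable M" "g \<in> borel_measurable M"
    and "(\<integral>\<^sup>+x. (f x)\<^sup>2 \<partial>M) < \<infinity>" "(\<integral>\<^sup>+x. (g x)\<^sup>2 \<partial>M) < \<infinity>"
  shows "(\<integral>\<^sup>+x. f x * g x \<partial>M) < \<infinity>"
proof -
  have "(\<integral>\<^sup>+x. f x * g x \<partial>M)\<^sup>2 \<le> (\<integral>\<^sup>+x. (f x)\<^sup>2 \<partial>M) * (\<integral>\<^sup>+x. (g x)\<^sup>2 \<partial>M)"
    by (rule Cauchy_Schwarz_nn_integral) measurable
  also have "\<dots> < \<infinity>" using assms(3,4) by (simp add: ennreal_mult_less_top)
  finally show ?thesis by (simp only: ennreal_square_finite_iff)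
qed

lemma schwartz_square_finite:
  assumes "schwartz \<psi>"
  shows "(square_integral (\<lambda>\<xi>. ennreal (cmod (\<psi> \<xi>)))) < \<infinity>"
proof -
  have [measurable]: "\<psi> \<in> borel_measurable borel" by (rule schwartz_measurable[OF assms])
  obtain B where B: "B \<ge> 0" "\<And>y. cmod (\<psi> y) * \<bar>y\<bar> ^ 0 \<le> B" using schwartz_decay[OF assms, of 0] by blast
  have "(square_integral (\<lambda>\<xi>. ennreal (cmod (\<psi> \<xi>)))) \<le> (\<integral>\<^sup>+\<xi>. ennreal B * ennreal (cmod (\<psi> \<xi>)) \<partial>lborel)"
  proof (rule nn_integral_mono)
    fix \<xi>
    have "ennreal (cmod (\<psi> \<xi>)) \<le> ennreal B" using B(2)[of \<xi>] by (simp add: ennreal_leI)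
    then show "(ennreal (cmod (\<psi> \<xi>)))\<^sup>2 \<le> ennreal B * ennreal (cmod (\<psi> \<xi>))"
      by (simp add: power2_eq_square mult_right_mono)
  qed
  also have "\<dots> = ennreal B * (\<integral>\<^sup>+\<xi>. ennreal (cmod (\<psi> \<xi>)) \<partial>lborel)" by (rule nn_integral_cmult) measurable
  also have "\<dots> < \<infinity>"
    using schwartz_integrable[OF assms] by (auto simp: integrable_iff_bounded ennreal_mult_less_top)
  finally show ?thesis .
qed

lemma symbol_measurable [measurable]:
  assumes [measurable]: "f \<in> borel_measurable M" "g \<in> borel_measurable M"
  shows "(\<lambda>x. dxx_inv_laplace_symbol (f x) k (g x)) \<in> borel_measurable M"
  unfolding dxx_inv_laplace_symbol_def by measurable

lemma symbol_bounds: "0 \<le> dxx_inv_laplace_symbol t k \<xi>" "dxx_inv_laplace_symbol t k \<xi> \<le> 1"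
  by (auto simp: dxx_inv_laplace_symbol_def divide_le_eq not_sum_power2_lt_zero intro!: divide_nonneg_nonneg add_nonneg_nonneg)

lemma symbol_resonant:
  assumes "k \<noteq> 0"
  shows "dxx_inv_laplace_symbol t k \<xi> = inverse (1 + (t - \<xi> / of_int k)\<^sup>2)"
proof -
  have "(of_int k)\<^sup>2 + (\<xi> - of_int k * t)\<^sup>2 = (of_int k)\<^sup>2 * (1 + (t - \<xi> / of_int k)\<^sup>2)"
    using assms by (simp add: power2_eq_square field_simps)
  then show ?thesis using assms by (simp add: dxx_inv_laplace_symbol_def divide_inverse)
qed

lemma symbol_time_integral:
  "(\<integral>\<^sup>+s. ennreal (indicator {0..T} s * dxx_inv_laplace_symbol s k \<xi>) \<partial>lborel) \<le> ennreal pi"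
proof (cases "k = 0 \<or> T < 0")
  case True
  then have eq: "indicator {0..T} s * dxx_inv_laplace_symbol s k \<xi> = 0" for s
    by (auto simp: dxx_inv_laplace_symbol_def)
  show ?thesis unfolding eq by simp
next
  case False
  then have k: "k \<noteq> 0" and T: "0 \<le> T" by auto
  have "(\<integral>\<^sup>+s. ennreal (indicator {0..T} s * dxx_inv_laplace_symbol s k \<xi>) \<partial>lborel) =
      (\<integral>\<^sup>+s. ennreal (inverse (1 + (s - \<xi> / of_int k)\<^sup>2)) * indicator {0..T} s \<partial>lborel)"
    by (intro nn_integral_cong) (auto simp: symbol_resonant[OF k] indicator_def)
  also have "\<dots> = ennreal (arctan (T - \<xi> / of_int k) - arctan (0 - \<xi> / of_int k))"
    by (rule nn_integral_FTC_Icc[OF _ _ _ T])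
       (auto intro!: derivative_eq_intros simp: add_nonneg_nonneg)
  also have "\<dots> \<le> ennreal pi"
    using arctan_bounded[of "T - \<xi> / of_int k"] arctan_bounded[of "0 - \<xi> / of_int k"]
    by (intro ennreal_leI) linarith
  finally show ?thesis .
qed

text \<open>One mode \<open>k\<close> of a solution on \<open>[0, T]\<close>: \<open>u\<close> and \<open>\<gamma>\<close> are the transforms of \<open>\<omega>\<close> and \<open>\<partial>\<^sub>x\<theta>\<close>, \<open>\<delta>\<^sup>3\<close> is
the viscosity, \<open>h dM\<close> is the transform of \<open>T'\<close>, and \<open>U\<close> is a jointly measurable version of \<open>u\<close>,
extended by \<open>0\<close> to other times. The equations are only known in tested form.\<close>

locale mode_flow =
  fixes \<delta> T :: real and k :: int and N :: nat and M :: "real measure" and h :: "real \<Rightarrow> complex"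
    and u \<gamma> :: "real \<Rightarrow> real \<Rightarrow> complex" and S :: real and U :: "real \<times> real \<Rightarrow> complex" and B :: real
  assumes \<delta>: "\<delta> > 0" and T: "T > 0"
    and M: "sets M = sets borel" "finite_measure M"
    and h: "h \<in> borel_measurable borel" "\<And>\<eta>. cmod (h \<eta>) \<le> 1"
    and S: "\<And>\<xi>. (\<integral>\<^sup>+\<eta>. ennreal (weight_ratio N (\<eta> + \<xi>) \<xi>) \<partial>M) \<le> ennreal S"
    and meas: "\<And>s. s \<in> {0..T} \<Longrightarrow> u s \<in> borel_measurable borel" "\<And>s. s \<in> {0..T} \<Longrightarrow> \<gamma> s \<in> borel_measurable borel"
    and test_integrable: "\<And>s c. s \<in> {0..T} \<Longrightarrow> integrable lborel (\<lambda>\<xi>. u s \<xi> * gauss c \<xi>)"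
      "\<And>s c. s \<in> {0..T} \<Longrightarrow> integrable lborel (\<lambda>\<xi>. \<gamma> s \<xi> * gauss c \<xi>)"
    and u_bound: "\<And>s. s \<in> {0..T} \<Longrightarrow> (square_integral (\<lambda>\<xi>. ennreal (mode_weight N k \<xi>) * ennreal (cmod (u s \<xi>)))) \<le> ennreal B"
    and \<gamma>_bound: "(square_integral (\<lambda>\<xi>. ennreal (mode_weight N k \<xi>) * ennreal (cmod (\<gamma> 0 \<xi>)))) < \<infinity>"
    and cont: "\<And>c. continuous_on {0..T} (\<lambda>s. LINT \<xi>|lborel. u s \<xi> * gauss c \<xi>)"
      "\<And>c. continuous_on {0..T} (\<lambda>s. LINT \<xi>|lborel. \<gamma> s \<xi> * gauss c \<xi>)"
    and du: "\<And>t c. 0 < t \<Longrightarrow> t < T \<Longrightarrow> ((\<lambda>s. LINT \<xi>|lborel. u s \<xi> * gauss c \<xi>) has_vector_derivative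
      (LINT \<xi>|lborel. (of_real (- (\<delta>^3 * (\<xi> - of_int k * t)\<^sup>2)) * u t \<xi> + \<gamma> t \<xi>) * gauss c \<xi>)) (at t)"
    and d\<gamma>: "\<And>t c. 0 < t \<Longrightarrow> t < T \<Longrightarrow> ((\<lambda>s. LINT \<xi>|lborel. \<gamma> s \<xi> * gauss c \<xi>) has_vector_derivative
      - (LINT \<eta>|M. h \<eta> * (LINT \<zeta>|lborel. of_real (dxx_inv_laplace_symbol t k \<zeta>) * u t \<zeta> * gauss c (\<zeta> + \<eta>)))) (at t)"
    and mean: "k = 0 \<Longrightarrow> AE \<xi> in lborel. \<gamma> 0 \<xi> = 0"
    and U_meas: "U \<in> borel_measurable (borel \<Otimes>\<^sub>M borel)"
    and U_eq: "\<And>s. s \<in> {0..T} \<Longrightarrow> AE \<xi> in lborel. U (s, \<xi>) = u s \<xi>"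
    and U_out: "\<And>s \<xi>. s \<notin> {0..T} \<Longrightarrow> U (s, \<xi>) = 0"
begin

sublocale M: finite_measure M by (rule M(2))

declare U_meas [measurable] h(1) [measurable] M(1) [measurable_cong]

abbreviation "\<kappa> s \<xi> \<equiv> dxx_inv_laplace_symbol s k \<xi>"
abbreviation "W \<xi> \<equiv> ennreal (mode_weight N k \<xi>)"

text \<open>\<open>G\<close> and \<open>Y\<close> are the right hand sides of the time-integrated equations for \<open>\<gamma>\<close> and \<open>u\<close>, written
in terms of \<open>U\<close>; they are defined at every \<open>(t, \<xi>)\<close>. For almost every \<open>\<xi>\<close> they turn out to be
continuous in \<open>t\<close>. The function \<open>spread a\<close> is the convolution of \<open>a\<close> with \<open>M\<close>, which dominates \<open>|\<mu>| * a\<close>.\<close>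

definition "abs_in_time \<xi> = (\<integral>\<^sup>+s. ennreal (cmod (U (s, \<xi>))) \<partial>lborel)"
definition "resonance \<xi> = (\<integral>\<^sup>+s. ennreal (\<kappa> s \<xi> * cmod (U (s, \<xi>))) \<partial>lborel)"
definition "spread a \<xi> = (\<integral>\<^sup>+\<eta>. a (\<xi> - \<eta>) \<partial>M)" for a :: "real \<Rightarrow> ennreal"
definition "force s \<xi> = (LINT \<eta>|M. h \<eta> * (of_real (\<kappa> s (\<xi> - \<eta>)) * U (s, \<xi> - \<eta>)))"
definition "G t \<xi> = \<gamma> 0 \<xi> - (LINT s|lborel. indicator {0..t} s *\<^sub>R force s \<xi>)"
definition "Y t \<xi> = u 0 \<xi> + (LINT s|lborel. indicator {0..t} s *\<^sub>R
    (of_real (- (\<delta>^3 * (\<xi> - of_int k * s)\<^sup>2)) * U (s, \<xi>) + G s \<xi>))"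

lemma T0: "0 \<in> {0..T}" using T by simp

lemma abs_in_time_measurable [measurable]: "abs_in_time \<in> borel_measurable borel"
  unfolding abs_in_time_def[abs_def] by measurable

lemma resonance_measurable [measurable]: "resonance \<in> borel_measurable borel"
  unfolding resonance_def[abs_def] by measurable

lemma spread_measurable [measurable]:
  assumes [measurable]: "a \<in> borel_measurable borel" shows "spread a \<in> borel_measurable borel"
  unfolding spread_def[abs_def] by measurable

lemma force_measurable [measurable]:
  "(\<lambda>p. force (fst p) (snd p)) \<in> borel_measurable (borel \<Otimes>\<^sub>M borel)"
  unfolding force_def by measurable

lemma force_measurable2 [measurable (raw)]:
  assumes [measurable]: "f \<in> borel_measurable L" "g \<in> borel_measurable L"
  shows "(\<lambda>x. force (f x) (g x)) \<in> borel_measurable L"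
proof -
  have "(\<lambda>x. (\<lambda>p. force (fst p) (snd p)) (f x, g x)) \<in> borel_measurable L" by measurable
  then show ?thesis by simp
qed

lemma G_measurable [measurable (raw)]:
  assumes [measurable]: "f \<in> borel_measurable L" "g \<in> borel_measurable L"
  shows "(\<lambda>x. G (f x) (g x)) \<in> borel_measurable L"
proof -
  note [measurable] = meas(2)[OF T0]
  have "(\<lambda>x. \<gamma> 0 (g x) - (LINT s|lborel. indicator {0..f x} s *\<^sub>R force s (g x))) \<in> borel_measurable L"
    unfolding indicator_def atLeastAtMost_iff by measurable
  then show ?thesis unfolding G_def .
qed

lemma Y_measurable [measurable (raw)]:
  assumes [measurable]: "f \<in> borel_measurable L" "g \<in> borel_measurable L"
  shows "(\<lambda>x. Y (f x) (g x)) \<in> borel_measurable L"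
proof -
  note [measurable] = meas(1)[OF T0]
  show ?thesis
    unfolding Y_def indicator_def atLeastAtMost_iff by measurable
qed

lemma resonance_le: "resonance \<xi> \<le> abs_in_time \<xi>"
  unfolding resonance_def abs_in_time_def
  by (intro nn_integral_mono ennreal_leI mult_left_le_one_le) (auto simp: symbol_bounds)

lemma spread_mono: "(\<And>\<xi>. a \<xi> \<le> b \<xi>) \<Longrightarrow> spread a \<xi> \<le> spread b \<xi>"
  unfolding spread_def by (rule nn_integral_mono)

lemma spread_bound:
  assumes "a \<in> borel_measurable borel"
  shows "(square_integral (\<lambda>\<xi>. W \<xi> * spread a \<xi>)) \<le> (ennreal S)\<^sup>2 * (square_integral (\<lambda>\<xi>. W \<xi> * a \<xi>))"
  unfolding spread_def by (rule weighted_convolution_bound[OF M S assms])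

lemma W_ge: "a \<le> W \<xi> * a"
proof -
  have "1 * a \<le> W \<xi> * a" 
    by (intro mult_right_mono) (use mode_weight_ge_1 in \<open>auto simp: ennreal_1[symmetric] simp del: ennreal_1 intro!: ennreal_leI\<close>)
  then show ?thesis by simp
qed

lemma unweighted_finite:
  assumes "(square_integral (\<lambda>\<xi>. W \<xi> * a \<xi>)) < \<infinity>"
  shows "(square_integral (\<lambda>\<xi>. a \<xi>)) < \<infinity>"
proof -
  have "(square_integral (\<lambda>\<xi>. a \<xi>)) \<le> (square_integral (\<lambda>\<xi>. W \<xi> * a \<xi>))"
    by (intro nn_integral_mono power_mono W_ge) auto
  then show ?thesis using assms by (rule le_less_trans)
qed

lemma finite_AE:
  assumes [measurable]: "a \<in> borel_measurable borel" and "(square_integral (\<lambda>\<xi>. W \<xi> * a \<xi>)) < \<infinity>"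
  shows "AE \<xi> in lborel. a \<xi> < \<infinity>"
proof -
  have "AE \<xi> in lborel. (a \<xi>)\<^sup>2 \<noteq> \<infinity>"
    by (rule nn_integral_PInf_AE) (use unweighted_finite[OF assms(2)] in \<open>auto simp: less_top\<close>)
  then show ?thesis by eventually_elim (metis ennreal_square_finite_iff infinity_ennreal_def less_top)
qed

text \<open>Qualitative finiteness on a bounded time interval, by the Cauchy-Schwarz inequality in time. It
makes the integrals below converge and later permits the absorption of a term into the left hand
side.\<close>

lemma abs_in_time_bound: "(square_integral (\<lambda>\<xi>. W \<xi> * abs_in_time \<xi>)) < \<infinity>"
proof -
  have pw: "(W \<xi> * abs_in_time \<xi>)\<^sup>2 \<le> ennreal T * (\<integral>\<^sup>+s. (W \<xi> * ennreal (cmod (U (s, \<xi>))))\<^sup>2 \<partial>lborel)" for \<xi>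
  proof -
    have "abs_in_time \<xi> = (\<integral>\<^sup>+s. indicator {0..T} s * ennreal (cmod (U (s, \<xi>))) \<partial>lborel)"
      unfolding abs_in_time_def by (intro nn_integral_cong) (use U_out in \<open>auto simp: indicator_def\<close>)
    then have "(abs_in_time \<xi>)\<^sup>2 \<le> (\<integral>\<^sup>+s. (indicator {0..T} s)\<^sup>2 \<partial>lborel) * (\<integral>\<^sup>+s. (ennreal (cmod (U (s, \<xi>))))\<^sup>2 \<partial>lborel)"
      by (simp only:) (rule Cauchy_Schwarz_nn_integral; measurable)
    also have "(\<integral>\<^sup>+s. (indicator {0..T} s)\<^sup>2 \<partial>lborel) = (\<integral>\<^sup>+s. indicator {0..T} s \<partial>lborel)"
      by (intro nn_integral_cong) (auto simp: indicator_def)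
    also have "\<dots> = ennreal T" using T by simp
    finally have "(W \<xi>)\<^sup>2 * (abs_in_time \<xi>)\<^sup>2 \<le> (W \<xi>)\<^sup>2 * (ennreal T * (\<integral>\<^sup>+s. (ennreal (cmod (U (s, \<xi>))))\<^sup>2 \<partial>lborel))"
      by (rule mult_left_mono) simp
    also have "\<dots> = ennreal T * ((W \<xi>)\<^sup>2 * (\<integral>\<^sup>+s. (ennreal (cmod (U (s, \<xi>))))\<^sup>2 \<partial>lborel))" by (simp only: mult_ac)
    also have "(W \<xi>)\<^sup>2 * (\<integral>\<^sup>+s. (ennreal (cmod (U (s, \<xi>))))\<^sup>2 \<partial>lborel) = (\<integral>\<^sup>+s. (W \<xi> * ennreal (cmod (U (s, \<xi>))))\<^sup>2 \<partial>lborel)"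
      unfolding power_mult_distrib by (rule nn_integral_cmult[symmetric]) measurable
    finally show ?thesis by (simp only: power_mult_distrib)
  qed
  have "(square_integral (\<lambda>\<xi>. W \<xi> * abs_in_time \<xi>)) \<le>
      (\<integral>\<^sup>+\<xi>. ennreal T * (\<integral>\<^sup>+s. (W \<xi> * ennreal (cmod (U (s, \<xi>))))\<^sup>2 \<partial>lborel) \<partial>lborel)"
    by (intro nn_integral_mono pw)
  also have "\<dots> = ennreal T * (\<integral>\<^sup>+\<xi>. (\<integral>\<^sup>+s. (W \<xi> * ennreal (cmod (U (s, \<xi>))))\<^sup>2 \<partial>lborel) \<partial>lborel)"
    by (rule nn_integral_cmult) measurable
  also have "(\<integral>\<^sup>+\<xi>. (\<integral>\<^sup>+s. (W \<xi> * ennreal (cmod (U (s, \<xi>))))\<^sup>2 \<partial>lborel) \<partial>lborel) =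
      (\<integral>\<^sup>+s. (square_integral (\<lambda>\<xi>. W \<xi> * ennreal (cmod (U (s, \<xi>))))) \<partial>lborel)"
    by (rule lborel_pair.Fubini') measurable
  also have "\<dots> \<le> (\<integral>\<^sup>+s. ennreal B * indicator {0..T} s \<partial>lborel)"
  proof (rule nn_integral_mono)
    fix s
    show "(square_integral (\<lambda>\<xi>. W \<xi> * ennreal (cmod (U (s, \<xi>))))) \<le> ennreal B * indicator {0..T} s"
    proof (cases "s \<in> {0..T}")
      case True
      have "(square_integral (\<lambda>\<xi>. W \<xi> * ennreal (cmod (U (s, \<xi>))))) = (square_integral (\<lambda>\<xi>. W \<xi> * ennreal (cmod (u s \<xi>))))"
        by (rule nn_integral_cong_AE) (use U_eq[OF True] in \<open>auto elim!: eventually_mono\<close>)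
      then show ?thesis using u_bound[OF True] True by simp
    next
      case False
      then show ?thesis by (simp add: U_out)
    qed
  qed
  also have "\<dots> = ennreal B * ennreal T" using T by (simp add: nn_integral_cmult)
  finally show ?thesis
    by (rule le_less_trans) (auto simp: ennreal_mult_less_top intro: mult_left_mono)
qed

lemma spread_abs_bound: "(square_integral (\<lambda>\<xi>. W \<xi> * spread abs_in_time \<xi>)) < \<infinity>"
  by (rule le_less_trans[OF spread_bound]) (use abs_in_time_bound in \<open>auto simp: ennreal_mult_less_top power2_eq_square\<close>)

lemma test_finite:
  assumes [measurable]: "a \<in> borel_measurable borel" and "(square_integral (\<lambda>\<xi>. W \<xi> * a \<xi>)) < \<infinity>" and \<psi>: "schwartz \<psi>"
  shows "(\<integral>\<^sup>+\<xi>. ennreal (cmod (\<psi> \<xi>)) * a \<xi> \<partial>lborel) < \<infinity>"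
proof -
  have [measurable]: "\<psi> \<in> borel_measurable borel" by (rule schwartz_measurable[OF \<psi>])
  show ?thesis
    by (rule nn_integral_product_finite) (use schwartz_square_finite[OF \<psi>] unweighted_finite[OF assms(2)] in auto)
qed

lemma force_norm_le: "ennreal (cmod (force s \<xi>)) \<le> spread (\<lambda>\<zeta>. ennreal (\<kappa> s \<zeta> * cmod (U (s, \<zeta>)))) \<xi>"
proof -
  let ?f = "\<lambda>\<eta>. h \<eta> * (of_real (\<kappa> s (\<xi> - \<eta>)) * U (s, \<xi> - \<eta>))"
  have le: "norm (?f \<eta>) \<le> \<kappa> s (\<xi> - \<eta>) * cmod (U (s, \<xi> - \<eta>))" for \<eta>
    using mult_right_mono[OF h(2)[of \<eta>], of "\<kappa> s (\<xi> - \<eta>) * cmod (U (s, \<xi> - \<eta>))"]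
    by (simp add: norm_mult symbol_bounds)
  have "ennreal (cmod (force s \<xi>)) \<le> (\<integral>\<^sup>+\<eta>. norm (?f \<eta>) \<partial>M)"
    unfolding force_def by (rule norm_integral_le_nn_integral) 
  also have "\<dots> \<le> spread (\<lambda>\<zeta>. ennreal (\<kappa> s \<zeta> * cmod (U (s, \<zeta>)))) \<xi>"
    unfolding spread_def by (intro nn_integral_mono ennreal_leI le)
  finally show ?thesis .
qed

lemma spread_resonance_time: "(\<integral>\<^sup>+s. spread (\<lambda>\<zeta>. ennreal (\<kappa> s \<zeta> * cmod (U (s, \<zeta>)))) \<xi> \<partial>lborel) = spread resonance \<xi>"
proof -
  interpret P: pair_sigma_finite M lborel ..
  show ?thesis
    unfolding spread_def resonance_def by (rule P.Fubini') measurable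
qed

lemma force_time_le: "(\<integral>\<^sup>+s. ennreal (cmod (force s \<xi>)) \<partial>lborel) \<le> spread resonance \<xi>"
  unfolding spread_resonance_time[symmetric] by (intro nn_integral_mono force_norm_le)

lemma force_integrable:
  assumes "spread abs_in_time \<xi> < \<infinity>"
  shows "integrable lborel (\<lambda>s. force s \<xi>)"
proof -
  have "(\<integral>\<^sup>+s. ennreal (cmod (force s \<xi>)) \<partial>lborel) \<le> spread abs_in_time \<xi>"
    by (rule order_trans[OF force_time_le spread_mono[OF resonance_le]])
  then show ?thesis using assms by (auto simp: integrable_iff_bounded)
qed

lemma G_norm_le: "ennreal (cmod (G t \<xi>)) \<le> ennreal (cmod (\<gamma> 0 \<xi>)) + spread resonance \<xi>"
proof -
  have "ennreal (cmod (G t \<xi>)) \<le> ennreal (cmod (\<gamma> 0 \<xi>) + cmod (LINT s|lborel. indicator {0..t} s *\<^sub>R force s \<xi>))"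
    unfolding G_def by (intro ennreal_leI norm_triangle_ineq4)
  also have "\<dots> = ennreal (cmod (\<gamma> 0 \<xi>)) + ennreal (cmod (LINT s|lborel. indicator {0..t} s *\<^sub>R force s \<xi>))" by simp
  also have "ennreal (cmod (LINT s|lborel. indicator {0..t} s *\<^sub>R force s \<xi>)) \<le> (\<integral>\<^sup>+s. norm (indicator {0..t} s *\<^sub>R force s \<xi>) \<partial>lborel)"
    by (rule norm_integral_le_nn_integral)
  also have "\<dots> \<le> (\<integral>\<^sup>+s. ennreal (cmod (force s \<xi>)) \<partial>lborel)"
    by (intro nn_integral_mono ennreal_leI) (auto simp: indicator_def)
  also have "\<dots> \<le> spread resonance \<xi>" by (rule force_time_le)
  finally show ?thesis by (auto intro: add_left_mono)
qed

end

text \<open>Passing from a tested differential equation to the integrated equation: the fundamental theorem of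
calculus in time, followed by an exchange of the integrals over \<open>s\<close> and \<open>\<xi>\<close>.\<close>

lemma weak_equation_integrated:
  fixes F :: "real \<Rightarrow> complex" and \<Psi> :: "real \<Rightarrow> real \<Rightarrow> complex" and \<psi> :: "real \<Rightarrow> complex"
  assumes t: "0 \<le> t" and cont: "continuous_on {0..t} F"
    and \<Psi>: "(\<lambda>p. \<Psi> (fst p) (snd p)) \<in> borel_measurable (borel \<Otimes>\<^sub>M borel)" and \<psi>: "\<psi> \<in> borel_measurable borel"
    and deriv: "\<And>s. 0 < s \<Longrightarrow> s < t \<Longrightarrow> (F has_vector_derivative (LINT \<xi>|lborel. \<Psi> s \<xi> * \<psi> \<xi>)) (at s)"
    and fin: "(\<integral>\<^sup>+\<xi>. ennreal (cmod (\<psi> \<xi>)) * (\<integral>\<^sup>+s. ennreal (indicator {0..t} s * cmod (\<Psi> s \<xi>)) \<partial>lborel) \<partial>lborel) < \<infinity>"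
  shows "integrable lborel (\<lambda>\<xi>. (LINT s|lborel. indicator {0..t} s *\<^sub>R \<Psi> s \<xi>) * \<psi> \<xi>)"
    and "F t - F 0 = (LINT \<xi>|lborel. (LINT s|lborel. indicator {0..t} s *\<^sub>R \<Psi> s \<xi>) * \<psi> \<xi>)"
proof -
  note [measurable] = \<psi>
  have \<Psi>_meas[measurable]: "(\<lambda>x. \<Psi> (f x) (g x)) \<in> borel_measurable L"
    if [measurable]: "f \<in> borel_measurable L" "g \<in> borel_measurable L" for f g and L :: "'c measure"
  proof -
    have "(\<lambda>x. (\<lambda>p. \<Psi> (fst p) (snd p)) (f x, g x)) \<in> borel_measurable L"
      by (rule measurable_compose[OF _ \<Psi>]) measurable
    then show ?thesis by simp
  qed
  let ?\<Phi> = "\<lambda>s \<xi>. indicator {0..t} s *\<^sub>R \<Psi> s \<xi> * \<psi> \<xi>"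
  have int: "integrable (lborel \<Otimes>\<^sub>M lborel) (\<lambda>(s, \<xi>). ?\<Phi> s \<xi>)"
  proof (rule integrableI_bounded)
    have "(\<integral>\<^sup>+p. ennreal (norm (case p of (s, \<xi>) \<Rightarrow> ?\<Phi> s \<xi>)) \<partial>(lborel \<Otimes>\<^sub>M lborel)) =
        (\<integral>\<^sup>+s. (\<integral>\<^sup>+\<xi>. ennreal (norm (?\<Phi> s \<xi>)) \<partial>lborel) \<partial>lborel)"
      by (subst lborel.nn_integral_fst[symmetric]) auto
    also have "\<dots> = (\<integral>\<^sup>+\<xi>. (\<integral>\<^sup>+s. ennreal (norm (?\<Phi> s \<xi>)) \<partial>lborel) \<partial>lborel)"
      by (rule lborel_pair.Fubini'[symmetric]) measurable
    also have "\<dots> = (\<integral>\<^sup>+\<xi>. ennreal (cmod (\<psi> \<xi>)) * (\<integral>\<^sup>+s. ennreal (indicator {0..t} s * cmod (\<Psi> s \<xi>)) \<partial>lborel) \<partial>lborel)"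
      by (subst nn_integral_cmult[symmetric])
         (auto intro!: nn_integral_cong simp: norm_mult ennreal_mult[symmetric] mult_ac)
    finally show "(\<integral>\<^sup>+p. ennreal (norm (case p of (s, \<xi>) \<Rightarrow> ?\<Phi> s \<xi>)) \<partial>(lborel \<Otimes>\<^sub>M lborel)) < \<infinity>"
      using fin by simp
  qed measurable
  have inner: "(LINT s|lborel. ?\<Phi> s \<xi>) = (LINT s|lborel. indicator {0..t} s *\<^sub>R \<Psi> s \<xi>) * \<psi> \<xi>" for \<xi>
    by (rule integral_mult_left_zero)
  have outer: "(LINT \<xi>|lborel. ?\<Phi> s \<xi>) = indicator {0..t} s *\<^sub>R (LINT \<xi>|lborel. \<Psi> s \<xi> * \<psi> \<xi>)" for s
    by (simp only: mult_scaleR_left integral_scaleR_right)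
  from lborel_pair.integrable_snd[OF int]
  show "integrable lborel (\<lambda>\<xi>. (LINT s|lborel. indicator {0..t} s *\<^sub>R \<Psi> s \<xi>) * \<psi> \<xi>)"
    by (simp only: inner)
  have si: "set_integrable lborel {0..t} (\<lambda>s. LINT \<xi>|lborel. \<Psi> s \<xi> * \<psi> \<xi>)"
    using lborel_pair.integrable_fst'[OF int] unfolding set_integrable_def by (simp only: prod.case outer)
  have "((\<lambda>s. LINT \<xi>|lborel. \<Psi> s \<xi> * \<psi> \<xi>) has_integral (F t - F 0)) {0..t}"
    by (rule fundamental_theorem_of_calculus_interior[OF t cont]) (use deriv in auto)
  then have "F t - F 0 = integral {0..t} (\<lambda>s. LINT \<xi>|lborel. \<Psi> s \<xi> * \<psi> \<xi>)"
    by (simp add: integral_unique)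
  also have "\<dots> = (LINT s|lborel. LINT \<xi>|lborel. ?\<Phi> s \<xi>)"
    using set_borel_integral_eq_integral(2)[OF si] by (simp only: outer set_lebesgue_integral_def)
  also have "\<dots> = (LINT \<xi>|lborel. LINT s|lborel. ?\<Phi> s \<xi>)"
    by (rule lborel_pair.Fubini_integral[OF int, symmetric])
  finally show "F t - F 0 = (LINT \<xi>|lborel. (LINT s|lborel. indicator {0..t} s *\<^sub>R \<Psi> s \<xi>) * \<psi> \<xi>)"
    by (simp only: inner)
qed

lemma nn_integral_combination_finite:
  fixes a b c :: "'a \<Rightarrow> ennreal"
  assumes [measurable]: "a \<in> borel_measurable L" "b \<in> borel_measurable L" "c \<in> borel_measurable L"
    and "(\<integral>\<^sup>+x. a x \<partial>L) < \<infinity>" "(\<integral>\<^sup>+x. b x \<partial>L) < \<infinity>" "(\<integral>\<^sup>+x. c x \<partial>L) < \<infinity>"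
  shows "(\<integral>\<^sup>+x. a x + ennreal r * (b x + c x) \<partial>L) < \<infinity>"
  using assms(4-6) by (simp add: nn_integral_add nn_integral_cmult ennreal_mult_less_top)

context mode_flow
begin

lemma U_slice_bound:
  assumes s: "s \<in> {0..T}"
  shows "(square_integral (\<lambda>\<xi>. W \<xi> * ennreal (cmod (U (s, \<xi>))))) < \<infinity>"
proof -
  note [measurable] = meas(1)[OF s]
  have "(square_integral (\<lambda>\<xi>. W \<xi> * ennreal (cmod (U (s, \<xi>))))) = (square_integral (\<lambda>\<xi>. W \<xi> * ennreal (cmod (u s \<xi>))))"
    by (rule nn_integral_cong_AE) (use U_eq[OF s] in \<open>auto elim!: eventually_mono\<close>)
  also have "\<dots> \<le> ennreal B" by (rule u_bound[OF s])
  finally show ?thesis by (rule le_less_trans) simp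
qed

text \<open>The sum of frequencies \<open>\<zeta> + \<eta>\<close> in the tested equation becomes a convolution after the translation
\<open>\<xi> = \<zeta> + \<eta>\<close>.\<close>

lemma force_tested:
  assumes s: "s \<in> {0..T}"
  shows "(LINT \<eta>|M. h \<eta> * (LINT \<zeta>|lborel. of_real (\<kappa> s \<zeta>) * u s \<zeta> * gauss c (\<zeta> + \<eta>))) =
    (LINT \<xi>|lborel. force s \<xi> * gauss c \<xi>)"
proof -
  interpret P: pair_sigma_finite lborel M ..
  note [measurable] = meas(1)[OF s]
  let ?f = "\<lambda>\<xi> \<eta>. h \<eta> * (of_real (\<kappa> s (\<xi> - \<eta>)) * U (s, \<xi> - \<eta>)) * gauss c \<xi>"
  let ?a = "spread (\<lambda>\<zeta>. ennreal (cmod (U (s, \<zeta>))))"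
  have int: "integrable (lborel \<Otimes>\<^sub>M M) (\<lambda>(\<xi>, \<eta>). ?f \<xi> \<eta>)"
  proof (rule integrableI_bounded)
    have "(\<integral>\<^sup>+p. ennreal (norm (case p of (\<xi>, \<eta>) \<Rightarrow> ?f \<xi> \<eta>)) \<partial>(lborel \<Otimes>\<^sub>M M)) =
        (\<integral>\<^sup>+\<xi>. (\<integral>\<^sup>+\<eta>. ennreal (norm (?f \<xi> \<eta>)) \<partial>M) \<partial>lborel)"
      by (subst M.nn_integral_fst[symmetric]) auto
    also have "\<dots> \<le> (\<integral>\<^sup>+\<xi>. ennreal (cmod (gauss c \<xi>)) * ?a \<xi> \<partial>lborel)"
    proof (rule nn_integral_mono)
      fix \<xi>
      have le: "norm (?f \<xi> \<eta>) \<le> cmod (gauss c \<xi>) * cmod (U (s, \<xi> - \<eta>))" for \<eta>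
      proof -
        have "norm (?f \<xi> \<eta>) = cmod (h \<eta>) * (\<kappa> s (\<xi> - \<eta>) * (cmod (gauss c \<xi>) * cmod (U (s, \<xi> - \<eta>))))"
          by (simp add: norm_mult symbol_bounds mult_ac)
        also have "\<dots> \<le> 1 * (1 * (cmod (gauss c \<xi>) * cmod (U (s, \<xi> - \<eta>))))"
          by (intro mult_mono h symbol_bounds mult_nonneg_nonneg norm_ge_zero order_refl zero_le_one)
        finally show ?thesis by simp
      qed
      have "(\<integral>\<^sup>+\<eta>. ennreal (norm (?f \<xi> \<eta>)) \<partial>M) \<le> (\<integral>\<^sup>+\<eta>. ennreal (cmod (gauss c \<xi>)) * ennreal (cmod (U (s, \<xi> - \<eta>))) \<partial>M)"
        by (rule nn_integral_mono) (simp only: ennreal_mult[symmetric, OF norm_ge_zero norm_ge_zero] ennreal_leI[OF le])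
      also have "\<dots> = ennreal (cmod (gauss c \<xi>)) * ?a \<xi>"
        unfolding spread_def by (rule nn_integral_cmult) measurable
      finally show "(\<integral>\<^sup>+\<eta>. ennreal (norm (?f \<xi> \<eta>)) \<partial>M) \<le> ennreal (cmod (gauss c \<xi>)) * ?a \<xi>" .
    qed
    also have "\<dots> < \<infinity>"
    proof (rule test_finite[OF _ _ schwartz_gauss])
      show "(square_integral (\<lambda>\<xi>. W \<xi> * ?a \<xi>)) < \<infinity>"
        by (rule le_less_trans[OF spread_bound])
           (use U_slice_bound[OF s] in \<open>auto simp: ennreal_mult_less_top power2_eq_square\<close>)
    qed measurable
    finally show "(\<integral>\<^sup>+p. ennreal (norm (case p of (\<xi>, \<eta>) \<Rightarrow> ?f \<xi> \<eta>)) \<partial>(lborel \<Otimes>\<^sub>M M)) < \<infinity>" .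
  qed measurable
  have shift: "(LINT \<zeta>|lborel. of_real (\<kappa> s \<zeta>) * u s \<zeta> * gauss c (\<zeta> + \<eta>)) =
      (LINT \<xi>|lborel. of_real (\<kappa> s (\<xi> - \<eta>)) * U (s, \<xi> - \<eta>) * gauss c \<xi>)" for \<eta>
  proof -
    have "(LINT \<zeta>|lborel. of_real (\<kappa> s \<zeta>) * u s \<zeta> * gauss c (\<zeta> + \<eta>)) =
        (LINT \<zeta>|lborel. of_real (\<kappa> s \<zeta>) * U (s, \<zeta>) * gauss c (\<zeta> + \<eta>))"
      by (rule integral_cong_AE) (use U_eq[OF s] in \<open>auto elim!: eventually_mono\<close>)
    also have "\<dots> = (LINT \<xi>|lborel. of_real (\<kappa> s (- \<eta> + 1 * \<xi>)) * U (s, - \<eta> + 1 * \<xi>) * gauss c ((- \<eta> + 1 * \<xi>) + \<eta>))"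
      using lborel_integral_real_affine[of 1 "\<lambda>\<zeta>. of_real (\<kappa> s \<zeta>) * U (s, \<zeta>) * gauss c (\<zeta> + \<eta>)" "- \<eta>"] by simp
    finally show ?thesis by simp
  qed
  have "(LINT \<eta>|M. h \<eta> * (LINT \<zeta>|lborel. of_real (\<kappa> s \<zeta>) * u s \<zeta> * gauss c (\<zeta> + \<eta>))) =
      (LINT \<eta>|M. LINT \<xi>|lborel. ?f \<xi> \<eta>)"
    unfolding shift integral_mult_right_zero[symmetric] by (simp only: mult.assoc)
  also have "\<dots> = (LINT \<xi>|lborel. LINT \<eta>|M. ?f \<xi> \<eta>)" by (rule P.Fubini_integral[OF int])
  also have "\<dots> = (LINT \<xi>|lborel. force s \<xi> * gauss c \<xi>)"
    unfolding force_def by (simp only: integral_mult_left_zero)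
  finally show ?thesis .
qed

lemma temperature_formula:
  assumes t: "t \<in> {0..T}"
  shows "AE \<xi> in lborel. \<gamma> t \<xi> = G t \<xi>"
proof -
  have t0: "0 \<le> t" using t by simp
  have fin: "(\<integral>\<^sup>+\<xi>. ennreal (cmod (gauss c \<xi>)) * (\<integral>\<^sup>+s. ennreal (indicator {0..t} s * cmod (- force s \<xi>)) \<partial>lborel) \<partial>lborel) < \<infinity>" for c
  proof (rule le_less_trans)
    show "(\<integral>\<^sup>+\<xi>. ennreal (cmod (gauss c \<xi>)) * (\<integral>\<^sup>+s. ennreal (indicator {0..t} s * cmod (- force s \<xi>)) \<partial>lborel) \<partial>lborel)
      \<le> (\<integral>\<^sup>+\<xi>. ennreal (cmod (gauss c \<xi>)) * spread abs_in_time \<xi> \<partial>lborel)"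
    proof (intro nn_integral_mono mult_left_mono)
      fix \<xi>
      have "(\<integral>\<^sup>+s. ennreal (indicator {0..t} s * cmod (- force s \<xi>)) \<partial>lborel) \<le> (\<integral>\<^sup>+s. ennreal (cmod (force s \<xi>)) \<partial>lborel)"
        by (intro nn_integral_mono ennreal_leI) (auto simp: indicator_def)
      also have "\<dots> \<le> spread abs_in_time \<xi>"
        by (rule order_trans[OF force_time_le spread_mono[OF resonance_le]])
      finally show "(\<integral>\<^sup>+s. ennreal (indicator {0..t} s * cmod (- force s \<xi>)) \<partial>lborel) \<le> spread abs_in_time \<xi>" .
    qed simp
    show "(\<integral>\<^sup>+\<xi>. ennreal (cmod (gauss c \<xi>)) * spread abs_in_time \<xi> \<partial>lborel) < \<infinity>"
      by (rule test_finite[OF _ spread_abs_bound schwartz_gauss]) measurable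
  qed
  have d: "((\<lambda>s. LINT \<xi>|lborel. \<gamma> s \<xi> * gauss c \<xi>) has_vector_derivative (LINT \<xi>|lborel. (- force s \<xi>) * gauss c \<xi>)) (at s)"
    if "0 < s" "s < t" for s c
    using d\<gamma>[of s c] that t by (simp add: force_tested)
  have c: "continuous_on {0..t} (\<lambda>s. LINT \<xi>|lborel. \<gamma> s \<xi> * gauss c \<xi>)" for c
    by (rule continuous_on_subset[OF cont(2)]) (use t in auto)
  have m: "(\<lambda>p. - force (fst p) (snd p)) \<in> borel_measurable (borel \<Otimes>\<^sub>M borel)" by measurable
  note W = weak_equation_integrated[OF t0 c m gauss_measurable d fin]
  have i: "integrable lborel (\<lambda>\<xi>. (LINT s|lborel. indicator {0..t} s *\<^sub>R force s \<xi>) * gauss c \<xi>)" for c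
    using W(1)[of c] by simp
  have eq: "(\<gamma> t \<xi> - G t \<xi>) * gauss c \<xi> = \<gamma> t \<xi> * gauss c \<xi> - \<gamma> 0 \<xi> * gauss c \<xi> + (LINT s|lborel. indicator {0..t} s *\<^sub>R force s \<xi>) * gauss c \<xi>" for c \<xi>
    by (simp add: G_def algebra_simps)
  have "AE \<xi> in lborel. \<gamma> t \<xi> - G t \<xi> = 0"
  proof (rule gauss_separating)
    show "integrable lborel (\<lambda>\<xi>. (\<gamma> t \<xi> - G t \<xi>) * gauss 0 \<xi>)"
      unfolding eq using test_integrable(2)[OF t] test_integrable(2)[OF T0] i by simp
    show "(LINT \<xi>|lborel. (\<gamma> t \<xi> - G t \<xi>) * gauss (\<i> * of_real b) \<xi>) = 0" for b
      unfolding eq using test_integrable(2)[OF t] test_integrable(2)[OF T0] i W(2)[of "\<i> * of_real b"] by simp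
  qed
  then show ?thesis by simp
qed

abbreviation "damping s \<xi> \<equiv> - (\<delta>^3 * (\<xi> - of_int k * s)\<^sup>2)"

lemma vorticity_formula:
  assumes t: "t \<in> {0..T}"
  shows "AE \<xi> in lborel. u t \<xi> = Y t \<xi>"
proof -
  have t0: "0 \<le> t" using t by simp
  let ?\<Psi> = "\<lambda>s \<xi>. of_real (damping s \<xi>) * U (s, \<xi>) + G s \<xi>"
  define q where "q \<xi> = 2 * \<delta>^3 * (\<xi>\<^sup>2 + (of_int k * T)\<^sup>2)" for \<xi> :: real
  have q0: "q \<xi> \<ge> 0" for \<xi> unfolding q_def using \<delta> by (intro mult_nonneg_nonneg add_nonneg_nonneg) auto
  define g0 where "g0 \<xi> = ennreal (cmod (\<gamma> 0 \<xi>)) + spread abs_in_time \<xi>" for \<xi>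
  note [measurable] = meas[OF T0]
  have [measurable]: "g0 \<in> borel_measurable borel" unfolding g0_def[abs_def] by measurable
  have [measurable]: "q \<in> borel_measurable borel" unfolding q_def[abs_def] by measurable
  have damping_le: "\<bar>damping s \<xi>\<bar> \<le> q \<xi>" if "s \<in> {0..T}" for s \<xi>
  proof -
    have "0 \<le> (\<xi> + of_int k * s)\<^sup>2" by simp
    then have "(\<xi> - of_int k * s)\<^sup>2 \<le> 2 * (\<xi>\<^sup>2 + (of_int k * s)\<^sup>2)" by (simp add: power2_eq_square algebra_simps)
    also have "\<dots> \<le> 2 * (\<xi>\<^sup>2 + (of_int k * T)\<^sup>2)"
      using that by (intro mult_left_mono add_left_mono) (auto simp: power_mult_distrib intro!: mult_left_mono power_mono)
    finally have "\<delta>^3 * (\<xi> - of_int k * s)\<^sup>2 \<le> \<delta>^3 * (2 * (\<xi>\<^sup>2 + (of_int k * T)\<^sup>2))"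
      using \<delta> by (intro mult_left_mono) auto
    then show ?thesis using \<delta> by (simp add: q_def abs_mult mult_ac)
  qed
  have \<Psi>_le: "ennreal (indicator {0..t} s * cmod (?\<Psi> s \<xi>)) \<le> ennreal (q \<xi>) * ennreal (cmod (U (s, \<xi>))) + g0 \<xi> * indicator {0..T} s" for s \<xi>
  proof (cases "s \<in> {0..t}")
    case True
    then have s: "s \<in> {0..T}" using t by auto
    have "ennreal (cmod (?\<Psi> s \<xi>)) \<le> ennreal (\<bar>damping s \<xi>\<bar> * cmod (U (s, \<xi>)) + cmod (G s \<xi>))"
      by (intro ennreal_leI order_trans[OF norm_triangle_ineq]) (simp only: norm_mult norm_of_real order_refl)
    also have "\<dots> \<le> ennreal (q \<xi> * cmod (U (s, \<xi>)) + cmod (G s \<xi>))"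
      by (intro ennreal_leI add_right_mono mult_right_mono damping_le s) auto
    also have "\<dots> = ennreal (q \<xi>) * ennreal (cmod (U (s, \<xi>))) + ennreal (cmod (G s \<xi>))"
      using q0[of \<xi>] by (simp add: ennreal_mult)
    also have "\<dots> \<le> ennreal (q \<xi>) * ennreal (cmod (U (s, \<xi>))) + g0 \<xi>"
      unfolding g0_def by (intro add_left_mono order_trans[OF G_norm_le] spread_mono resonance_le)
    finally show ?thesis using True s by simp
  qed simp
  have fin: "(\<integral>\<^sup>+\<xi>. ennreal (cmod (gauss c \<xi>)) * (\<integral>\<^sup>+s. ennreal (indicator {0..t} s * cmod (?\<Psi> s \<xi>)) \<partial>lborel) \<partial>lborel) < \<infinity>" for c
  proof (rule le_less_trans)
    \<comment> \<open>The damping rate grows quadratically in \<open>\<xi>\<close>; with the Gaussian it is still a Schwartz function.\<close>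
    let ?\<psi> = "\<lambda>\<xi>. poly [:of_real (2 * \<delta>^3 * (of_int k * T)\<^sup>2), 0, of_real (2 * \<delta>^3):] (of_real \<xi>) * gauss c \<xi>"
    let ?J = "\<lambda>\<xi>. \<integral>\<^sup>+s. ennreal (indicator {0..t} s * cmod (?\<Psi> s \<xi>)) \<partial>lborel"
    let ?g = "\<lambda>\<xi>. ennreal (cmod (gauss c \<xi>))"
    let ?R = "\<lambda>\<xi>. ennreal (cmod (?\<psi> \<xi>)) * abs_in_time \<xi> + ennreal T * (?g \<xi> * ennreal (cmod (\<gamma> 0 \<xi>)) + ?g \<xi> * spread abs_in_time \<xi>)"
    have \<psi>: "cmod (?\<psi> \<xi>) = cmod (gauss c \<xi>) * q \<xi>" for \<xi>
    proof -
      have "poly [:of_real (2 * \<delta>^3 * (of_int k * T)\<^sup>2), 0, of_real (2 * \<delta>^3):] (of_real \<xi>) = complex_of_real (q \<xi>)"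
        by (simp add: q_def power2_eq_square algebra_simps)
      then show ?thesis using q0[of \<xi>] by (simp add: norm_mult mult.commute)
    qed
    have [measurable]: "?\<psi> \<in> borel_measurable borel" by (rule schwartz_measurable[OF schwartz_poly_gauss])
    show "(\<integral>\<^sup>+\<xi>. ?g \<xi> * ?J \<xi> \<partial>lborel)
      \<le> (\<integral>\<^sup>+\<xi>. ?R \<xi> \<partial>lborel)"
    proof (rule nn_integral_mono)
      fix \<xi>
      have "?J \<xi> \<le>
          (\<integral>\<^sup>+s. ennreal (q \<xi>) * ennreal (cmod (U (s, \<xi>))) + g0 \<xi> * indicator {0..T} s \<partial>lborel)"
        by (rule nn_integral_mono[OF \<Psi>_le])
      also have "\<dots> = ennreal (q \<xi>) * abs_in_time \<xi> + g0 \<xi> * ennreal T"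
        unfolding abs_in_time_def using T by (subst nn_integral_add) (auto simp: nn_integral_cmult)
      finally have "?g \<xi> * ?J \<xi> \<le>
          ?g \<xi> * (ennreal (q \<xi>) * abs_in_time \<xi> + g0 \<xi> * ennreal T)"
        by (rule mult_left_mono) simp
      also have "\<dots> = ?R \<xi>"
        unfolding \<psi> g0_def using q0[of \<xi>] by (simp add: ennreal_mult distrib_left mult_ac)
      finally show "?g \<xi> * ?J \<xi> \<le>
         ?R \<xi>" .
    qed
    have "(\<integral>\<^sup>+\<xi>. ennreal (cmod (?\<psi> \<xi>)) * abs_in_time \<xi> \<partial>lborel) < \<infinity>"
      by (rule test_finite[OF _ abs_in_time_bound schwartz_poly_gauss]) measurable
    moreover have "(\<integral>\<^sup>+\<xi>. ?g \<xi> * ennreal (cmod (\<gamma> 0 \<xi>)) \<partial>lborel) < \<infinity>"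
      by (rule test_finite[OF _ \<gamma>_bound schwartz_gauss]) measurable
    moreover have "(\<integral>\<^sup>+\<xi>. ?g \<xi> * spread abs_in_time \<xi> \<partial>lborel) < \<infinity>"
      by (rule test_finite[OF _ spread_abs_bound schwartz_gauss]) measurable
    ultimately show "(\<integral>\<^sup>+\<xi>. ?R \<xi> \<partial>lborel) < \<infinity>"
      by (intro nn_integral_combination_finite) measurable
  qed
  have d: "((\<lambda>s. LINT \<xi>|lborel. u s \<xi> * gauss c \<xi>) has_vector_derivative (LINT \<xi>|lborel. ?\<Psi> s \<xi> * gauss c \<xi>)) (at s)"
    if s: "0 < s" "s < t" for s c
  proof -
    have sT: "s \<in> {0..T}" using s t by auto
    note [measurable] = meas[OF sT]
    have "(LINT \<xi>|lborel. (of_real (damping s \<xi>) * u s \<xi> + \<gamma> s \<xi>) * gauss c \<xi>) = (LINT \<xi>|lborel. ?\<Psi> s \<xi> * gauss c \<xi>)"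
    proof (rule integral_cong_AE)
      show "AE \<xi> in lborel. (of_real (damping s \<xi>) * u s \<xi> + \<gamma> s \<xi>) * gauss c \<xi> = ?\<Psi> s \<xi> * gauss c \<xi>"
        using U_eq[OF sT] temperature_formula[OF sT] by eventually_elim simp
    qed measurable
    then show ?thesis using du[of s c] s t by simp
  qed
  have c: "continuous_on {0..t} (\<lambda>s. LINT \<xi>|lborel. u s \<xi> * gauss c \<xi>)" for c
    by (rule continuous_on_subset[OF cont(1)]) (use t in auto)
  have m: "(\<lambda>p. ?\<Psi> (fst p) (snd p)) \<in> borel_measurable (borel \<Otimes>\<^sub>M borel)" by measurable
  note W = weak_equation_integrated[OF t0 c m gauss_measurable d fin]
  have eq: "(u t \<xi> - Y t \<xi>) * gauss c \<xi> = u t \<xi> * gauss c \<xi> - u 0 \<xi> * gauss c \<xi> - (LINT s|lborel. indicator {0..t} s *\<^sub>R ?\<Psi> s \<xi>) * gauss c \<xi>" for c \<xi>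
    by (simp add: Y_def algebra_simps)
  have "AE \<xi> in lborel. u t \<xi> - Y t \<xi> = 0"
  proof (rule gauss_separating)
    show "integrable lborel (\<lambda>\<xi>. (u t \<xi> - Y t \<xi>) * gauss 0 \<xi>)"
      unfolding eq by (intro Bochner_Integration.integrable_diff test_integrable(1) t T0 W(1))
    show "(LINT \<xi>|lborel. (u t \<xi> - Y t \<xi>) * gauss (\<i> * of_real b) \<xi>) = 0" for b
      unfolding eq using test_integrable(1)[OF t] test_integrable(1)[OF T0] W[of "\<i> * of_real b"] by simp
  qed
  then show ?thesis by simp
qed

lemma U_formula: "AE \<xi> in lborel. AE s in lborel. s \<in> {0..T} \<longrightarrow> U (s, \<xi>) = Y s \<xi>"
proof -
  have "AE s in lborel. AE \<xi> in lborel. s \<in> {0..T} \<longrightarrow> U (s, \<xi>) = Y s \<xi>"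
  proof (rule AE_I2)
    fix s
    show "AE \<xi> in lborel. s \<in> {0..T} \<longrightarrow> U (s, \<xi>) = Y s \<xi>"
    proof (cases "s \<in> {0..T}")
      case True
      show ?thesis using U_eq[OF True] vorticity_formula[OF True] by eventually_elim simp
    next
      case False
      then show ?thesis by (intro AE_I2) auto
    qed
  qed
  then show ?thesis
    by (subst (asm) lborel_pair.AE_commute) measurable
qed

end

section \<open>Bounds for one mode\<close>

context mode_flow
begin

lemma singleton_integral: "(LINT s|lborel. indicator {0..0::real} s *\<^sub>R f s) = (0 :: complex)"
proof (rule integral_eq_zero_AE)
  show "AE s in lborel. indicator {0..0::real} s *\<^sub>R f s = 0"
    using AE_lborel_singleton[of "0::real"] by eventually_elim (simp add: indicator_def)
qed

text \<open>For almost every \<open>\<xi>\<close> the functions \<open>U(\<cdot>, \<xi>)\<close> and \<open>Y(\<cdot>, \<xi>)\<close> agree at almost every time. In the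
integral defining \<open>Y\<close> the former can therefore be replaced by the latter, which makes the integrand
continuous and \<open>Y\<close> differentiable at every time.\<close>

lemma pathwise_system:
  "AE \<xi> in lborel. spread abs_in_time \<xi> < \<infinity> \<and>
     (AE s in lborel. s \<in> {0..T} \<longrightarrow> U (s, \<xi>) = Y s \<xi>) \<and>
     continuous_on {0..T} (\<lambda>t. Y t \<xi>) \<and> continuous_on {0..T} (\<lambda>t. G t \<xi>) \<and>
     (\<forall>t. 0 < t \<longrightarrow> t < T \<longrightarrow>
       ((\<lambda>t. Y t \<xi>) has_vector_derivative of_real (damping t \<xi>) * Y t \<xi> + G t \<xi>) (at t)) \<and>
     Y 0 \<xi> = u 0 \<xi> \<and> G 0 \<xi> = \<gamma> 0 \<xi>"
proof -
  have "AE \<xi> in lborel. spread abs_in_time \<xi> < \<infinity>" by (rule finite_AE[OF _ spread_abs_bound]) measurable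
  moreover have "AE \<xi> in lborel. abs_in_time \<xi> < \<infinity>" by (rule finite_AE[OF _ abs_in_time_bound]) measurable
  ultimately show ?thesis using U_formula
  proof eventually_elim
    case (elim \<xi>)
    note UY = elim(3)
    have f: "set_integrable lborel {0..T} (\<lambda>s. force s \<xi>)"
      using integrable_mult_indicator[OF _ force_integrable[OF elim(1)], of "{0..T}"] by (simp add: set_integrable_def)
    have G: "continuous_on {0..T} (\<lambda>t. G t \<xi>)"
      unfolding G_def by (intro continuous_intros continuous_indefinite_integral f)
    let ?\<Psi> = "\<lambda>s. of_real (damping s \<xi>) * U (s, \<xi>) + G s \<xi>"
    have U_int: "integrable lborel (\<lambda>s. U (s, \<xi>))"
      using elim(2) by (simp add: integrable_iff_bounded abs_in_time_def)
    have "set_integrable lborel {0..T} ?\<Psi>"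
    proof -
      have "continuous_on {0..T} (\<lambda>s. damping s \<xi>)" by (intro continuous_intros)
      then have "bounded ((\<lambda>s. damping s \<xi>) ` {0..T})"
        by (intro compact_imp_bounded compact_continuous_image) auto
      then obtain c where "\<forall>x\<in>(\<lambda>s. damping s \<xi>) ` {0..T}. norm x \<le> c"
        unfolding bounded_iff by blast
      then have c: "\<bar>damping s \<xi>\<bar> \<le> c" if "s \<in> {0..T}" for s
        using that by simp
      have "integrable lborel (\<lambda>s. indicator {0..T} s *\<^sub>R (of_real (damping s \<xi>) * U (s, \<xi>)))"
      proof (rule Bochner_Integration.integrable_bound)
        show "integrable lborel (\<lambda>s. of_real c * U (s, \<xi>))" using U_int by simp
        show "AE s in lborel. norm (indicator {0..T} s *\<^sub>R (of_real (damping s \<xi>) * U (s, \<xi>))) \<le> norm (of_real c * U (s, \<xi>))"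
        proof (rule AE_I2)
          fix s
          show "norm (indicator {0..T} s *\<^sub>R (of_real (damping s \<xi>) * U (s, \<xi>))) \<le> norm (of_real c * U (s, \<xi>))"
          proof (cases "s \<in> {0..T}")
            case True
            have "\<bar>damping s \<xi>\<bar> * cmod (U (s, \<xi>)) \<le> \<bar>c\<bar> * cmod (U (s, \<xi>))"
              using c[OF True] by (intro mult_right_mono) auto
            then show ?thesis using True by (simp only: norm_scaleR norm_mult norm_of_real) simp
          qed simp
        qed
      qed measurable
      moreover have "set_integrable lborel {0..T} (\<lambda>s. G s \<xi>)"
        by (rule borel_integrable_atLeastAtMost'[OF G])
      ultimately show ?thesis unfolding set_integrable_def by (simp add: scaleR_add_right del: of_real_minus of_real_mult of_real_power)
    qed
    then have Y: "continuous_on {0..T} (\<lambda>t. Y t \<xi>)"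
      unfolding Y_def by (intro continuous_intros continuous_indefinite_integral)
    have dY: "((\<lambda>t. Y t \<xi>) has_vector_derivative of_real (damping t \<xi>) * Y t \<xi> + G t \<xi>) (at t)" if t: "0 < t" "t < T" for t
    proof -
      have "((\<lambda>t. LINT s|lborel. indicator {0..t} s *\<^sub>R ?\<Psi> s) has_vector_derivative of_real (damping t \<xi>) * Y t \<xi> + G t \<xi>) (at t)"
      proof (rule derivative_indefinite_integral[OF _ _ _ t])
        show "?\<Psi> \<in> borel_measurable borel" by measurable
        show "AE s in lborel. s \<in> {0..T} \<longrightarrow> ?\<Psi> s = of_real (damping s \<xi>) * Y s \<xi> + G s \<xi>"
          using UY by eventually_elim simp
        show "continuous_on {0..T} (\<lambda>s. of_real (damping s \<xi>) * Y s \<xi> + G s \<xi>)"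
          by (intro continuous_intros Y G)
      qed
      then have "((\<lambda>t. u 0 \<xi> + (LINT s|lborel. indicator {0..t} s *\<^sub>R ?\<Psi> s)) has_vector_derivative 0 + (of_real (damping t \<xi>) * Y t \<xi> + G t \<xi>)) (at t)"
        by (intro has_vector_derivative_add has_vector_derivative_const)
      then show ?thesis by (simp add: Y_def[abs_def])
    qed
    have "Y 0 \<xi> = u 0 \<xi>" "G 0 \<xi> = \<gamma> 0 \<xi>"
      by (simp_all only: Y_def G_def singleton_integral) simp_all
    then show ?case using elim(1) UY Y G dY by blast
  qed
qed

lemma symbol_zero_mode: "k = 0 \<Longrightarrow> \<kappa> s \<xi> = 0"
  by (simp add: dxx_inv_laplace_symbol_def)

lemma resonance_zero_mode:
  assumes "k = 0" shows "spread resonance \<xi> = 0"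
proof -
  have "resonance \<zeta> = 0" for \<zeta>
    unfolding resonance_def symbol_zero_mode[OF assms] by simp
  then show ?thesis unfolding spread_def by simp
qed

text \<open>\<open>damped_ode_bound\<close> with the bound of \<open>G_norm_le\<close>, which is uniform in time. For \<open>k = 0\<close>, where no
damping is available at \<open>\<xi> = 0\<close>, that bound is \<open>0\<close>.\<close>

lemma vorticity_bound:
  "AE \<xi> in lborel. \<forall>t\<in>{0..T}. ennreal (cmod (Y t \<xi>)) \<le> ennreal (cmod (u 0 \<xi>)) +
      ennreal ((1 + pi) / \<delta>) * (ennreal (cmod (\<gamma> 0 \<xi>)) + spread resonance \<xi>)"
proof -
  have "AE \<xi> in lborel. k = 0 \<longrightarrow> \<gamma> 0 \<xi> = 0" using mean by (cases "k = 0") auto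
  with pathwise_system show ?thesis
  proof eventually_elim
    case (elim \<xi>)
    have sf: "spread resonance \<xi> < \<infinity>"
      using elim spread_mono[OF resonance_le] by (meson le_less_trans)
    define g where "g = cmod (\<gamma> 0 \<xi>) + enn2real (spread resonance \<xi>)"
    have g0: "g \<ge> 0" by (simp add: g_def)
    have eg: "ennreal g = ennreal (cmod (\<gamma> 0 \<xi>)) + spread resonance \<xi>"
      using sf by (simp add: g_def)
    have Gle: "cmod (G s \<xi>) \<le> g" for s
      using G_norm_le[of s \<xi>] g0 unfolding eg[symmetric] by simp
    show ?case
    proof
      fix t assume t: "t \<in> {0..T}"
      have "cmod (Y t \<xi>) \<le> cmod (Y 0 \<xi>) + g * ((1 + pi) / \<delta>)"
      proof (rule damped_ode_bound[OF \<delta>, where k = k and \<xi> = \<xi> and g = "\<lambda>t. G t \<xi>"])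
        show "k \<noteq> 0 \<or> g = 0" using elim resonance_zero_mode by (auto simp: g_def)
        show "continuous_on {0..t} (\<lambda>t. Y t \<xi>)"
          using elim t by (auto elim!: continuous_on_subset)
      qed (use g0 t elim Gle in auto)
      also have "Y 0 \<xi> = u 0 \<xi>" using elim by simp
      finally have "ennreal (cmod (Y t \<xi>)) \<le> ennreal (cmod (u 0 \<xi>) + g * ((1 + pi) / \<delta>))"
        by (rule ennreal_leI)
      also have "\<dots> = ennreal (cmod (u 0 \<xi>)) + ennreal ((1 + pi) / \<delta>) * ennreal g"
        using g0 \<delta> by (simp add: ennreal_mult[symmetric] mult.commute)
      finally show "ennreal (cmod (Y t \<xi>)) \<le> ennreal (cmod (u 0 \<xi>)) +
         ennreal ((1 + pi) / \<delta>) * (ennreal (cmod (\<gamma> 0 \<xi>)) + spread resonance \<xi>)"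
        unfolding eg .
    qed
  qed
qed

text \<open>The bound for \<open>Y\<close> is uniform in time, and the resonance factor has total integral at most \<open>\<pi>\<close>.\<close>

lemma resonance_bound:
  "AE \<xi> in lborel. resonance \<xi> \<le> ennreal pi * (ennreal (cmod (u 0 \<xi>)) +
      ennreal ((1 + pi) / \<delta>) * (ennreal (cmod (\<gamma> 0 \<xi>)) + spread resonance \<xi>))"
  using pathwise_system vorticity_bound
proof eventually_elim
  case (elim \<xi>)
  let ?D = "ennreal (cmod (u 0 \<xi>)) + ennreal ((1 + pi) / \<delta>) * (ennreal (cmod (\<gamma> 0 \<xi>)) + spread resonance \<xi>)"
  have res: "resonance \<xi> = (\<integral>\<^sup>+s. ennreal (\<kappa> s \<xi> * cmod (U (s, \<xi>))) \<partial>lborel)"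
    by (rule resonance_def)
  have bound: "ennreal (cmod (Y s \<xi>)) \<le> ?D" if "s \<in> {0..T}" for s using elim that by blast
  have "resonance \<xi> \<le> (\<integral>\<^sup>+s. ennreal (indicator {0..T} s * \<kappa> s \<xi>) * ?D \<partial>lborel)"
    unfolding res
  proof (rule nn_integral_mono_AE)
    have "AE s in lborel. s \<in> {0..T} \<longrightarrow> U (s, \<xi>) = Y s \<xi>" using elim by blast
    then show "AE s in lborel. ennreal (\<kappa> s \<xi> * cmod (U (s, \<xi>))) \<le> ennreal (indicator {0..T} s * \<kappa> s \<xi>) * ?D"
    proof eventually_elim
      case (elim s)
      show ?case
      proof (cases "s \<in> {0..T}")
        case True
        then show ?thesis using elim bound[OF True]
          by (simp add: ennreal_mult symbol_bounds mult_left_mono)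
      qed (simp add: U_out)
    qed
  qed
  also have "\<dots> = (\<integral>\<^sup>+s. ennreal (indicator {0..T} s * \<kappa> s \<xi>) \<partial>lborel) * ?D"
    by (rule nn_integral_multc) measurable
  also have "\<dots> \<le> ennreal pi * ?D" by (intro mult_right_mono symbol_time_integral) simp
  finally show ?case .
qed

abbreviation "energy a \<equiv> (square_integral (\<lambda>\<xi>. W \<xi> * ennreal (cmod (a \<xi>))))"

lemma energy_le3:
  assumes [measurable]: "a \<in> borel_measurable borel" "b \<in> borel_measurable borel" "c \<in> borel_measurable borel"
    and le: "AE \<xi> in lborel. f \<xi> \<le> ennreal p * a \<xi> + ennreal q * b \<xi> + ennreal r * c \<xi>"
    and nonneg: "p \<ge> 0" "q \<ge> 0" "r \<ge> 0"
  shows "(square_integral (\<lambda>\<xi>. W \<xi> * f \<xi>)) \<le>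
     3 * (ennreal (p\<^sup>2) * (square_integral (\<lambda>\<xi>. W \<xi> * a \<xi>)) + ennreal (q\<^sup>2) * (square_integral (\<lambda>\<xi>. W \<xi> * b \<xi>))
       + ennreal (r\<^sup>2) * (square_integral (\<lambda>\<xi>. W \<xi> * c \<xi>)))"
proof -
  have "(square_integral (\<lambda>\<xi>. W \<xi> * f \<xi>)) \<le> (\<integral>\<^sup>+\<xi>. 3 * (ennreal (p\<^sup>2) * (W \<xi> * a \<xi>)\<^sup>2 + ennreal (q\<^sup>2) * (W \<xi> * b \<xi>)\<^sup>2 + ennreal (r\<^sup>2) * (W \<xi> * c \<xi>)\<^sup>2) \<partial>lborel)"
  proof (rule nn_integral_mono_AE)
    show "AE \<xi> in lborel. (W \<xi> * f \<xi>)\<^sup>2 \<le> 3 * (ennreal (p\<^sup>2) * (W \<xi> * a \<xi>)\<^sup>2 + ennreal (q\<^sup>2) * (W \<xi> * b \<xi>)\<^sup>2 + ennreal (r\<^sup>2) * (W \<xi> * c \<xi>)\<^sup>2)"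
      using le
    proof eventually_elim
      case (elim \<xi>)
      have "W \<xi> * f \<xi> \<le> ennreal p * (W \<xi> * a \<xi>) + ennreal q * (W \<xi> * b \<xi>) + ennreal r * (W \<xi> * c \<xi>)"
        using mult_left_mono[OF elim, of "W \<xi>"] by (simp add: distrib_left mult_ac)
      then have "(W \<xi> * f \<xi>)\<^sup>2 \<le> (ennreal p * (W \<xi> * a \<xi>) + ennreal q * (W \<xi> * b \<xi>) + ennreal r * (W \<xi> * c \<xi>))\<^sup>2"
        by (rule power_mono) simp
      also have "\<dots> \<le> 3 * ((ennreal p * (W \<xi> * a \<xi>))\<^sup>2 + (ennreal q * (W \<xi> * b \<xi>))\<^sup>2 + (ennreal r * (W \<xi> * c \<xi>))\<^sup>2)"
        by (rule square_add3_le)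
      finally show ?case using nonneg by (simp only: power_mult_distrib[of "ennreal _"] ennreal_power)
    qed
  qed
  also have "\<dots> = 3 * (ennreal (p\<^sup>2) * (square_integral (\<lambda>\<xi>. W \<xi> * a \<xi>)) + ennreal (q\<^sup>2) * (square_integral (\<lambda>\<xi>. W \<xi> * b \<xi>))
       + ennreal (r\<^sup>2) * (square_integral (\<lambda>\<xi>. W \<xi> * c \<xi>)))"
    by (simp add: nn_integral_add nn_integral_cmult)
  finally show ?thesis .
qed

lemma energy_formulas:
  assumes t: "t \<in> {0..T}"
  shows "energy (u t) = energy (Y t)" "energy (\<gamma> t) = energy (G t)"
proof -
  note [measurable] = meas[OF t]
  show "energy (u t) = energy (Y t)"
    by (rule nn_integral_cong_AE) (use vorticity_formula[OF t] in \<open>auto elim!: eventually_mono\<close>)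
  show "energy (\<gamma> t) = energy (G t)"
    by (rule nn_integral_cong_AE) (use temperature_formula[OF t] in \<open>auto elim!: eventually_mono\<close>)
qed

text \<open>The weighted square integral \<open>X\<close> of the resonance is finite and satisfies
\<open>X \<le> 3 (\<pi>\<^sup>2 a + (\<pi> C)\<^sup>2 b + (\<pi> C S)\<^sup>2 X)\<close>, with \<open>a\<close> and \<open>b\<close> the initial energies. The last term is at
most \<open>X / 2\<close>. The bounds for \<open>Y\<close> and \<open>G\<close> then involve only initial data.\<close>

lemma mode_estimate_small:
  assumes S0: "S \<ge> 0" and small: "3 * (pi * ((1 + pi) / \<delta>) * S)\<^sup>2 \<le> 1 / 2" and t: "t \<in> {0..T}"
    and K: "K = 3 * (1 + ((1 + pi) / \<delta>)\<^sup>2) * (1 + 6 * S\<^sup>2 * pi\<^sup>2 * (1 + ((1 + pi) / \<delta>)\<^sup>2))"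
  shows "energy (u t) + energy (\<gamma> t) \<le> ennreal K * (energy (u 0) + energy (\<gamma> 0))"
proof -
  define C where "C = (1 + pi) / \<delta>"
  have C0: "C \<ge> 0" using \<delta> by (simp add: C_def)
  note [measurable] = meas[OF T0]
  define X where "X = (square_integral (\<lambda>\<xi>. W \<xi> * resonance \<xi>))"
  define Z where "Z = (square_integral (\<lambda>\<xi>. W \<xi> * spread resonance \<xi>))"
  have X_fin: "X < \<infinity>"
  proof -
    have "X \<le> (square_integral (\<lambda>\<xi>. W \<xi> * abs_in_time \<xi>))"
      unfolding X_def by (intro nn_integral_mono power_mono mult_left_mono resonance_le) auto
    then show ?thesis using abs_in_time_bound by (rule le_less_trans)
  qed
  have ZX: "Z \<le> ennreal (S\<^sup>2) * X"
    unfolding Z_def X_def using spread_bound[OF resonance_measurable] S0 by (simp add: ennreal_power)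
  have "AE \<xi> in lborel. resonance \<xi> \<le> ennreal pi * ennreal (cmod (u 0 \<xi>)) + ennreal (pi * C) * ennreal (cmod (\<gamma> 0 \<xi>)) + ennreal (pi * C) * spread resonance \<xi>"
    using resonance_bound unfolding C_def[symmetric]
    by eventually_elim (use C0 in \<open>simp add: ennreal_mult distrib_left mult_ac add_ac\<close>)
  from energy_le3[OF _ _ _ this]
  have X1: "X \<le> 3 * (ennreal (pi\<^sup>2) * energy (u 0) + ennreal ((pi * C)\<^sup>2) * energy (\<gamma> 0) + ennreal ((pi * C)\<^sup>2) * Z)"
    unfolding X_def Z_def using C0 by simp
  have "AE \<xi> in lborel. ennreal (cmod (Y t \<xi>)) \<le> ennreal 1 * ennreal (cmod (u 0 \<xi>)) + ennreal C * ennreal (cmod (\<gamma> 0 \<xi>)) + ennreal C * spread resonance \<xi>"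
    using vorticity_bound unfolding C_def[symmetric]
    by eventually_elim (use t in \<open>auto simp add: distrib_left add_ac\<close>)
  from energy_le3[OF _ _ _ this]
  have Y1: "energy (Y t) \<le> 3 * (ennreal 1 * energy (u 0) + ennreal (C\<^sup>2) * energy (\<gamma> 0) + ennreal (C\<^sup>2) * Z)"
    unfolding Z_def using C0 by simp
  have "AE \<xi> in lborel. ennreal (cmod (G t \<xi>)) \<le> ennreal 0 * ennreal (cmod (u 0 \<xi>)) + ennreal 1 * ennreal (cmod (\<gamma> 0 \<xi>)) + ennreal 1 * spread resonance \<xi>"
    using G_norm_le by (intro AE_I2) simp
  from energy_le3[OF _ _ _ this]
  have G1: "energy (G t) \<le> 3 * (energy (\<gamma> 0) + Z)"
    unfolding Z_def by simp
  have fin: "energy (u 0) < \<infinity>" "energy (\<gamma> 0) < \<infinity>" "Z < \<infinity>"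
    using u_bound[OF T0] \<gamma>_bound X_fin ZX by (auto simp: ennreal_mult_less_top le_less_trans)
  obtain a where a: "energy (u 0) = ennreal a" "a \<ge> 0" using fin(1) by (cases "energy (u 0)") auto
  obtain b where b: "energy (\<gamma> 0) = ennreal b" "b \<ge> 0" using fin(2) by (cases "energy (\<gamma> 0)") auto
  obtain z where z: "Z = ennreal z" "z \<ge> 0" using fin(3) by (cases Z) auto
  obtain x where x: "X = ennreal x" "x \<ge> 0" using X_fin by (cases X) auto
  have zx: "z \<le> S\<^sup>2 * x" using ZX x z by (simp add: ennreal_mult[symmetric])
  have three: "(3::ennreal) = ennreal 3" by simp
  have "ennreal x \<le> ennreal (3 * (pi\<^sup>2 * a + (pi * C)\<^sup>2 * b + (pi * C)\<^sup>2 * z))"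
    using X1 a b z x unfolding three by (simp add: ennreal_mult[symmetric] ennreal_plus[symmetric] del: ennreal_plus ennreal_numeral)
  then have x1: "x \<le> 3 * (pi\<^sup>2 * a + (pi * C)\<^sup>2 * b + (pi * C)\<^sup>2 * z)"
    using a b z by (subst (asm) ennreal_le_iff) auto
  have "(pi * C)\<^sup>2 * z \<le> (pi * C)\<^sup>2 * (S\<^sup>2 * x)" using zx by (intro mult_left_mono) auto
  moreover have "3 * ((pi * C)\<^sup>2 * (S\<^sup>2 * x)) = 3 * (pi * C * S)\<^sup>2 * x" by (simp add: power_mult_distrib)
  moreover have "3 * (pi * C * S)\<^sup>2 * x \<le> 1 / 2 * x" using small x(2) unfolding C_def by (intro mult_right_mono) auto
  ultimately have "x \<le> 6 * (pi\<^sup>2 * a + (pi * C)\<^sup>2 * b)" using x1 by (simp add: algebra_simps)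
  also have "\<dots> = 6 * pi\<^sup>2 * (a + C\<^sup>2 * b)" by (simp add: power_mult_distrib algebra_simps)
  also have "\<dots> \<le> 6 * pi\<^sup>2 * ((1 + C\<^sup>2) * (a + b))"
    using a b by (intro mult_left_mono) (auto simp: algebra_simps)
  finally have x2: "x \<le> 6 * pi\<^sup>2 * ((1 + C\<^sup>2) * (a + b))" .
  have "z \<le> S\<^sup>2 * (6 * pi\<^sup>2 * ((1 + C\<^sup>2) * (a + b)))"
    using zx x2 by (meson mult_left_mono order_trans zero_le_power2)
  then have z2: "a + b + z \<le> (1 + 6 * S\<^sup>2 * pi\<^sup>2 * (1 + C\<^sup>2)) * (a + b)" by (simp add: algebra_simps)
  have "energy (u t) + energy (\<gamma> t) \<le> 3 * (ennreal 1 * energy (u 0) + ennreal (C\<^sup>2) * energy (\<gamma> 0) + ennreal (C\<^sup>2) * Z) + 3 * (energy (\<gamma> 0) + Z)"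
    unfolding energy_formulas[OF t] by (intro add_mono Y1 G1)
  also have "\<dots> = ennreal (3 * (1 * a + C\<^sup>2 * b + C\<^sup>2 * z) + 3 * (b + z))"
    using a b z unfolding three by (simp add: ennreal_mult[symmetric] ennreal_plus[symmetric] del: ennreal_plus ennreal_numeral)
  also have "\<dots> \<le> ennreal (3 * (1 + C\<^sup>2) * (a + b + z))"
    using a b z by (intro ennreal_leI) (simp add: algebra_simps)
  also have "\<dots> \<le> ennreal (3 * (1 + C\<^sup>2) * ((1 + 6 * S\<^sup>2 * pi\<^sup>2 * (1 + C\<^sup>2)) * (a + b)))"
    by (intro ennreal_leI mult_left_mono z2) (auto intro!: add_nonneg_nonneg)
  also have "\<dots> = ennreal (K * (a + b))" by (simp add: K C_def[symmetric] mult.assoc)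
  also have "\<dots> = ennreal K * (energy (u 0) + energy (\<gamma> 0))"
  proof -
    have "K \<ge> 0" unfolding K by (intro mult_nonneg_nonneg add_nonneg_nonneg) auto
    then show ?thesis using a b by (simp add: ennreal_mult')
  qed
  finally show ?thesis .
qed

text \<open>If \<open>h dM\<close> is \<open>\<alpha>\<close> times the point mass at \<open>0\<close>, the force at frequency \<open>\<xi>\<close> involves only \<open>U(\<cdot>, \<xi>)\<close>, and
the pair \<open>(Y, G)\<close> solves a closed linear system for almost every \<open>\<xi>\<close>.\<close>

lemma temperature_bound_local:
  assumes local: "\<And>f. f \<in> borel_measurable borel \<Longrightarrow> (LINT \<eta>|M. h \<eta> * f \<eta>) = of_real \<alpha> * f 0"
    and K1: "K1 = 2 * exp ((2 * \<bar>\<alpha>\<bar> * ((1 + pi) / \<delta>) + 1) * pi)"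
  shows "AE \<xi> in lborel. \<forall>t\<in>{0..T}. cmod (G t \<xi>) \<le> K1 * (cmod (\<gamma> 0 \<xi>) + \<bar>\<alpha>\<bar> * pi * cmod (u 0 \<xi>)) \<and>
     cmod (Y t \<xi>) \<le> cmod (u 0 \<xi>) + K1 * (cmod (\<gamma> 0 \<xi>) + \<bar>\<alpha>\<bar> * pi * cmod (u 0 \<xi>)) * ((1 + pi) / \<delta>)"
proof -
  have force: "force s \<xi> = of_real \<alpha> * (of_real (\<kappa> s \<xi>) * U (s, \<xi>))" for s \<xi>
    unfolding force_def by (subst local) auto
  have K1_1: "K1 \<ge> 1"
  proof -
    have "0 \<le> (2 * \<bar>\<alpha>\<bar> * ((1 + pi) / \<delta>) + 1) * pi" using \<delta> by (intro mult_nonneg_nonneg add_nonneg_nonneg) auto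
    then have "1 \<le> exp ((2 * \<bar>\<alpha>\<bar> * ((1 + pi) / \<delta>) + 1) * pi)" by simp
    then show ?thesis unfolding K1 by linarith
  qed
  have C0: "(1 + pi) / \<delta> \<ge> 0" using \<delta> by simp
  from pathwise_system vorticity_bound show ?thesis
  proof eventually_elim
    case (elim \<xi>)
    let ?g = "cmod (\<gamma> 0 \<xi>) + \<bar>\<alpha>\<bar> * pi * cmod (u 0 \<xi>)"
    have g0: "0 \<le> ?g" by (intro add_nonneg_nonneg mult_nonneg_nonneg) auto
    from elim have Y: "continuous_on {0..T} (\<lambda>t. Y t \<xi>)" and G: "continuous_on {0..T} (\<lambda>t. G t \<xi>)"
      and dY: "\<And>t. 0 < t \<Longrightarrow> t < T \<Longrightarrow> ((\<lambda>t. Y t \<xi>) has_vector_derivative of_real (damping t \<xi>) * Y t \<xi> + G t \<xi>) (at t)"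
      and UY: "AE s in lborel. s \<in> {0..T} \<longrightarrow> U (s, \<xi>) = Y s \<xi>"
      and init: "Y 0 \<xi> = u 0 \<xi>" "G 0 \<xi> = \<gamma> 0 \<xi>" by blast+
    show ?case
    proof (cases "k = 0")
      case True
      have G: "G t \<xi> = \<gamma> 0 \<xi>" for t
        unfolding G_def force symbol_zero_mode[OF True] by simp
      show ?thesis
      proof
        fix t assume t: "t \<in> {0..T}"
        have g: "cmod (\<gamma> 0 \<xi>) \<le> K1 * ?g"
        proof -
          have "cmod (\<gamma> 0 \<xi>) \<le> 1 * ?g" by simp
          also have "\<dots> \<le> K1 * ?g" by (intro mult_right_mono K1_1 g0)
          finally show ?thesis .
        qed
        have "ennreal (cmod (Y t \<xi>)) \<le> ennreal (cmod (u 0 \<xi>) + cmod (\<gamma> 0 \<xi>) * ((1 + pi) / \<delta>))"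
        proof -
          have "ennreal (cmod (Y t \<xi>)) \<le> ennreal (cmod (u 0 \<xi>)) + ennreal ((1 + pi) / \<delta>) * ennreal (cmod (\<gamma> 0 \<xi>))"
            using elim(2) t resonance_zero_mode[OF True] by auto
          also have "\<dots> = ennreal (cmod (u 0 \<xi>) + cmod (\<gamma> 0 \<xi>) * ((1 + pi) / \<delta>))"
          proof -
            have comb: "ennreal x + ennreal c * ennreal y = ennreal (x + y * c)" if "x \<ge> 0" "y \<ge> 0" "c \<ge> 0" for x y c
              using that by (simp add: ennreal_mult[symmetric] mult.commute)
            show ?thesis by (rule comb) (use C0 in auto)
          qed
          finally show ?thesis .
        qed
        then have "cmod (Y t \<xi>) \<le> cmod (u 0 \<xi>) + cmod (\<gamma> 0 \<xi>) * ((1 + pi) / \<delta>)"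
          by (simp only: ennreal_le_iff[OF add_nonneg_nonneg[OF norm_ge_zero mult_nonneg_nonneg[OF norm_ge_zero C0]]])
        also have "\<dots> \<le> cmod (u 0 \<xi>) + K1 * ?g * ((1 + pi) / \<delta>)"
          by (intro add_left_mono mult_right_mono g C0)
        finally show "cmod (G t \<xi>) \<le> K1 * ?g \<and> cmod (Y t \<xi>) \<le> cmod (u 0 \<xi>) + K1 * ?g * ((1 + pi) / \<delta>)"
          using g G by simp
      qed
    next
      case False
      have dG: "((\<lambda>t. G t \<xi>) has_vector_derivative of_real (- (\<alpha> * inverse (1 + (t - \<xi> / of_int k)\<^sup>2))) * Y t \<xi>) (at t)"
        if t: "0 < t" "t < T" for t
      proof -
        have "((\<lambda>t. LINT s|lborel. indicator {0..t} s *\<^sub>R force s \<xi>) has_vector_derivative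
            of_real \<alpha> * (of_real (inverse (1 + (t - \<xi> / of_int k)\<^sup>2)) * Y t \<xi>)) (at t)"
        proof (rule derivative_indefinite_integral[OF _ _ _ t])
          show "(\<lambda>s. force s \<xi>) \<in> borel_measurable borel" by measurable
          show "AE s in lborel. s \<in> {0..T} \<longrightarrow> force s \<xi> = of_real \<alpha> * (of_real (inverse (1 + (s - \<xi> / of_int k)\<^sup>2)) * Y s \<xi>)"
            using UY by eventually_elim (simp add: force symbol_resonant[OF False])
          have "1 + (s - \<xi> / of_int k)\<^sup>2 \<noteq> 0" for s :: real
            by (metis add_pos_nonneg less_irrefl zero_le_power2 zero_less_one)
          then show "continuous_on {0..T} (\<lambda>s. of_real \<alpha> * (of_real (inverse (1 + (s - \<xi> / of_int k)\<^sup>2)) * Y s \<xi>))"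
            by (intro continuous_intros Y) auto
        qed
        then have "((\<lambda>t. \<gamma> 0 \<xi> - (LINT s|lborel. indicator {0..t} s *\<^sub>R force s \<xi>)) has_vector_derivative
            0 - of_real \<alpha> * (of_real (inverse (1 + (t - \<xi> / of_int k)\<^sup>2)) * Y t \<xi>)) (at t)"
          by (intro has_vector_derivative_diff has_vector_derivative_const)
        then show ?thesis by (simp add: G_def[abs_def] mult.assoc)
      qed
      have Gle: "cmod (G t \<xi>) \<le> K1 * ?g" if t: "t \<in> {0..T}" for t
        using resonant_gronwall[OF \<delta> False T Y G dY dG t refl] unfolding init K1 .
      show ?thesis
      proof (intro ballI conjI Gle)
        fix t assume t: "t \<in> {0..T}"
        have "cmod (Y t \<xi>) \<le> cmod (Y 0 \<xi>) + K1 * ?g * ((1 + pi) / \<delta>)"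
        proof (rule damped_ode_bound[OF \<delta>, where k = k and \<xi> = \<xi> and g = "\<lambda>t. G t \<xi>"])
          show "continuous_on {0..t} (\<lambda>t. Y t \<xi>)" by (rule continuous_on_subset[OF Y]) (use t in auto)
          show "K1 * ?g \<ge> 0" using K1_1 g0 by (intro mult_nonneg_nonneg) auto
        qed (use False t dY Gle in auto)
        then show "cmod (Y t \<xi>) \<le> cmod (u 0 \<xi>) + K1 * ?g * ((1 + pi) / \<delta>)" unfolding init .
      qed
    qed
  qed
qed

lemma mode_estimate_local:
  assumes local: "\<And>f. f \<in> borel_measurable borel \<Longrightarrow> (LINT \<eta>|M. h \<eta> * f \<eta>) = of_real \<alpha> * f 0"
    and K1: "K1 = 2 * exp ((2 * \<bar>\<alpha>\<bar> * ((1 + pi) / \<delta>) + 1) * pi)" and t: "t \<in> {0..T}"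
    and K: "K = 3 * ((1 + K1 * (\<bar>\<alpha>\<bar> * pi) * ((1 + pi) / \<delta>))\<^sup>2 + (K1 * ((1 + pi) / \<delta>))\<^sup>2 + (K1 * (\<bar>\<alpha>\<bar> * pi))\<^sup>2 + K1\<^sup>2)"
  shows "energy (u t) + energy (\<gamma> t) \<le> ennreal K * (energy (u 0) + energy (\<gamma> 0))"
proof -
  define C where "C = (1 + pi) / \<delta>"
  have C0: "C \<ge> 0" using \<delta> by (simp add: C_def)
  have K10: "K1 \<ge> 0" by (simp add: K1)
  define p where "p = 1 + K1 * (\<bar>\<alpha>\<bar> * pi) * C"
  define q where "q = K1 * C"
  define r where "r = K1 * (\<bar>\<alpha>\<bar> * pi)"
  have nn: "p \<ge> 0" "q \<ge> 0" "r \<ge> 0" using C0 K10 by (auto simp: p_def q_def r_def)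
  note [measurable] = meas[OF T0]
  have bound: "AE \<xi> in lborel. \<forall>t\<in>{0..T}. cmod (G t \<xi>) \<le> K1 * (cmod (\<gamma> 0 \<xi>) + \<bar>\<alpha>\<bar> * pi * cmod (u 0 \<xi>)) \<and>
     cmod (Y t \<xi>) \<le> cmod (u 0 \<xi>) + K1 * (cmod (\<gamma> 0 \<xi>) + \<bar>\<alpha>\<bar> * pi * cmod (u 0 \<xi>)) * ((1 + pi) / \<delta>)"
    by (rule temperature_bound_local[OF local K1])
  have "AE \<xi> in lborel. ennreal (cmod (Y t \<xi>)) \<le> ennreal p * ennreal (cmod (u 0 \<xi>)) + ennreal q * ennreal (cmod (\<gamma> 0 \<xi>)) + ennreal 0 * 0"
    using bound
  proof eventually_elim
    case (elim \<xi>)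
    with t have "cmod (Y t \<xi>) \<le> p * cmod (u 0 \<xi>) + q * cmod (\<gamma> 0 \<xi>)"
      by (auto simp: p_def q_def C_def[symmetric] algebra_simps)
    then have "ennreal (cmod (Y t \<xi>)) \<le> ennreal (p * cmod (u 0 \<xi>) + q * cmod (\<gamma> 0 \<xi>))" by (rule ennreal_leI)
    then show ?case using nn by (simp add: ennreal_mult)
  qed
  from energy_le3[OF _ _ _ this]
  have Y1: "energy (Y t) \<le> 3 * (ennreal (p\<^sup>2) * energy (u 0) + ennreal (q\<^sup>2) * energy (\<gamma> 0))"
    using nn by simp
  have "AE \<xi> in lborel. ennreal (cmod (G t \<xi>)) \<le> ennreal r * ennreal (cmod (u 0 \<xi>)) + ennreal K1 * ennreal (cmod (\<gamma> 0 \<xi>)) + ennreal 0 * 0"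
    using bound
  proof eventually_elim
    case (elim \<xi>)
    with t have "cmod (G t \<xi>) \<le> r * cmod (u 0 \<xi>) + K1 * cmod (\<gamma> 0 \<xi>)"
      by (auto simp: r_def algebra_simps)
    then have "ennreal (cmod (G t \<xi>)) \<le> ennreal (r * cmod (u 0 \<xi>) + K1 * cmod (\<gamma> 0 \<xi>))" by (rule ennreal_leI)
    then show ?case using nn K10 by (simp add: ennreal_mult)
  qed
  from energy_le3[OF _ _ _ this]
  have G1: "energy (G t) \<le> 3 * (ennreal (r\<^sup>2) * energy (u 0) + ennreal (K1\<^sup>2) * energy (\<gamma> 0))"
    using nn K10 by simp
  have K': "K = 3 * (p\<^sup>2 + q\<^sup>2 + r\<^sup>2 + K1\<^sup>2)" by (simp add: K p_def q_def r_def C_def)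
  have three: "(3::ennreal) = ennreal 3" by simp
  have "energy (u t) + energy (\<gamma> t) \<le> 3 * (ennreal (p\<^sup>2) * energy (u 0) + ennreal (q\<^sup>2) * energy (\<gamma> 0)) + 3 * (ennreal (r\<^sup>2) * energy (u 0) + ennreal (K1\<^sup>2) * energy (\<gamma> 0))"
    unfolding energy_formulas[OF t] by (intro add_mono Y1 G1)
  also have "\<dots> = ennreal (3 * (p\<^sup>2 + r\<^sup>2)) * energy (u 0) + ennreal (3 * (q\<^sup>2 + K1\<^sup>2)) * energy (\<gamma> 0)"
    unfolding three by (simp add: ennreal_mult distrib_left distrib_right add_ac mult_ac del: ennreal_numeral)
  also have "\<dots> \<le> ennreal K * energy (u 0) + ennreal K * energy (\<gamma> 0)"
    unfolding K' by (intro add_mono mult_right_mono ennreal_leI) auto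
  finally show ?thesis by (simp add: distrib_left)
qed

end

section \<open>Sobolev norms of the solution\<close>

abbreviation sobolev_weight :: "nat \<Rightarrow> int \<Rightarrow> real \<Rightarrow> real" where
  "sobolev_weight N k \<xi> \<equiv> (1 + (of_int k)\<^sup>2 + \<xi>\<^sup>2) ^ N"

text \<open>\<^const>\<open>sobolev_energy\<close> for an arbitrary family of transforms in place of the chosen one.\<close>

definition fourier_energy :: "nat \<Rightarrow> (int \<Rightarrow> real \<Rightarrow> complex) \<Rightarrow> ennreal" where
  "fourier_energy N f =
     (\<integral>\<^sup>+ k. (\<integral>\<^sup>+ \<xi>. ennreal (sobolev_weight N k \<xi> * (cmod (f k \<xi>))\<^sup>2) \<partial>lborel) \<partial>count_space UNIV)"

definition mode_energy :: "nat \<Rightarrow> int \<Rightarrow> (int \<Rightarrow> real \<Rightarrow> complex) \<Rightarrow> ennreal" where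
  "mode_energy N k f = (square_integral (\<lambda>\<xi>. ennreal (mode_weight N k \<xi>) * ennreal (cmod (f k \<xi>))))"

lemma sobolev_energy_eq: "sobolev_energy N u = fourier_energy N (fourier_cyl u)"
  by (simp add: sobolev_energy_def fourier_energy_def)

lemma fourier_energy_cong:
  assumes "\<And>k. AE \<xi> in lborel. f k \<xi> = g k \<xi>"
  shows "fourier_energy N f = fourier_energy N g"
  unfolding fourier_energy_def
proof (rule nn_integral_cong)
  fix k
  show "(\<integral>\<^sup>+ \<xi>. ennreal (sobolev_weight N k \<xi> * (cmod (f k \<xi>))\<^sup>2) \<partial>lborel) =
        (\<integral>\<^sup>+ \<xi>. ennreal (sobolev_weight N k \<xi> * (cmod (g k \<xi>))\<^sup>2) \<partial>lborel)"
    by (rule nn_integral_cong_AE) (use assms[of k] in \<open>auto elim!: eventually_mono\<close>)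
qed

lemma fourier_energy_triangle:
  assumes b: "\<And>k. b k \<in> borel_measurable borel" and c: "\<And>k. c k \<in> borel_measurable borel"
    and le: "\<And>k \<xi>. cmod (a k \<xi>) \<le> cmod (b k \<xi>) + cmod (c k \<xi>)"
  shows "fourier_energy N a \<le> 2 * fourier_energy N b + 2 * fourier_energy N c"
proof -
  note [measurable] = b c
  have w0: "0 \<le> sobolev_weight N k \<xi>" for k :: int and \<xi> by (rule zero_le_power) (intro add_nonneg_nonneg; simp)
  have pw: "ennreal (sobolev_weight N k \<xi> * (cmod (a k \<xi>))\<^sup>2) \<le> 2 * ennreal (sobolev_weight N k \<xi> * (cmod (b k \<xi>))\<^sup>2) + 2 * ennreal (sobolev_weight N k \<xi> * (cmod (c k \<xi>))\<^sup>2)" for k \<xi>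
  proof -
    have "(cmod (a k \<xi>))\<^sup>2 \<le> (cmod (b k \<xi>) + cmod (c k \<xi>))\<^sup>2" by (intro power_mono le) auto
    also have "\<dots> \<le> 2 * (cmod (b k \<xi>))\<^sup>2 + 2 * (cmod (c k \<xi>))\<^sup>2"
      using zero_le_power2[of "cmod (b k \<xi>) - cmod (c k \<xi>)"] by (simp add: power2_eq_square algebra_simps)
    finally have "sobolev_weight N k \<xi> * (cmod (a k \<xi>))\<^sup>2 \<le> sobolev_weight N k \<xi> * (2 * (cmod (b k \<xi>))\<^sup>2 + 2 * (cmod (c k \<xi>))\<^sup>2)"
      using w0 by (rule mult_left_mono)
    also have "\<dots> = 2 * (sobolev_weight N k \<xi> * (cmod (b k \<xi>))\<^sup>2) + 2 * (sobolev_weight N k \<xi> * (cmod (c k \<xi>))\<^sup>2)" by (simp add: algebra_simps)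
    finally have "ennreal (sobolev_weight N k \<xi> * (cmod (a k \<xi>))\<^sup>2) \<le> ennreal (2 * (sobolev_weight N k \<xi> * (cmod (b k \<xi>))\<^sup>2) + 2 * (sobolev_weight N k \<xi> * (cmod (c k \<xi>))\<^sup>2))"
      by (rule ennreal_leI)
    also have "\<dots> = ennreal (2 * (sobolev_weight N k \<xi> * (cmod (b k \<xi>))\<^sup>2)) + ennreal (2 * (sobolev_weight N k \<xi> * (cmod (c k \<xi>))\<^sup>2))"
      by (rule ennreal_plus) (intro mult_nonneg_nonneg w0; simp)+
    finally show ?thesis using w0[of k \<xi>] by (simp add: ennreal_mult)
  qed
  have "fourier_energy N a \<le> (\<integral>\<^sup>+ k. 2 * (\<integral>\<^sup>+ \<xi>. ennreal (sobolev_weight N k \<xi> * (cmod (b k \<xi>))\<^sup>2) \<partial>lborel)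
      + 2 * (\<integral>\<^sup>+ \<xi>. ennreal (sobolev_weight N k \<xi> * (cmod (c k \<xi>))\<^sup>2) \<partial>lborel) \<partial>count_space UNIV)"
    unfolding fourier_energy_def
  proof (rule nn_integral_mono)
    fix k
    have "(\<integral>\<^sup>+ \<xi>. ennreal (sobolev_weight N k \<xi> * (cmod (a k \<xi>))\<^sup>2) \<partial>lborel) \<le>
      (\<integral>\<^sup>+ \<xi>. 2 * ennreal (sobolev_weight N k \<xi> * (cmod (b k \<xi>))\<^sup>2) + 2 * ennreal (sobolev_weight N k \<xi> * (cmod (c k \<xi>))\<^sup>2) \<partial>lborel)"
      by (rule nn_integral_mono[OF pw])
    also have "\<dots> = 2 * (\<integral>\<^sup>+ \<xi>. ennreal (sobolev_weight N k \<xi> * (cmod (b k \<xi>))\<^sup>2) \<partial>lborel)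
      + 2 * (\<integral>\<^sup>+ \<xi>. ennreal (sobolev_weight N k \<xi> * (cmod (c k \<xi>))\<^sup>2) \<partial>lborel)"
      by (simp add: nn_integral_add nn_integral_cmult)
    finally show "(\<integral>\<^sup>+ \<xi>. ennreal (sobolev_weight N k \<xi> * (cmod (a k \<xi>))\<^sup>2) \<partial>lborel) \<le> \<dots>" .
  qed
  also have "\<dots> = 2 * fourier_energy N b + 2 * fourier_energy N c"
    unfolding fourier_energy_def by (simp add: nn_integral_add nn_integral_cmult)
  finally show ?thesis .
qed

lemma mode_energy_le_fourier_energy:
  assumes "f k \<in> borel_measurable borel"
  shows "mode_energy N k f \<le> 2 ^ N * (\<integral>\<^sup>+ \<xi>. ennreal (sobolev_weight N k \<xi> * (cmod (f k \<xi>))\<^sup>2) \<partial>lborel)"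
    and "(\<integral>\<^sup>+ \<xi>. ennreal (sobolev_weight N k \<xi> * (cmod (f k \<xi>))\<^sup>2) \<partial>lborel) \<le> 2 ^ N * mode_energy N k f"
proof -
  note [measurable] = assms
  have w0: "0 \<le> sobolev_weight N k \<xi>" for \<xi> by (rule zero_le_power) (intro add_nonneg_nonneg; simp)
  have m: "(ennreal (mode_weight N k \<xi>) * ennreal (cmod (f k \<xi>)))\<^sup>2 = ennreal ((mode_weight N k \<xi>)\<^sup>2 * (cmod (f k \<xi>))\<^sup>2)" for \<xi>
    using mode_weight_ge_1[of N k \<xi>] by (simp add: power_mult_distrib ennreal_power ennreal_mult)
  have two: "(2::ennreal) ^ N = ennreal (2 ^ N)" by (simp add: ennreal_power[symmetric])
  have "mode_energy N k f \<le> (\<integral>\<^sup>+ \<xi>. 2 ^ N * ennreal (sobolev_weight N k \<xi> * (cmod (f k \<xi>))\<^sup>2) \<partial>lborel)"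
    unfolding mode_energy_def m
  proof (rule nn_integral_mono)
    fix \<xi>
    have "(mode_weight N k \<xi>)\<^sup>2 * (cmod (f k \<xi>))\<^sup>2 \<le> (2 ^ N * sobolev_weight N k \<xi>) * (cmod (f k \<xi>))\<^sup>2"
      by (intro mult_right_mono sobolev_weight_equivalent) auto
    then show "ennreal ((mode_weight N k \<xi>)\<^sup>2 * (cmod (f k \<xi>))\<^sup>2) \<le> 2 ^ N * ennreal (sobolev_weight N k \<xi> * (cmod (f k \<xi>))\<^sup>2)"
      unfolding two using w0[of \<xi>] by (simp add: ennreal_mult'[symmetric] mult.assoc ennreal_leI)
  qed
  then show "mode_energy N k f \<le> 2 ^ N * (\<integral>\<^sup>+ \<xi>. ennreal (sobolev_weight N k \<xi> * (cmod (f k \<xi>))\<^sup>2) \<partial>lborel)"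
    by (simp add: nn_integral_cmult)
  have "(\<integral>\<^sup>+ \<xi>. ennreal (sobolev_weight N k \<xi> * (cmod (f k \<xi>))\<^sup>2) \<partial>lborel) \<le> (\<integral>\<^sup>+ \<xi>. 2 ^ N * (ennreal (mode_weight N k \<xi>) * ennreal (cmod (f k \<xi>)))\<^sup>2 \<partial>lborel)"
    unfolding m
  proof (rule nn_integral_mono)
    fix \<xi>
    have "sobolev_weight N k \<xi> * (cmod (f k \<xi>))\<^sup>2 \<le> (2 ^ N * (mode_weight N k \<xi>)\<^sup>2) * (cmod (f k \<xi>))\<^sup>2"
      by (intro mult_right_mono sobolev_weight_equivalent) auto
    then show "ennreal (sobolev_weight N k \<xi> * (cmod (f k \<xi>))\<^sup>2) \<le> 2 ^ N * ennreal ((mode_weight N k \<xi>)\<^sup>2 * (cmod (f k \<xi>))\<^sup>2)"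
      unfolding two by (simp add: ennreal_mult'[symmetric] mult.assoc ennreal_leI)
  qed
  then show "(\<integral>\<^sup>+ \<xi>. ennreal (sobolev_weight N k \<xi> * (cmod (f k \<xi>))\<^sup>2) \<partial>lborel) \<le> 2 ^ N * mode_energy N k f"
    unfolding mode_energy_def by (simp add: nn_integral_cmult)
qed

lemma mode_part_le_fourier_energy:
  "(\<integral>\<^sup>+ \<xi>. ennreal (sobolev_weight N k \<xi> * (cmod (f k \<xi>))\<^sup>2) \<partial>lborel) \<le> fourier_energy N f"
  unfolding fourier_energy_def
  by (rule nn_integral_ge_point[of k UNIV "\<lambda>k. \<integral>\<^sup>+ \<xi>. ennreal (sobolev_weight N k \<xi> * (cmod (f k \<xi>))\<^sup>2) \<partial>lborel"]) simp

lemma mode_square_le_fourier_energy: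
  "(\<integral>\<^sup>+ \<xi>. ennreal ((cmod (f k \<xi>))\<^sup>2) \<partial>lborel) \<le> fourier_energy N f"
proof -
  have "(cmod (f k \<xi>))\<^sup>2 \<le> sobolev_weight N k \<xi> * (cmod (f k \<xi>))\<^sup>2" for \<xi>
    using mult_right_mono[of 1 "sobolev_weight N k \<xi>" "(cmod (f k \<xi>))\<^sup>2"] by (simp add: one_le_power)
  then have "(\<integral>\<^sup>+ \<xi>. ennreal ((cmod (f k \<xi>))\<^sup>2) \<partial>lborel) \<le> (\<integral>\<^sup>+ \<xi>. ennreal (sobolev_weight N k \<xi> * (cmod (f k \<xi>))\<^sup>2) \<partial>lborel)"
    by (intro nn_integral_mono ennreal_leI)
  also have "\<dots> \<le> fourier_energy N f" by (rule mode_part_le_fourier_energy)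
  finally show ?thesis .
qed

lemma in_sobolevD:
  assumes "in_sobolev N u"
  shows "L2_cyl u" "is_fourier u (fourier_cyl u)" "fourier_energy N (fourier_cyl u) < \<infinity>"
    "fourier_cyl u k \<in> borel_measurable borel"
  using assms is_fourier_fourier_cyl[OF assms] is_fourierD(1)
  unfolding in_sobolev_def sobolev_energy_eq by auto

abbreviation fourier_diff :: "(real \<times> real \<Rightarrow> real) \<Rightarrow> (real \<times> real \<Rightarrow> real) \<Rightarrow> int \<Rightarrow> real \<Rightarrow> complex" where
  "fourier_diff u v \<equiv> (\<lambda>k \<xi>. fourier_cyl u k \<xi> - fourier_cyl v k \<xi>)"

lemma fourier_energy_diff_finite:
  assumes "in_sobolev N u" "in_sobolev N v"
  shows "fourier_energy N (fourier_diff u v) < \<infinity>"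
proof -
  have "fourier_energy N (fourier_diff u v) \<le>
      2 * fourier_energy N (fourier_cyl u) + 2 * fourier_energy N (fourier_cyl v)"
    by (rule fourier_energy_triangle) (auto intro: in_sobolevD assms norm_triangle_ineq4)
  also have "\<dots> < \<infinity>" using in_sobolevD(3)[OF assms(1)] in_sobolevD(3)[OF assms(2)] by (simp add: ennreal_mult_less_top)
  finally show ?thesis .
qed

lemma sobolev_norm_diff:
  assumes "in_sobolev N u" "in_sobolev N v"
  shows "(sobolev_norm N (\<lambda>p. u p - v p))\<^sup>2 =
    (2 * pi)\<^sup>2 * enn2real (fourier_energy N (fourier_diff u v))"
proof -
  note d = is_fourier_diff[OF in_sobolevD(1)[OF assms(1)] in_sobolevD(1)[OF assms(2)] in_sobolevD(2)[OF assms(1)] in_sobolevD(2)[OF assms(2)]]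
  then have "is_fourier (\<lambda>p. u p - v p) (fourier_cyl (\<lambda>p. u p - v p))"
    unfolding fourier_cyl_def[of "\<lambda>p. u p - v p"] by (rule someI[of "is_fourier (\<lambda>p. u p - v p)"])
  from is_fourier_unique[OF this d]
  have "sobolev_energy N (\<lambda>p. u p - v p) = fourier_energy N (fourier_diff u v)"
    unfolding sobolev_energy_eq by (intro fourier_energy_cong)
  then show ?thesis by (simp add: sobolev_norm_def power_mult_distrib)
qed

lemma continuous_in_sobolev_fourier:
  assumes c: "continuous_in_sobolev N u"
  defines "d \<equiv> (\<lambda>s t. enn2real (fourier_energy N (fourier_diff (u s) (u t))))"
  shows fourier_distance_triangle: "\<And>r s t. r \<in> {0..T} \<Longrightarrow> s \<in> {0..T} \<Longrightarrow> t \<in> {0..T} \<Longrightarrow> d s t \<le> 2 * d s r + 2 * d t r"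
    and fourier_distance_refl: "\<And>t. d t t = 0"
    and fourier_distance_tendsto: "\<And>t. t \<in> {0..T} \<Longrightarrow> ((\<lambda>s. d s t) \<longlongrightarrow> 0) (at t within {0..T})"
    and fourier_distance_energy: "\<And>s t. s \<in> {0..T} \<Longrightarrow> t \<in> {0..T} \<Longrightarrow>
      enn2real (fourier_energy N (fourier_cyl (u s))) \<le> 2 * d s t + 2 * enn2real (fourier_energy N (fourier_cyl (u t)))"
    and fourier_distance_ennreal: "\<And>s t. s \<in> {0..T} \<Longrightarrow> t \<in> {0..T} \<Longrightarrow>
      ennreal (d s t) = fourier_energy N (fourier_diff (u s) (u t))"
proof -
  have us: "in_sobolev N (u s)" if "s \<in> {0..T}" for s
    using c that unfolding continuous_in_sobolev_def by auto
  have meas: "(\<lambda>\<xi>. fourier_cyl (u s) k \<xi> - fourier_cyl (u t) k \<xi>) \<in> borel_measurable borel" if "s \<in> {0..T}" "t \<in> {0..T}" for s t k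
    using in_sobolevD(4)[OF us[OF that(1)]] in_sobolevD(4)[OF us[OF that(2)]] by measurable
  have fin: "fourier_energy N (fourier_diff (u s) (u t)) < \<infinity>"
    if "s \<in> {0..T}" "t \<in> {0..T}" for s t
    by (rule fourier_energy_diff_finite[OF us[OF that(1)] us[OF that(2)]])
  have real: "enn2real a \<le> 2 * enn2real b + 2 * enn2real c" if "a \<le> 2 * b + 2 * c" "b < \<infinity>" "c < \<infinity>" for a b c :: ennreal
  proof -
    have "enn2real a \<le> enn2real (2 * b + 2 * c)" by (rule enn2real_mono[OF that(1)]) (use that in \<open>auto simp: ennreal_mult_less_top\<close>)
    also have "\<dots> = 2 * enn2real b + 2 * enn2real c" using that by (simp add: enn2real_plus enn2real_mult ennreal_mult_less_top)
    finally show ?thesis .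
  qed
  show e: "ennreal (d s t) = fourier_energy N (fourier_diff (u s) (u t))"
    if "s \<in> {0..T}" "t \<in> {0..T}" for s t
    unfolding d_def using fin[OF that] by simp
  show "d s t \<le> 2 * d s r + 2 * d t r" if "r \<in> {0..T}" "s \<in> {0..T}" "t \<in> {0..T}" for r s t
    unfolding d_def
  proof (rule real)
    show "fourier_energy N (fourier_diff (u s) (u t)) \<le>
      2 * fourier_energy N (fourier_diff (u s) (u r)) +
      2 * fourier_energy N (fourier_diff (u t) (u r))"
    proof (rule fourier_energy_triangle)
      fix k \<xi>
      show "cmod (fourier_cyl (u s) k \<xi> - fourier_cyl (u t) k \<xi>) \<le> cmod (fourier_cyl (u s) k \<xi> - fourier_cyl (u r) k \<xi>) + cmod (fourier_cyl (u t) k \<xi> - fourier_cyl (u r) k \<xi>)"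
        using norm_triangle_ineq4[of "fourier_cyl (u s) k \<xi> - fourier_cyl (u r) k \<xi>" "fourier_cyl (u t) k \<xi> - fourier_cyl (u r) k \<xi>"] by simp
    qed (use that meas in auto)
  qed (use that fin in auto)
  show "d t t = 0" for t
    by (simp add: d_def fourier_energy_def)
  show "enn2real (fourier_energy N (fourier_cyl (u s))) \<le> 2 * d s t + 2 * enn2real (fourier_energy N (fourier_cyl (u t)))"
    if "s \<in> {0..T}" "t \<in> {0..T}" for s t
    unfolding d_def
  proof (rule real)
    show "fourier_energy N (fourier_cyl (u s)) \<le> 2 * fourier_energy N (fourier_diff (u s) (u t))
       + 2 * fourier_energy N (fourier_cyl (u t))"
    proof (rule fourier_energy_triangle)
      fix k \<xi>
      show "cmod (fourier_cyl (u s) k \<xi>) \<le> cmod (fourier_cyl (u s) k \<xi> - fourier_cyl (u t) k \<xi>) + cmod (fourier_cyl (u t) k \<xi>)"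
        using norm_triangle_ineq[of "fourier_cyl (u s) k \<xi> - fourier_cyl (u t) k \<xi>" "fourier_cyl (u t) k \<xi>"] by simp
    qed (use that meas in_sobolevD(4)[OF us] in auto)
  qed (use that fin in_sobolevD(3)[OF us] in auto)
  show "((\<lambda>s. d s t) \<longlongrightarrow> 0) (at t within {0..T})" if t: "t \<in> {0..T}" for t
  proof -
    have "((\<lambda>s. sobolev_norm N (\<lambda>p. u s p - u t p)) \<longlongrightarrow> 0) (at t within {0..})"
      using c t unfolding continuous_in_sobolev_def by auto
    then have "((\<lambda>s. sobolev_norm N (\<lambda>p. u s p - u t p)) \<longlongrightarrow> 0) (at t within {0..T})"
      by (rule tendsto_within_subset) auto
    then have "((\<lambda>s. (sobolev_norm N (\<lambda>p. u s p - u t p))\<^sup>2 / (2 * pi)\<^sup>2) \<longlongrightarrow> 0\<^sup>2 / (2 * pi)\<^sup>2) (at t within {0..T})"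
      by (intro tendsto_divide tendsto_power tendsto_const) auto
    then have "((\<lambda>s. (sobolev_norm N (\<lambda>p. u s p - u t p))\<^sup>2 / (2 * pi)\<^sup>2) \<longlongrightarrow> 0) (at t within {0..T})" by simp
    then show ?thesis
    proof (rule tendsto_cong[THEN iffD1, rotated])
      show "\<forall>\<^sub>F s in at t within {0..T}. (sobolev_norm N (\<lambda>p. u s p - u t p))\<^sup>2 / (2 * pi)\<^sup>2 = d s t"
      proof -
        have "(sobolev_norm N (\<lambda>p. u s p - u t p))\<^sup>2 / (2 * pi)\<^sup>2 = d s t" if "s \<in> {0..T}" for s
          unfolding sobolev_norm_diff[OF us[OF that] us[OF t]] d_def by simp
        then show ?thesis unfolding eventually_at by (intro exI[of _ 1]) auto
      qed
    qed
  qed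
qed

lemma tested_mode_continuous:
  assumes c: "continuous_in_sobolev N u"
  shows "continuous_on {0..T} (\<lambda>s. LINT \<xi>|lborel. fourier_cyl (u s) k \<xi> * gauss c \<xi>)"
proof -
  define d where "d s t = enn2real (fourier_energy N (fourier_diff (u s) (u t)))" for s t
  have us: "in_sobolev N (u s)" if "s \<in> {0..T}" for s
    using assms(1) that unfolding continuous_in_sobolev_def by auto
  obtain P where P: "(square_integral (\<lambda>\<xi>. ennreal (cmod (gauss c \<xi>)))) = ennreal P" "P \<ge> 0"
    using schwartz_square_finite[OF schwartz_gauss[of c]] by (cases "\<integral>\<^sup>+\<xi>. (ennreal (cmod (gauss c \<xi>)))\<^sup>2 \<partial>lborel") auto
  let ?F = "\<lambda>s. LINT \<xi>|lborel. fourier_cyl (u s) k \<xi> * gauss c \<xi>"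
  have le: "norm (?F s - ?F t) \<le> sqrt (d s t * P)" if st: "s \<in> {0..T}" "t \<in> {0..T}" for s t
  proof -
    note [measurable] = in_sobolevD(4)[OF us[OF st(1)], of k] in_sobolevD(4)[OF us[OF st(2)], of k]
    have i: "integrable lborel (\<lambda>\<xi>. fourier_cyl (u r) k \<xi> * gauss c \<xi>)" if "r \<in> {0..T}" for r
      by (rule is_fourierD(2)[OF in_sobolevD(2)[OF us[OF that]] schwartz_gauss])
    let ?D = "\<lambda>\<xi>. fourier_cyl (u s) k \<xi> - fourier_cyl (u t) k \<xi>"
    have "?F s - ?F t = (LINT \<xi>|lborel. ?D \<xi> * gauss c \<xi>)"
      using i st by (simp add: left_diff_distrib)
    then have "ennreal (norm (?F s - ?F t)) \<le> (\<integral>\<^sup>+\<xi>. ennreal (cmod (?D \<xi>)) * ennreal (cmod (gauss c \<xi>)) \<partial>lborel)"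
      using norm_integral_le_nn_integral[of lborel "\<lambda>\<xi>. ?D \<xi> * gauss c \<xi>"] by (simp add: norm_mult ennreal_mult)
    then have "(ennreal (norm (?F s - ?F t)))\<^sup>2 \<le> (\<integral>\<^sup>+\<xi>. ennreal (cmod (?D \<xi>)) * ennreal (cmod (gauss c \<xi>)) \<partial>lborel)\<^sup>2"
      by (rule power_mono) simp
    also have "\<dots> \<le> (square_integral (\<lambda>\<xi>. ennreal (cmod (?D \<xi>)))) * (square_integral (\<lambda>\<xi>. ennreal (cmod (gauss c \<xi>))))"
      by (rule Cauchy_Schwarz_nn_integral) measurable
    also have "\<dots> \<le> ennreal (d s t) * ennreal P"
      unfolding P(1) fourier_distance_ennreal[OF assms(1) st, folded d_def]
      using mode_square_le_fourier_energy[of "fourier_diff (u s) (u t)" k N]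
      by (intro mult_right_mono) (simp_all add: ennreal_power)
    finally have "ennreal ((norm (?F s - ?F t))\<^sup>2) \<le> ennreal (d s t * P)"
      using P(2) by (simp add: ennreal_power ennreal_mult d_def)
    then have "(norm (?F s - ?F t))\<^sup>2 \<le> d s t * P"
      using P(2) by (subst (asm) ennreal_le_iff) (auto simp: d_def)
    then show ?thesis by (rule real_le_rsqrt)
  qed
  show ?thesis
    unfolding continuous_on_def
  proof
    fix t assume t: "t \<in> {0..T}"
    have "((\<lambda>s. sqrt (d s t * P)) \<longlongrightarrow> sqrt (0 * P)) (at t within {0..T})"
      unfolding d_def by (intro tendsto_real_sqrt tendsto_mult tendsto_const fourier_distance_tendsto[OF assms(1) t])
    then have lim: "((\<lambda>s. sqrt (d s t * P)) \<longlongrightarrow> 0) (at t within {0..T})" by simp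
    have "((\<lambda>s. ?F s - ?F t) \<longlongrightarrow> 0) (at t within {0..T})"
    proof (rule Lim_null_comparison[OF _ lim])
      show "\<forall>\<^sub>F s in at t within {0..T}. norm (?F s - ?F t) \<le> sqrt (d s t * P)"
        unfolding eventually_at by (intro exI[of _ 1]) (use le t in auto)
    qed
    then show "(?F \<longlongrightarrow> ?F t) (at t within {0..T})" by (simp add: LIM_zero_iff)
  qed
qed

text \<open>All quantitative assumptions follow from continuity in \<open>H\<^sup>N\<close>: it is uniform on \<open>[0, T]\<close> and bounds
the norms there, and the \<open>L\<^sup>2\<close> distance of single modes is dominated by the \<open>H\<^sup>N\<close> distance.\<close>

lemma mode_flow_of_solution:
  assumes sol: "boussinesq_solution \<nu> T' N \<omega> \<theta> g" and \<nu>: "\<nu> > 0"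
    and rep: "character_representation T' M h" and T': "L_infinity T'"
    and S: "\<And>\<xi>. (\<integral>\<^sup>+\<eta>. ennreal (weight_ratio N (\<eta> + \<xi>) \<xi>) \<partial>M) \<le> ennreal S"
    and T: "T > 0"
  obtains U B where "mode_flow (\<nu> powr (1/3)) T k N M h (\<lambda>s. fourier_cyl (\<omega> s) k) (\<lambda>s. fourier_cyl (g s) k) S U B"
proof -
  have c\<omega>: "continuous_in_sobolev N \<omega>" and cg: "continuous_in_sobolev N g"
    and weak: "\<And>t. t \<ge> 0 \<Longrightarrow> weak_dx (\<theta> t) (g t)"
    using sol unfolding boussinesq_solution_def by auto
  have H\<omega>: "in_sobolev N (\<omega> s)" and Hg: "in_sobolev N (g s)" if "s \<in> {0..T}" for s
    using c\<omega> cg that unfolding continuous_in_sobolev_def by auto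
  define d where "d s t = enn2real (fourier_energy N (fourier_diff (\<omega> s) (\<omega> t)))" for s t
  note dist = fourier_distance_triangle[OF c\<omega>, where T = T, folded d_def] fourier_distance_refl[OF c\<omega>, folded d_def]
    fourier_distance_tendsto[OF c\<omega>, where T = T, folded d_def]
  obtain F where F: "F \<in> borel_measurable (borel \<Otimes>\<^sub>M borel)"
    "\<And>s. s \<in> {0..T} \<Longrightarrow> AE \<xi> in lborel. F (s, \<xi>) = fourier_cyl (\<omega> s) k \<xi>"
  proof (rule measurable_version)
    show "fourier_cyl (\<omega> s) k \<in> borel_measurable borel" if "s \<in> {0..T}" for s
      by (rule in_sobolevD(4)[OF H\<omega>[OF that]])
    fix e :: real assume "e > 0"
    from uniform_of_pointwise_on_interval[OF dist this]
    obtain r where r: "r > 0" "\<And>s t. s \<in> {0..T} \<Longrightarrow> t \<in> {0..T} \<Longrightarrow> \<bar>s - t\<bar> < r \<Longrightarrow> d s t \<le> e" by blast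
    have "(\<integral>\<^sup>+\<xi>. ennreal ((cmod (fourier_cyl (\<omega> s) k \<xi> - fourier_cyl (\<omega> t) k \<xi>))\<^sup>2) \<partial>lborel) \<le> ennreal e"
      if "s \<in> {0..T}" "t \<in> {0..T}" "\<bar>s - t\<bar> < r" for s t
    proof -
      have "(\<integral>\<^sup>+\<xi>. ennreal ((cmod (fourier_cyl (\<omega> s) k \<xi> - fourier_cyl (\<omega> t) k \<xi>))\<^sup>2) \<partial>lborel) \<le> ennreal (d s t)"
        unfolding fourier_distance_ennreal[OF c\<omega> that(1,2), folded d_def]
        by (rule mode_square_le_fourier_energy[of "fourier_diff (\<omega> s) (\<omega> t)"])
      also have "\<dots> \<le> ennreal e" by (intro ennreal_leI r that)
      finally show ?thesis .
    qed
    then show "\<exists>\<delta>>0. \<forall>s\<in>{0..T}. \<forall>t\<in>{0..T}. \<bar>s - t\<bar> < \<delta> \<longrightarrow>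
        (\<integral>\<^sup>+\<xi>. ennreal ((cmod (fourier_cyl (\<omega> s) k \<xi> - fourier_cyl (\<omega> t) k \<xi>))\<^sup>2) \<partial>lborel) \<le> ennreal e"
      using r(1) by blast
  qed blast
  define U where "U p = (if fst p \<in> {0..T} then F p else 0)" for p
  obtain B where B: "\<And>s. s \<in> {0..T} \<Longrightarrow> enn2real (fourier_energy N (fourier_cyl (\<omega> s))) \<le> B"
    using bounded_of_pointwise_on_interval[OF fourier_distance_energy[OF c\<omega>, where T = T, folded d_def] dist(2,3)] by metis
  have mode_le: "mode_energy N k (fourier_cyl v) \<le> 2 ^ N * fourier_energy N (fourier_cyl v)" if "in_sobolev N v" for v
    by (rule order_trans[OF mode_energy_le_fourier_energy(1)[of "fourier_cyl v"] mult_left_mono[OF mode_part_le_fourier_energy]])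
       (use in_sobolevD(4)[OF that] in auto)
  have \<delta>3: "(\<nu> powr (1/3)) ^ 3 = \<nu>" using \<nu> by (simp add: powr_power)
  have "mode_flow (\<nu> powr (1/3)) T k N M h (\<lambda>s. fourier_cyl (\<omega> s) k) (\<lambda>s. fourier_cyl (g s) k) S U (2 ^ N * B)"
  proof (rule mode_flow.intro)
    show "\<nu> powr (1/3) > 0" using \<nu> by simp
    show "T > 0" by fact
    show "sets M = sets borel" "finite_measure M" "h \<in> borel_measurable borel"
      using rep unfolding character_representation_def by auto
    show "cmod (h \<eta>) \<le> 1" for \<eta> using rep unfolding character_representation_def by auto
    show "(\<integral>\<^sup>+\<eta>. ennreal (weight_ratio N (\<eta> + \<xi>) \<xi>) \<partial>M) \<le> ennreal S" for \<xi> by (rule S)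
    show "fourier_cyl (\<omega> s) k \<in> borel_measurable borel" "fourier_cyl (g s) k \<in> borel_measurable borel" if "s \<in> {0..T}" for s
      using in_sobolevD(4) H\<omega>[OF that] Hg[OF that] by auto
    show "integrable lborel (\<lambda>\<xi>. fourier_cyl (\<omega> s) k \<xi> * gauss c \<xi>)" "integrable lborel (\<lambda>\<xi>. fourier_cyl (g s) k \<xi> * gauss c \<xi>)"
      if "s \<in> {0..T}" for s c
      using is_fourierD(2)[OF in_sobolevD(2)[OF H\<omega>[OF that]] schwartz_gauss] is_fourierD(2)[OF in_sobolevD(2)[OF Hg[OF that]] schwartz_gauss]
      by auto
    show "(square_integral (\<lambda>\<xi>. ennreal (mode_weight N k \<xi>) * ennreal (cmod (fourier_cyl (\<omega> s) k \<xi>)))) \<le> ennreal (2 ^ N * B)"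
      if s: "s \<in> {0..T}" for s
    proof -
      have "mode_energy N k (fourier_cyl (\<omega> s)) \<le> 2 ^ N * fourier_energy N (fourier_cyl (\<omega> s))"
        by (rule mode_le[OF H\<omega>[OF s]])
      also have "fourier_energy N (fourier_cyl (\<omega> s)) = ennreal (enn2real (fourier_energy N (fourier_cyl (\<omega> s))))"
        using in_sobolevD(3)[OF H\<omega>[OF s]] by simp
      also have "2 ^ N * \<dots> \<le> 2 ^ N * ennreal B" by (intro mult_left_mono ennreal_leI B s) simp
      also have "\<dots> = ennreal (2 ^ N * B)" by (simp add: ennreal_mult' ennreal_power[symmetric])
      finally show ?thesis by (simp add: mode_energy_def)
    qed
    have "mode_energy N k (fourier_cyl (g 0)) \<le> 2 ^ N * fourier_energy N (fourier_cyl (g 0))"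
      by (rule mode_le[OF Hg]) (use T in auto)
    also have "\<dots> < \<infinity>" using in_sobolevD(3)[OF Hg[of 0]] T by (simp add: ennreal_mult_less_top power_less_top_ennreal)
    finally show "(square_integral (\<lambda>\<xi>. ennreal (mode_weight N k \<xi>) * ennreal (cmod (fourier_cyl (g 0) k \<xi>)))) < \<infinity>"
      by (simp add: mode_energy_def)
    show "continuous_on {0..T} (\<lambda>s. LINT \<xi>|lborel. fourier_cyl (\<omega> s) k \<xi> * gauss c \<xi>)" for c
      by (rule tested_mode_continuous[OF c\<omega>])
    show "continuous_on {0..T} (\<lambda>s. LINT \<xi>|lborel. fourier_cyl (g s) k \<xi> * gauss c \<xi>)" for c
      by (rule tested_mode_continuous[OF cg])
    show "((\<lambda>s. LINT \<xi>|lborel. fourier_cyl (\<omega> s) k \<xi> * gauss c \<xi>) has_vector_derivative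
      (LINT \<xi>|lborel. (of_real (- ((\<nu> powr (1/3))^3 * (\<xi> - of_int k * t)\<^sup>2)) * fourier_cyl (\<omega> t) k \<xi> + fourier_cyl (g t) k \<xi>) * gauss c \<xi>)) (at t)"
      if "0 < t" for t c
      using vorticity_mode_equation[OF sol that, of k c] unfolding \<delta>3 by simp
    show "((\<lambda>s. LINT \<xi>|lborel. fourier_cyl (g s) k \<xi> * gauss c \<xi>) has_vector_derivative
      - (LINT \<eta>|M. h \<eta> * (LINT \<zeta>|lborel. of_real (dxx_inv_laplace_symbol t k \<zeta>) * fourier_cyl (\<omega> t) k \<zeta> * gauss c (\<zeta> + \<eta>)))) (at t)"
      if "0 < t" for t c
      by (rule temperature_mode_equation[OF sol rep T' that])
    show "AE \<xi> in lborel. fourier_cyl (g 0) k \<xi> = 0" if "k = 0"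
      unfolding that by (rule temperature_mean_mode_vanishes[OF weak in_sobolevD(2)[OF Hg]]) (use T in auto)
    have [measurable]: "F \<in> borel_measurable (borel \<Otimes>\<^sub>M borel)" by fact
    have "(\<lambda>p. if 0 \<le> fst p \<and> fst p \<le> T then F p else 0) \<in> borel_measurable (borel \<Otimes>\<^sub>M borel)" by measurable
    then show "U \<in> borel_measurable (borel \<Otimes>\<^sub>M borel)" by (simp add: U_def[abs_def])
    show "AE \<xi> in lborel. U (s, \<xi>) = fourier_cyl (\<omega> s) k \<xi>" if "s \<in> {0..T}" for s
      using F(2)[OF that] that by (simp add: U_def)
    show "U (s, \<xi>) = 0" if "s \<notin> {0..T}" for s \<xi>
      unfolding U_def fst_conv using that by (rule if_not_P)
  qed
  then show thesis by (rule that)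
qed

section \<open>Stability\<close>

text \<open>The estimate is summed over \<open>k\<close>. The constant may depend on \<open>\<nu>\<close> and \<open>N\<close>, so the change of weight and
the factor \<open>\<nu>\<close> in front of the temperature are absorbed into it.\<close>

lemma stable_of_mode_estimate:
  assumes \<nu>: "\<nu> > 0" and K: "K \<ge> 0"
    and est: "\<And>\<omega> \<theta> g t k. boussinesq_solution \<nu> T' N \<omega> \<theta> g \<Longrightarrow> t > 0 \<Longrightarrow>
      mode_energy N k (fourier_cyl (\<omega> t)) + mode_energy N k (fourier_cyl (g t)) \<le>
      ennreal K * (mode_energy N k (fourier_cyl (\<omega> 0)) + mode_energy N k (fourier_cyl (g 0)))"
  shows "boussinesq_stable \<nu> T' N"
proof -
  define L where "L = 2 ^ N * (K * 2 ^ N)"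
  have L0: "L \<ge> 0" using K by (simp add: L_def)
  define A where "A = (1 + \<nu>) * sqrt (2 * L) / min 1 \<nu>"
  have A0: "A \<ge> 0" using \<nu> L0 by (simp add: A_def)
  have main: "sobolev_norm N (\<omega> t) + \<nu> * sobolev_norm N (g t) \<le> A * (sobolev_norm N (\<omega> 0) + \<nu> * sobolev_norm N (g 0))"
    if sol: "boussinesq_solution \<nu> T' N \<omega> \<theta> g" and t: "t > 0" for \<omega> \<theta> g t
  proof -
    have H: "in_sobolev N (\<omega> s)" "in_sobolev N (g s)" if "s \<ge> 0" for s
      using sol that unfolding boussinesq_solution_def continuous_in_sobolev_def by auto
    let ?p = "\<lambda>k f. \<integral>\<^sup>+ \<xi>. ennreal (sobolev_weight N k \<xi> * (cmod (f k \<xi>))\<^sup>2) \<partial>lborel"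
    let ?e = "\<lambda>u. fourier_energy N (fourier_cyl u)"
    have two: "(2::ennreal) ^ N = ennreal (2 ^ N)" by (simp add: ennreal_power[symmetric])
    have pk: "?p k (fourier_cyl (\<omega> t)) + ?p k (fourier_cyl (g t)) \<le> ennreal L * (?p k (fourier_cyl (\<omega> 0)) + ?p k (fourier_cyl (g 0)))" for k :: int
    proof -
      have m: "fourier_cyl (\<omega> s) k \<in> borel_measurable borel" "fourier_cyl (g s) k \<in> borel_measurable borel" if "s \<ge> 0" for s
        using in_sobolevD(4) H[OF that] by auto
      have "?p k (fourier_cyl (\<omega> t)) + ?p k (fourier_cyl (g t)) \<le>
          2 ^ N * mode_energy N k (fourier_cyl (\<omega> t)) + 2 ^ N * mode_energy N k (fourier_cyl (g t))"
        by (intro add_mono mode_energy_le_fourier_energy(2) m) (use t in auto)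
      also have "\<dots> = 2 ^ N * (mode_energy N k (fourier_cyl (\<omega> t)) + mode_energy N k (fourier_cyl (g t)))"
        by (simp add: distrib_left)
      also have "\<dots> \<le> 2 ^ N * (ennreal K * (mode_energy N k (fourier_cyl (\<omega> 0)) + mode_energy N k (fourier_cyl (g 0))))"
        by (intro mult_left_mono est[OF sol t]) simp
      also have "\<dots> \<le> 2 ^ N * (ennreal K * (2 ^ N * ?p k (fourier_cyl (\<omega> 0)) + 2 ^ N * ?p k (fourier_cyl (g 0))))"
        by (intro mult_left_mono add_mono mode_energy_le_fourier_energy(1) m) auto
      also have "\<dots> = (2 ^ N * (ennreal K * 2 ^ N)) * (?p k (fourier_cyl (\<omega> 0)) + ?p k (fourier_cyl (g 0)))"
        by (simp only: distrib_left mult.assoc)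
      also have "2 ^ N * (ennreal K * 2 ^ N) = ennreal L" unfolding two L_def using K by (simp add: ennreal_mult)
      finally show ?thesis .
    qed
    have "?e (\<omega> t) + ?e (g t) = (\<integral>\<^sup>+k. ?p k (fourier_cyl (\<omega> t)) + ?p k (fourier_cyl (g t)) \<partial>count_space UNIV)"
      unfolding fourier_energy_def by (simp add: nn_integral_add)
    also have "\<dots> \<le> (\<integral>\<^sup>+k. ennreal L * (?p k (fourier_cyl (\<omega> 0)) + ?p k (fourier_cyl (g 0))) \<partial>count_space UNIV)"
      by (rule nn_integral_mono[OF pk])
    also have "\<dots> = ennreal L * (?e (\<omega> 0) + ?e (g 0))"
      unfolding fourier_energy_def by (simp add: nn_integral_add nn_integral_cmult)
    finally have E: "?e (\<omega> t) + ?e (g t) \<le> ennreal L * (?e (\<omega> 0) + ?e (g 0))" .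
    define r where "r u = enn2real (?e u)" for u
    have r: "?e u = ennreal (r u)" "r u \<ge> 0" if "in_sobolev N u" for u
      using in_sobolevD(3)[OF that] by (auto simp: r_def)
    note rr = r[OF H(1)] r[OF H(2)]
    have "r (\<omega> t) + r (g t) \<le> L * (r (\<omega> 0) + r (g 0))"
      using E rr[of t] rr[of 0] t L0 by (simp add: ennreal_mult[symmetric] ennreal_plus[symmetric] del: ennreal_plus)
    moreover have "r (\<omega> 0) + r (g 0) \<le> (sqrt (r (\<omega> 0)) + sqrt (r (g 0)))\<^sup>2"
      using rr[of 0] by (simp add: power2_sum)
    ultimately have sq: "r (\<omega> t) + r (g t) \<le> L * (sqrt (r (\<omega> 0)) + sqrt (r (g 0)))\<^sup>2"
      using L0 by (meson mult_left_mono order_trans)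
    let ?s = "sqrt (r (\<omega> 0)) + sqrt (r (g 0))"
    have s0: "?s \<ge> 0" using rr[of 0] by simp
    have "r (\<omega> t) \<le> 2 * L * ?s\<^sup>2" "r (g t) \<le> 2 * L * ?s\<^sup>2"
      using sq rr[of t] t L0 mult_nonneg_nonneg[OF L0 zero_le_power2[of ?s]] by auto
    then have "sqrt (r (\<omega> t)) \<le> sqrt (2 * L) * ?s" "sqrt (r (g t)) \<le> sqrt (2 * L) * ?s"
      using s0 by (metis real_sqrt_le_iff real_sqrt_mult real_sqrt_unique)+
    then have "sqrt (r (\<omega> t)) + \<nu> * sqrt (r (g t)) \<le> sqrt (2 * L) * ?s + \<nu> * (sqrt (2 * L) * ?s)"
      using \<nu> by (intro add_mono mult_left_mono) auto
    also have "\<dots> = ((1 + \<nu>) * sqrt (2 * L)) * ?s" by (simp add: algebra_simps)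
    also have "\<dots> \<le> ((1 + \<nu>) * sqrt (2 * L)) * ((sqrt (r (\<omega> 0)) + \<nu> * sqrt (r (g 0))) / min 1 \<nu>)"
    proof (intro mult_left_mono)
      have "min 1 \<nu> * sqrt (r (\<omega> 0)) + min 1 \<nu> * sqrt (r (g 0)) \<le> 1 * sqrt (r (\<omega> 0)) + \<nu> * sqrt (r (g 0))"
        using rr[of 0] by (intro add_mono mult_right_mono) auto
      then show "?s \<le> (sqrt (r (\<omega> 0)) + \<nu> * sqrt (r (g 0))) / min 1 \<nu>"
        using \<nu> by (simp add: le_divide_eq algebra_simps)
    qed (use \<nu> L0 in auto)
    also have "\<dots> = A * (sqrt (r (\<omega> 0)) + \<nu> * sqrt (r (g 0)))" by (simp add: A_def)
    finally have "2 * pi * (sqrt (r (\<omega> t)) + \<nu> * sqrt (r (g t))) \<le> 2 * pi * (A * (sqrt (r (\<omega> 0)) + \<nu> * sqrt (r (g 0))))"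
      by (rule mult_left_mono) simp
    then show ?thesis
      unfolding sobolev_norm_def sobolev_energy_eq r_def by (simp add: algebra_simps)
  qed
  define C where "C = (A + 1) * \<nu> powr (2/3)"
  have C: "C > 0" using A0 \<nu> by (simp add: C_def)
  have C\<nu>: "C * \<nu> powr (- (2/3)) = A + 1" using \<nu> by (simp add: C_def powr_minus field_simps)
  have "sobolev_norm N (\<omega> t) + \<nu> * sobolev_norm N (g t) \<le> C * \<nu> powr (- (2/3)) * (sobolev_norm N (\<omega> 0) + \<nu> * sobolev_norm N (g 0))"
    if "boussinesq_solution \<nu> T' N \<omega> \<theta> g" "t > 0" for \<omega> \<theta> g t
  proof -
    have "0 \<le> sobolev_norm N (\<omega> 0) + \<nu> * sobolev_norm N (g 0)" using \<nu> by (simp add: sobolev_norm_def)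
    then show ?thesis using main[OF that] unfolding C\<nu> by (simp add: distrib_right)
  qed
  then show ?thesis unfolding boussinesq_stable_def using C by blast
qed

lemma weight_ratio_le_weighted_variation:
  assumes M: "sets M = sets borel"
  shows "(\<integral>\<^sup>+\<eta>. ennreal (weight_ratio N (\<eta> + \<xi>) \<xi>) \<partial>M) \<le> weighted_variation \<nu> N M \<xi>"
proof -
  note [measurable_cong] = M
  have "weighted_variation \<nu> N M \<xi> = (\<integral>\<^sup>+\<eta>. ennreal (weight_ratio N (\<eta> + \<xi>) \<xi>
      * (1 + min (\<nu> powr (- (2/3))) (\<bar>(\<eta> + \<xi>) - \<xi>\<bar> powr (2/3)))) \<partial>M)"
    unfolding weighted_variation_def weight_ratio_def by (subst nn_integral_distr) auto
  also have "\<dots> \<ge> (\<integral>\<^sup>+\<eta>. ennreal (weight_ratio N (\<eta> + \<xi>) \<xi>) \<partial>M)"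
  proof (intro nn_integral_mono ennreal_leI)
    fix \<eta>
    have "weight_ratio N (\<eta> + \<xi>) \<xi> * 1 \<le> weight_ratio N (\<eta> + \<xi>) \<xi> * (1 + min (\<nu> powr (- (2/3))) (\<bar>(\<eta> + \<xi>) - \<xi>\<bar> powr (2/3)))"
      using weight_ratio_ge_1[of N "\<eta> + \<xi>" \<xi>] by (intro mult_left_mono) auto
    then show "weight_ratio N (\<eta> + \<xi>) \<xi> \<le> weight_ratio N (\<eta> + \<xi>) \<xi> * (1 + min (\<nu> powr (- (2/3))) (\<bar>(\<eta> + \<xi>) - \<xi>\<bar> powr (2/3)))" by simp
  qed
  finally show ?thesis .
qed

lemma stable_of_small_variation:
  assumes \<nu>: "\<nu> > 0" and T': "L_infinity T'" and F: "fourier_is_measure T' M h"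
    and small: "(SUP \<xi>. weighted_variation \<nu> N M \<xi>) < ennreal (1 / 100 * \<nu> powr (1/3))"
  shows "boussinesq_stable \<nu> T' N"
proof -
  define \<delta> where "\<delta> = \<nu> powr (1/3)"
  have \<delta>: "\<delta> > 0" using \<nu> by (simp add: \<delta>_def)
  define S where "S = \<delta> / 100"
  have M: "sets M = sets borel" using F by (simp add: fourier_is_measure_def)
  have S: "(\<integral>\<^sup>+\<eta>. ennreal (weight_ratio N (\<eta> + \<xi>) \<xi>) \<partial>M) \<le> ennreal S" for \<xi>
  proof -
    have "(\<integral>\<^sup>+\<eta>. ennreal (weight_ratio N (\<eta> + \<xi>) \<xi>) \<partial>M) \<le> weighted_variation \<nu> N M \<xi>"
      by (rule weight_ratio_le_weighted_variation[OF M])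
    also have "\<dots> \<le> (SUP \<xi>. weighted_variation \<nu> N M \<xi>)" by (rule SUP_upper) simp
    also have "\<dots> \<le> ennreal S" using small by (simp add: S_def \<delta>_def)
    finally show ?thesis .
  qed
  have "emeasure M UNIV = (\<integral>\<^sup>+\<eta>. 1 \<partial>M)" using sets_eq_imp_space_eq[OF M] by simp
  also have "\<dots> \<le> (\<integral>\<^sup>+\<eta>. ennreal (weight_ratio N (\<eta> + 0) 0) \<partial>M)"
    using weight_ratio_ge_1 by (intro nn_integral_mono) (auto simp: ennreal_1[symmetric] simp del: ennreal_1 intro!: ennreal_leI)
  also have "\<dots> \<le> ennreal S" by (rule S)
  finally have fin: "emeasure M UNIV < \<infinity>" by (rule le_less_trans) simp
  obtain h0 where rep: "character_representation T' M h0"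
    by (rule character_representation_of_fourier[OF T' F fin])
  \<comment> \<open>With \<open>S = \<delta> / 100\<close> the product is at most \<open>20 / 100\<close>, and \<open>3 / 25 \<le> 1 / 2\<close>.\<close>
  have "pi * (1 + pi) \<le> 4 * 5" using pi_less_4 by (intro mult_mono) auto
  then have "(pi * ((1 + pi) / \<delta>) * S) \<le> 1 / 5" using \<delta> by (simp add: S_def)
  moreover have "0 \<le> pi * ((1 + pi) / \<delta>) * S" using \<delta> by (simp add: S_def)
  ultimately have "(pi * ((1 + pi) / \<delta>) * S)\<^sup>2 \<le> (1 / 5)\<^sup>2" by (intro power_mono)
  then have "3 * (pi * ((1 + pi) / \<delta>) * S)\<^sup>2 \<le> 3 * (1 / 5)\<^sup>2" by (rule mult_left_mono) simp
  also have "\<dots> \<le> (1 / 2 :: real)" by (simp add: power2_eq_square)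
  finally have sm: "3 * (pi * ((1 + pi) / \<delta>) * S)\<^sup>2 \<le> 1 / 2" .
  have S0: "S \<ge> 0" using \<delta> by (simp add: S_def)
  define K where "K = 3 * (1 + ((1 + pi) / \<delta>)\<^sup>2) * (1 + 6 * S\<^sup>2 * pi\<^sup>2 * (1 + ((1 + pi) / \<delta>)\<^sup>2))"
  show ?thesis
  proof (rule stable_of_mode_estimate[OF \<nu>])
    show "K \<ge> 0" unfolding K_def by (intro mult_nonneg_nonneg add_nonneg_nonneg) auto
    fix \<omega> \<theta> g t k assume sol: "boussinesq_solution \<nu> T' N \<omega> \<theta> g" and t: "(t::real) > 0"
    obtain U B where "mode_flow \<delta> t k N M h0 (\<lambda>s. fourier_cyl (\<omega> s) k) (\<lambda>s. fourier_cyl (g s) k) S U B"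
      using mode_flow_of_solution[OF sol \<nu> rep T' S t] unfolding \<delta>_def by blast
    then interpret mode_flow \<delta> t k N M h0 "\<lambda>s. fourier_cyl (\<omega> s) k" "\<lambda>s. fourier_cyl (g s) k" S U B .
    show "mode_energy N k (fourier_cyl (\<omega> t)) + mode_energy N k (fourier_cyl (g t)) \<le>
      ennreal K * (mode_energy N k (fourier_cyl (\<omega> 0)) + mode_energy N k (fourier_cyl (g 0)))"
      unfolding mode_energy_def by (rule mode_estimate_small[OF S0 sm _ K_def]) (use t in auto)
  qed
qed

lemma stable_of_linear_profile:
  assumes \<nu>: "\<nu> > 0" and T': "L_infinity T'" and const: "AE y in lborel. T' y = \<alpha>"
  shows "boussinesq_stable \<nu> T' N"
proof -
  define \<delta> where "\<delta> = \<nu> powr (1/3)"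
  have \<delta>: "\<delta> > 0" using \<nu> by (simp add: \<delta>_def)
  \<comment> \<open>The transform of the constant \<open>\<alpha>\<close> in polar form.\<close>
  define M where "M = density (return borel (0::real)) (\<lambda>_. ennreal \<bar>\<alpha>\<bar>)"
  define h where "h = (\<lambda>_::real. complex_of_real (sgn \<alpha>))"
  have M: "sets M = sets borel" by (simp add: M_def)
  have "emeasure M (space M) < \<infinity>"
    by (simp add: M_def emeasure_density nn_integral_cmult)
  then have fin: "finite_measure M" by (intro finite_measureI) auto
  have local: "(LINT \<eta>|M. h \<eta> * f \<eta>) = of_real \<alpha> * f 0" if [measurable]: "f \<in> borel_measurable borel" for f
  proof -
    have "(LINT \<eta>|M. h \<eta> * f \<eta>) = (LINT \<eta>|return borel 0. \<bar>\<alpha>\<bar> *\<^sub>R (h \<eta> * f \<eta>))"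
      unfolding M_def by (rule integral_density) (auto simp: h_def)
    also have "\<dots> = \<bar>\<alpha>\<bar> *\<^sub>R (h 0 * f 0)"
      by (rule integral_return) (auto simp: h_def)
    also have "\<dots> = of_real (\<bar>\<alpha>\<bar> * sgn \<alpha>) * f 0" by (simp add: h_def scaleR_conv_of_real)
    finally show ?thesis by (simp add: mult.commute[of "\<bar>\<alpha>\<bar>"] sgn_mult_abs)
  qed
  have rep: "character_representation T' M h"
    unfolding character_representation_def
  proof (intro conjI allI)
    show "AE y in lborel. of_real (T' y) = (LINT \<eta>|M. h \<eta> * cis (\<eta> * y))"
      using const by eventually_elim (subst local; simp)
  qed (use M fin in \<open>auto simp: h_def sgn_if\<close>)
  define S where "S = \<bar>\<alpha>\<bar> * 2 ^ N"
  have S: "(\<integral>\<^sup>+\<eta>. ennreal (weight_ratio N (\<eta> + \<xi>) \<xi>) \<partial>M) \<le> ennreal S" for \<xi>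
  proof -
    have "(\<integral>\<^sup>+\<eta>. ennreal (weight_ratio N (\<eta> + \<xi>) \<xi>) \<partial>M) = ennreal \<bar>\<alpha>\<bar> * ennreal (weight_ratio N (0 + \<xi>) \<xi>)"
      unfolding M_def by (subst nn_integral_density) (auto simp: nn_integral_return)
    also have "weight_ratio N (0 + \<xi>) \<xi> = 2 ^ N" by (simp add: weight_ratio_def)
    finally show ?thesis by (simp add: S_def ennreal_mult')
  qed
  define K1 where "K1 = 2 * exp ((2 * \<bar>\<alpha>\<bar> * ((1 + pi) / \<delta>) + 1) * pi)"
  define K where "K = 3 * ((1 + K1 * (\<bar>\<alpha>\<bar> * pi) * ((1 + pi) / \<delta>))\<^sup>2 + (K1 * ((1 + pi) / \<delta>))\<^sup>2 + (K1 * (\<bar>\<alpha>\<bar> * pi))\<^sup>2 + K1\<^sup>2)"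
  show ?thesis
  proof (rule stable_of_mode_estimate[OF \<nu>])
    show "K \<ge> 0" unfolding K_def by (intro mult_nonneg_nonneg add_nonneg_nonneg) auto
    fix \<omega> \<theta> g t k assume sol: "boussinesq_solution \<nu> T' N \<omega> \<theta> g" and t: "(t::real) > 0"
    obtain U B where "mode_flow \<delta> t k N M h (\<lambda>s. fourier_cyl (\<omega> s) k) (\<lambda>s. fourier_cyl (g s) k) S U B"
      using mode_flow_of_solution[OF sol \<nu> rep T' S t] unfolding \<delta>_def by blast
    then interpret mode_flow \<delta> t k N M h "\<lambda>s. fourier_cyl (\<omega> s) k" "\<lambda>s. fourier_cyl (g s) k" S U B .
    show "mode_energy N k (fourier_cyl (\<omega> t)) + mode_energy N k (fourier_cyl (g t)) \<le>
      ennreal K * (mode_energy N k (fourier_cyl (\<omega> 0)) + mode_energy N k (fourier_cyl (g 0)))"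
      unfolding mode_energy_def by (rule mode_estimate_local[OF local K1_def _ K_def]) (use t in auto)
  qed
qed

theorem theorem1p1:
  fixes \<nu> :: real and T T' :: "real \<Rightarrow> real" and N :: nat
  assumes "\<nu> > 0"
    and "has_density_derivative T T'"
    and "L_infinity T'"
  shows "(\<forall>M h. fourier_is_measure T' M h \<and>
            (SUP \<xi>. weighted_variation \<nu> N M \<xi>) < ennreal (1 / 100 * \<nu> powr (1/3))
            \<longrightarrow> boussinesq_stable \<nu> T' N)
       \<and> (\<forall>\<alpha>::real. T = (\<lambda>y. \<alpha> * y) \<and> \<alpha> > - (1 / 100 * \<nu> powr (1/3)) \<longrightarrow> boussinesq_stable \<nu> T' N)"
proof (intro conjI allI impI)
  fix M h
  assume "fourier_is_measure T' M h \<and> (SUP \<xi>. weighted_variation \<nu> N M \<xi>) < ennreal (1 / 100 * \<nu> powr (1/3))"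
  then show "boussinesq_stable \<nu> T' N" using stable_of_small_variation[OF assms(1,3)] by blast
next
  fix \<alpha> :: real
  assume "T = (\<lambda>y. \<alpha> * y) \<and> \<alpha> > - (1 / 100 * \<nu> powr (1/3))"
  then have "has_density_derivative (\<lambda>y. \<alpha> * y) T'" using assms(2) by simp
  from constant_of_linear_profile[OF this assms(3)]
  show "boussinesq_stable \<nu> T' N" by (rule stable_of_linear_profile[OF assms(1,3)])
qed

end
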